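(* Let $k$ be an infinite field, and let $p:=\operatorname{char}k$ if this is positive and $p:=\infty$ otherwise. Let $U$ and $V$ be finite dimensional representations over $k$ of a finite group $G$. Let $n$ be an integer with $n\ge\max\left(\dim V,\frac{\beta_k(G)}{p-1}\right)$ and let $S$ be a generating set of the $k$-algebra $k[U\oplus V^{\oplus n}]^G$. Then for any $m\ge n$ the polarization of $S$, i.e. the $GL(m)$-submodule of $k[U\oplus V^{\oplus m}]$ generated by $S$, generates the ring of invariants $k[U\oplus V^{\oplus m}]^G$ as a $k$-algebra.
   Context: $k[W]$ denotes the ring of polynomial functions on a finite dimensional vector space $W$. $GL(m)=GL_m(k)$ acts on $V^{\oplus m}=V\otimes_kk^m$ via $k^m$ and trivially on $U$; this action on $U\oplus V^{\oplus m}$ commutes with $G$. For $n\le m$, $U\oplus V^{\oplus n}$ is regarded as the quotient of $U\oplus V^{\oplus m}$ obtained by forgetting the last $m-n$ copies of $V$, so that $k[U\oplus V^{\oplus n}]\subseteq k[U\oplus V^{\oplus m}]$ by pullback. For an $\mathbb N$-graded commutative ring $A=\bigoplus_{d\ge0}A_d$ put $\beta(A):=\inf\{n\in\mathbb N\mid A\text{ is generated as a ring by }\bigoplus_{d=0}^nA_d\}$ (with $\inf\emptyset=\infty$). $\beta_k(G):=\sup_A\beta(A^G)\in\mathbb N\cup\{\infty\}$, where $A$ runs through all $\mathbb N$-graded commutative $k$-algebras with a $G$-action (by degree-preserving $k$-algebra automorphisms) and with $\beta(A)\le1$. If $\operatorname{char}k=0$ (so $p=\infty$), then $\frac{\beta_k(G)}{p-1}$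 is read as $0$. *)

theory Defs
  imports
    "HOL-Algebra.Algebraic_Closure_Type"
    "HOL-Algebra.Generated_Rings"
    "HOL-Algebra.Group_Action"
    "HOL-Algebra.Module"
    "HOL-Library.Extended_Real"
    "HOL-Library.Function_Algebras"
    "HOL-Library.Poly_Mapping"
    "HOL-Library.Product_Plus"
    "Jordan_Normal_Form.Matrix"
begin

section \<open>Graded algebras and the number $\beta_k(G)$\<close>

locale graded_algebra = algebra "ring_of_type_algebra :: 'k::field ring" A
  for A :: "('k::field, 'a) module" (structure) +
  fixes gr :: "nat \<Rightarrow> 'a set"
  assumes gr_submodule: "submodule (gr d) (ring_of_type_algebra :: 'k ring) A"
    and one_gr: "\<one>\<^bsub>A\<^esub> \<in> gr 0"
    and mult_gr: "\<lbrakk>x \<in> gr d; y \<in> gr e\<rbrakk> \<Longrightarrow> x \<otimes>\<^bsub>A\<^esub> y \<in> gr (d + e)"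
    and decomposition: "x \<in> carrier A \<Longrightarrow>
      \<exists>!f. (\<forall>d. f d \<in> gr d) \<and> finite {d. f d \<noteq> \<zero>\<^bsub>A\<^esub>} \<and>
           x = (\<Oplus>\<^bsub>A\<^esub>d\<in>{d. f d \<noteq> \<zero>\<^bsub>A\<^esub>}. f d)"

definition beta :: "('a, 'b) ring_scheme \<Rightarrow> (nat \<Rightarrow> 'a set) \<Rightarrow> enat" where
  "beta A gr = Inf (enat ` {n. generate_ring A
     {(\<Oplus>\<^bsub>A\<^esub>d\<in>{..n}. f d) | f. \<forall>d\<le>n. f d \<in> gr d} = carrier A})"

locale graded_G_algebra =
  graded_algebra A gr + group_action G "carrier A" \<phi>
  for A :: "('k::field, 'a) module" (structure) and gr
    and G :: "('g, 'x) monoid_scheme" and \<phi> +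
  assumes action_ring_hom: "g \<in> carrier G \<Longrightarrow> \<phi> g \<in> Ring.ring_hom A A"
    and action_smult: "\<lbrakk>g \<in> carrier G; x \<in> carrier A\<rbrakk> \<Longrightarrow> \<phi> g (c \<odot>\<^bsub>A\<^esub> x) = c \<odot>\<^bsub>A\<^esub> \<phi> g x"
    and action_gr: "\<lbrakk>g \<in> carrier G; x \<in> gr d\<rbrakk> \<Longrightarrow> \<phi> g x \<in> gr d"

definition invariant_elements ::
    "('g, 'x) monoid_scheme \<Rightarrow> ('g \<Rightarrow> 'a \<Rightarrow> 'a) \<Rightarrow> ('a, 'b) ring_scheme \<Rightarrow> 'a set" where
  "invariant_elements G \<phi> A = {x \<in> carrier A. \<forall>g\<in>carrier G. \<phi> g x = x}"

definition beta_invariants ::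
    "('g, 'x) monoid_scheme \<Rightarrow> ('g \<Rightarrow> 'a \<Rightarrow> 'a) \<Rightarrow> ('k::field, 'a) module \<Rightarrow>
     (nat \<Rightarrow> 'a set) \<Rightarrow> enat" where
  "beta_invariants G \<phi> A gr =
     beta (A\<lparr>carrier := invariant_elements G \<phi> A\<rparr>) (\<lambda>d. gr d \<inter> invariant_elements G \<phi> A)"

text \<open>
  The carrier of an algebra lives in some type, so a supremum over all algebras has to name one.
  The type of finitely supported functions from the natural numbers to the field only serves as a
  universe of sets: every countably generated $k$-algebra has countable dimension, hence is
  isomorphic to one with carrier inside this type. Nothing is lost: for a finite group the number
  bounds the invariants of algebras with carrier in any type, see \<open>beta_group_upper\<close> below.
\<close>

definition beta_group :: "('g, 'x) monoid_scheme \<Rightarrow> 'k::field itself \<Rightarrow> enat" where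
  "beta_group G K = Sup {beta_invariants G \<phi> A gr |
     (A :: ('k, nat \<Rightarrow>\<^sub>0 'k) module) gr \<phi>.
     graded_G_algebra A gr G \<phi> \<and> beta A gr \<le> 1}"


section \<open>Polynomial functions on $U \oplus V^{\oplus m}$\<close>

definition representation ::
    "('g, 'x) monoid_scheme \<Rightarrow> ('k::field \<Rightarrow> 'w::ab_group_add \<Rightarrow> 'w) \<Rightarrow> ('g \<Rightarrow> 'w \<Rightarrow> 'w) \<Rightarrow> bool" where
  "representation G s \<rho> \<longleftrightarrow> (\<exists>B. finite_dimensional_vector_space s B) \<and>
     group_action G UNIV \<rho> \<and> (\<forall>g\<in>carrier G. Vector_Spaces.linear s s (\<rho> g))"

inductive_set algebra_generated :: "('w \<Rightarrow> 'k::comm_ring_1) set \<Rightarrow> ('w \<Rightarrow> 'k) set"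
  for S where
    const: "(\<lambda>_. c) \<in> algebra_generated S"
  | incl: "f \<in> S \<Longrightarrow> f \<in> algebra_generated S"
  | add: "\<lbrakk>f \<in> algebra_generated S; h \<in> algebra_generated S\<rbrakk> \<Longrightarrow> f + h \<in> algebra_generated S"
  | mult: "\<lbrakk>f \<in> algebra_generated S; h \<in> algebra_generated S\<rbrakk> \<Longrightarrow> f * h \<in> algebra_generated S"

text \<open>
  All spaces $U \oplus V^{\oplus m}$ are treated simultaneously as quotients of $U \oplus V^{\mathbb N}$,
  by forgetting all copies of $V$ but the first $m$; functions on the quotient are identified with
  their pullbacks. This makes the inclusions $k[U \oplus V^{\oplus n}] \subseteq k[U \oplus V^{\oplus m}]$
  literal.
\<close>

definition scale_sum ::
    "('k \<Rightarrow> 'u \<Rightarrow> 'u) \<Rightarrow> ('k \<Rightarrow> 'v \<Rightarrow> 'v) \<Rightarrow> 'k \<Rightarrow> 'u \<times> (nat \<Rightarrow> 'v) \<Rightarrow> 'u \<times> (nat \<Rightarrow> 'v)" where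
  "scale_sum sU sV c = (\<lambda>(u, v). (sU c u, \<lambda>i. sV c (v i)))"

definition linear_functionals ::
    "('k::field \<Rightarrow> 'u::ab_group_add \<Rightarrow> 'u) \<Rightarrow> ('k \<Rightarrow> 'v::ab_group_add \<Rightarrow> 'v) \<Rightarrow> nat \<Rightarrow>
     ('u \<times> (nat \<Rightarrow> 'v) \<Rightarrow> 'k) set" where
  "linear_functionals sU sV m = {l. Vector_Spaces.linear (scale_sum sU sV) (*) l \<and>
     (\<forall>u v v'. (\<forall>i<m. v i = v' i) \<longrightarrow> l (u, v) = l (u, v'))}"

definition polynomial_functions ::
    "('k::field \<Rightarrow> 'u::ab_group_add \<Rightarrow> 'u) \<Rightarrow> ('k \<Rightarrow> 'v::ab_group_add \<Rightarrow> 'v) \<Rightarrow> nat \<Rightarrow>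
     ('u \<times> (nat \<Rightarrow> 'v) \<Rightarrow> 'k) set" where
  "polynomial_functions sU sV m = algebra_generated (linear_functionals sU sV m)"

definition function_action ::
    "('g, 'x) monoid_scheme \<Rightarrow> ('g \<Rightarrow> 'w \<Rightarrow> 'w) \<Rightarrow> 'g \<Rightarrow> ('w \<Rightarrow> 'k) \<Rightarrow> 'w \<Rightarrow> 'k" where
  "function_action H act g f = (\<lambda>w. f (act (inv\<^bsub>H\<^esub> g) w))"

definition diagonal_action ::
    "('g \<Rightarrow> 'u \<Rightarrow> 'u) \<Rightarrow> ('g \<Rightarrow> 'v \<Rightarrow> 'v) \<Rightarrow> 'g \<Rightarrow> 'u \<times> (nat \<Rightarrow> 'v) \<Rightarrow> 'u \<times> (nat \<Rightarrow> 'v)" where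
  "diagonal_action \<rho> \<sigma> g = (\<lambda>(u, v). (\<rho> g u, \<lambda>i. \<sigma> g (v i)))"

definition invariant_polynomials ::
    "('g, 'x) monoid_scheme \<Rightarrow>
     ('k::field \<Rightarrow> 'u::ab_group_add \<Rightarrow> 'u) \<Rightarrow> ('g \<Rightarrow> 'u \<Rightarrow> 'u) \<Rightarrow>
     ('k \<Rightarrow> 'v::ab_group_add \<Rightarrow> 'v) \<Rightarrow> ('g \<Rightarrow> 'v \<Rightarrow> 'v) \<Rightarrow> nat \<Rightarrow>
     ('u \<times> (nat \<Rightarrow> 'v) \<Rightarrow> 'k) set" where
  "invariant_polynomials G sU \<rho> sV \<sigma> m = {f \<in> polynomial_functions sU sV m.
     \<forall>g\<in>carrier G. function_action G (diagonal_action \<rho> \<sigma>) g f = f}"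


section \<open>The action of $GL(m)$ and polarization\<close>

definition GL :: "nat \<Rightarrow> 'k::field mat monoid" where
  "GL m = units_of (ring_mat TYPE('k) m ())"

text \<open>
  A tuple \<open>v\<close> stands for $\sum_{j<m} v_j \otimes e_j$, on which a matrix acts through $e_j$; this
  gives the formula below. Values at indices outside the first $m$ are irrelevant to functions on
  $U \oplus V^{\oplus m}$.
\<close>

definition GL_action ::
    "('k::field \<Rightarrow> 'v::ab_group_add \<Rightarrow> 'v) \<Rightarrow> nat \<Rightarrow> 'k mat \<Rightarrow> 'u \<times> (nat \<Rightarrow> 'v) \<Rightarrow> 'u \<times> (nat \<Rightarrow> 'v)" where
  "GL_action sV m a = (\<lambda>(u, v). (u, \<lambda>i. if i < m then \<Sum>j<m. sV (a $$ (i, j)) (v j) else v i))"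

definition GL_submodule ::
    "('k::field \<Rightarrow> 'u::ab_group_add \<Rightarrow> 'u) \<Rightarrow> ('k \<Rightarrow> 'v::ab_group_add \<Rightarrow> 'v) \<Rightarrow> nat \<Rightarrow>
     ('u \<times> (nat \<Rightarrow> 'v) \<Rightarrow> 'k) set \<Rightarrow> bool" where
  "GL_submodule sU sV m M \<longleftrightarrow> M \<subseteq> polynomial_functions sU sV m \<and>
     module.subspace (\<lambda>c f w. c * f w) M \<and>
     (\<forall>a\<in>carrier (GL m). \<forall>f\<in>M. function_action (GL m) (GL_action sV m) a f \<in> M)"

definition polarization ::
    "('k::field \<Rightarrow> 'u::ab_group_add \<Rightarrow> 'u) \<Rightarrow> ('k \<Rightarrow> 'v::ab_group_add \<Rightarrow> 'v) \<Rightarrow> nat \<Rightarrow>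
     ('u \<times> (nat \<Rightarrow> 'v) \<Rightarrow> 'k) set \<Rightarrow> ('u \<times> (nat \<Rightarrow> 'v) \<Rightarrow> 'k) set" where
  "polarization sU sV m S = GL_submodule sU sV m hull S"


section \<open>Independence of $\beta_k(G)$ from the universe of carriers\<close>

text \<open>
  An invariant of an arbitrary algebra lies in a $G$-stable graded subalgebra generated by finitely
  many elements of degree at most one; this subalgebra is copied into the universe of
  \<open>beta_group\<close>.
\<close>

lemma generate_ring_hom:
  assumes "ring R" "ring S" "h \<in> Ring.ring_hom R S" "H \<subseteq> carrier R"
  shows "generate_ring S (h ` H) = h ` generate_ring R H"
proof -
  interpret ring_hom_ring R S h using assms(1-3) by (rule ring_hom_ringI2)
  have c: "x \<in> generate_ring R H \<Longrightarrow> x \<in> carrier R" for x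
    by (rule R.generate_ring_in_carrier[OF assms(4)])
  show ?thesis
  proof (intro equalityI subsetI)
    fix x assume "x \<in> generate_ring S (h ` H)"
    then show "x \<in> h ` generate_ring R H"
    proof (induction rule: generate_ring.induct)
      case one
      show ?case using hom_one generate_ring.one[of R H] by (metis image_eqI)
    next
      case (incl x)
      then show ?case by (auto intro: generate_ring.incl)
    next
      case (a_inv x)
      then obtain y where y: "y \<in> generate_ring R H" "x = h y" by auto
      then have "\<ominus>\<^bsub>S\<^esub> x = h (\<ominus>\<^bsub>R\<^esub> y)" using c by simp
      then show ?case using y by (auto intro: generate_ring.a_inv)
    next
      case (eng_add x x')
      then obtain y y' where y: "y \<in> generate_ring R H" "x = h y" "y' \<in> generate_ring R H" "x' = h y'"
        by auto
      then have "x \<oplus>\<^bsub>S\<^esub> x' = h (y \<oplus>\<^bsub>R\<^esub> y')" using c by simp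
      then show ?case using y by (auto intro: generate_ring.eng_add)
    next
      case (eng_mult x x')
      then obtain y y' where y: "y \<in> generate_ring R H" "x = h y" "y' \<in> generate_ring R H" "x' = h y'"
        by auto
      then have "x \<otimes>\<^bsub>S\<^esub> x' = h (y \<otimes>\<^bsub>R\<^esub> y')" using c by simp
      then show ?case using y by (auto intro: generate_ring.eng_mult)
    qed
  next
    fix x assume "x \<in> h ` generate_ring R H"
    then obtain y where y: "y \<in> generate_ring R H" "x = h y" by auto
    from y(1) have "h y \<in> generate_ring S (h ` H)"
    proof (induction rule: generate_ring.induct)
      case one
      show ?case using generate_ring.one[of S] by simp
    next
      case (incl x)
      then show ?case by (auto intro: generate_ring.incl)
    next
      case (a_inv x)
      then show ?case using c[OF a_inv(1)] by (simp add: generate_ring.a_inv)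
    next
      case (eng_add x x')
      then show ?case using c[OF eng_add(1)] c[OF eng_add(2)] by (simp add: generate_ring.eng_add)
    next
      case (eng_mult x x')
      then show ?case using c[OF eng_mult(1)] c[OF eng_mult(2)] by (simp add: generate_ring.eng_mult)
    qed
    then show "x \<in> generate_ring S (h ` H)" using y by simp
  qed
qed

lemma generate_ring_upto:
  fixes gr :: "nat \<Rightarrow> 'a set" and R :: "('a, 'b) ring_scheme"
  assumes "ring R" "\<And>d. gr d \<subseteq> carrier R" "\<And>d. \<zero>\<^bsub>R\<^esub> \<in> gr d"
  shows "generate_ring R {(\<Oplus>\<^bsub>R\<^esub>d\<in>{..n}. f d) | f. \<forall>d\<le>n. f d \<in> gr d} =
    generate_ring R (\<Union>d\<le>n. gr d)" (is "generate_ring R ?D = generate_ring R ?U")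
proof -
  interpret ring R by fact
  have U: "?U \<subseteq> carrier R" using assms(2) by blast
  have sums: "(\<Oplus>\<^bsub>R\<^esub>d\<in>I. f d) \<in> generate_ring R ?U"
    if "finite I" "I \<subseteq> {..n}" "\<forall>d\<le>n. f d \<in> gr d" for f :: "nat \<Rightarrow> 'a" and I
    using that(1,2)
  proof (induction I)
    case empty
    then show ?case using zero_in_generate by simp
  next
    case (insert i I)
    have fc: "f \<in> I \<rightarrow> carrier R" "f i \<in> carrier R"
      using insert(4) that(3) assms(2) by blast+
    have "f i \<in> generate_ring R ?U"
      using insert(4) that(3) by (auto intro!: generate_ring.incl)
    then show ?case using insert fc by (simp add: generate_ring.eng_add)
  qed
  have DU: "?D \<subseteq> generate_ring R ?U" using sums by blast
  then have D: "?D \<subseteq> carrier R" using generate_ring_incl[OF U] by blast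
  have "?U \<subseteq> ?D"
  proof
    fix x assume "x \<in> ?U"
    then obtain e where e: "e \<le> n" "x \<in> gr e" by auto
    have x: "x \<in> carrier R" using e assms(2) by blast
    let ?f = "\<lambda>d. if e = d then x else \<zero>\<^bsub>R\<^esub>"
    have "(\<Oplus>\<^bsub>R\<^esub>d\<in>{..n}. ?f d) = x"
      using add.finprod_singleton[of e "{..n}" "\<lambda>_. x"] e x by simp
    moreover have "\<forall>d\<le>n. ?f d \<in> gr d" using e assms(3) by auto
    ultimately show "x \<in> ?D" by (smt (verit, best) mem_Collect_eq)
  qed
  then have "generate_ring R ?U \<subseteq> generate_ring R ?D" using D by (rule mono_generate_ring)
  moreover have "generate_ring R ?D \<subseteq> generate_ring R ?U"
    by (rule generate_ring_min_subring1[OF D generate_ring_is_subring[OF U] DU])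
  ultimately show ?thesis by blast
qed

lemma beta_le_iff:
  assumes "ring R" "\<And>d. gr d \<subseteq> carrier R" "\<And>d. \<zero>\<^bsub>R\<^esub> \<in> gr d"
  shows "beta R gr \<le> enat n \<longleftrightarrow> generate_ring R (\<Union>d\<le>n. gr d) = carrier R"
proof -
  interpret ring R by fact
  let ?N = "{n. generate_ring R (\<Union>d\<le>n. gr d) = carrier R}"
  have b: "beta R gr = Inf (enat ` ?N)"
    unfolding beta_def by (simp add: generate_ring_upto[where gr = gr, OF assms])
  have mono: "n \<in> ?N" if "m \<in> ?N" "m \<le> n" for m n
  proof -
    have "(\<Union>d\<le>m. gr d) \<subseteq> (\<Union>d\<le>n. gr d)" using that(2) by (auto intro: order_trans)
    moreover have "(\<Union>d\<le>n. gr d) \<subseteq> carrier R" using assms(2) by blast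
    ultimately show ?thesis
      using mono_generate_ring[of "\<Union>d\<le>m. gr d" "\<Union>d\<le>n. gr d"] generate_ring_incl that(1)
      by blast
  qed
  show ?thesis
  proof
    assume "beta R gr \<le> enat n"
    then have "beta R gr < enat (Suc n)" by (simp add: order_le_less_trans)
    then obtain m where "m \<in> ?N" "enat m < enat (Suc n)"
      unfolding b Inf_less_iff by auto
    then have "n \<in> ?N" using mono by auto
    then show "generate_ring R (\<Union>d\<le>n. gr d) = carrier R" by simp
  next
    assume "generate_ring R (\<Union>d\<le>n. gr d) = carrier R"
    then show "beta R gr \<le> enat n" unfolding b by (auto intro: Inf_lower)
  qed
qed

context graded_algebra
begin

lemma gr_props:
  "gr d \<subseteq> carrier A" "\<zero>\<^bsub>A\<^esub> \<in> gr d"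
  "\<lbrakk>x \<in> gr d; y \<in> gr d\<rbrakk> \<Longrightarrow> x \<oplus>\<^bsub>A\<^esub> y \<in> gr d"
  "x \<in> gr d \<Longrightarrow> c \<odot>\<^bsub>A\<^esub> x \<in> gr d"
  "x \<in> gr d \<Longrightarrow> \<ominus>\<^bsub>A\<^esub> x \<in> gr d"
proof -
  interpret submodule "gr d" "ring_of_type_algebra :: 'k ring" A by (rule gr_submodule)
  show "gr d \<subseteq> carrier A" using subset by simp
  show "\<zero>\<^bsub>A\<^esub> \<in> gr d" using one_closed by simp
  show "\<lbrakk>x \<in> gr d; y \<in> gr d\<rbrakk> \<Longrightarrow> x \<oplus>\<^bsub>A\<^esub> y \<in> gr d" using m_closed by simp
  show "x \<in> gr d \<Longrightarrow> c \<odot>\<^bsub>A\<^esub> x \<in> gr d" using smult_closed[of c x]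
    by (simp add: ring_of_type_algebra_def)
  show "x \<in> gr d \<Longrightarrow> \<ominus>\<^bsub>A\<^esub> x \<in> gr d" using m_inv_closed by (simp add: a_inv_def)
qed

lemmas scalar_simps =
  smult_closed[of c for c, simplified ring_of_type_algebra_def, simplified]
  smult_l_distr[of c e for c e, simplified ring_of_type_algebra_def, simplified]
  smult_r_distr[of c for c, simplified ring_of_type_algebra_def, simplified]
  smult_assoc1[of c e for c e, simplified ring_of_type_algebra_def, simplified]
  smult_assoc2[of c for c, simplified ring_of_type_algebra_def, simplified]
  smult_l_null[simplified ring_of_type_algebra_def, simplified]
  smult_one[simplified ring_of_type_algebra_def, simplified]

definition graded_sum :: "'a set \<Rightarrow> 'a \<Rightarrow> bool" where
  "graded_sum L x \<longleftrightarrow> (\<exists>f. (\<forall>d. f d \<in> gr d \<inter> L) \<and> finite {d. f d \<noteq> \<zero>\<^bsub>A\<^esub>} \<and>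
     x = (\<Oplus>\<^bsub>A\<^esub>d\<in>{d. f d \<noteq> \<zero>\<^bsub>A\<^esub>}. f d))"

end

lemma graded_G_algebra_copy:
  fixes A :: "('k::field, 'a) module" and G :: "('g, 'x) monoid_scheme" and h :: "'a \<Rightarrow> 'b"
  assumes "graded_G_algebra A gr G \<phi>"
    and L: "L \<subseteq> carrier A" "\<one>\<^bsub>A\<^esub> \<in> L"
      "\<And>x y. \<lbrakk>x \<in> L; y \<in> L\<rbrakk> \<Longrightarrow> x \<oplus>\<^bsub>A\<^esub> y \<in> L"
      "\<And>x y. \<lbrakk>x \<in> L; y \<in> L\<rbrakk> \<Longrightarrow> x \<otimes>\<^bsub>A\<^esub> y \<in> L"
      "\<And>c x. x \<in> L \<Longrightarrow> c \<odot>\<^bsub>A\<^esub> x \<in> L"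
      "\<And>g x. \<lbrakk>g \<in> carrier G; x \<in> L\<rbrakk> \<Longrightarrow> \<phi> g x \<in> L"
    and comps: "\<And>x. x \<in> L \<Longrightarrow> graded_algebra.graded_sum A gr L x"
    and inj: "inj_on h L"
  obtains B :: "('k, 'b) module" and grB \<psi> r where
    "graded_G_algebra B grB G \<psi>" "r \<in> Ring.ring_hom B A" "inj_on r (carrier B)"
    "r ` carrier B = L" "\<And>d. r ` grB d = gr d \<inter> L"
    "r ` invariant_elements G \<psi> B = invariant_elements G \<phi> A \<inter> L"
proof -
  interpret graded_G_algebra A gr G \<phi> by fact
  define r where "r = inv_into L h"
  have rh [simp]: "r (h x) = x" if "x \<in> L" for x unfolding r_def using inj that by simp
  define B :: "('k, 'b) module" where
    "B = \<lparr>carrier = h ` L, monoid.mult = (\<lambda>x y. h (r x \<otimes>\<^bsub>A\<^esub> r y)), one = h \<one>\<^bsub>A\<^esub>,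
      ring.zero = h \<zero>\<^bsub>A\<^esub>, add = (\<lambda>x y. h (r x \<oplus>\<^bsub>A\<^esub> r y)), module.smult = (\<lambda>c x. h (c \<odot>\<^bsub>A\<^esub> r x))\<rparr>"
  define grB where "grB d = h ` (gr d \<inter> L)" for d
  define \<psi> where "\<psi> g = (\<lambda>x\<in>h ` L. h (\<phi> g (r x)))" for g
  have sel [simp]: "carrier B = h ` L" "x \<otimes>\<^bsub>B\<^esub> y = h (r x \<otimes>\<^bsub>A\<^esub> r y)" "\<one>\<^bsub>B\<^esub> = h \<one>\<^bsub>A\<^esub>"
    "\<zero>\<^bsub>B\<^esub> = h \<zero>\<^bsub>A\<^esub>" "x \<oplus>\<^bsub>B\<^esub> y = h (r x \<oplus>\<^bsub>A\<^esub> r y)" "c \<odot>\<^bsub>B\<^esub> x = h (c \<odot>\<^bsub>A\<^esub> r x)" for x y c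
    unfolding B_def by simp_all
  have Lc [simp]: "x \<in> L \<Longrightarrow> x \<in> carrier A" for x using L(1) by blast
  have zL [simp]: "\<zero>\<^bsub>A\<^esub> \<in> L" using L(5)[OF L(2), of 0] by (simp add: scalar_simps)
  have neg: "(-1) \<odot>\<^bsub>A\<^esub> x \<oplus>\<^bsub>A\<^esub> x = \<zero>\<^bsub>A\<^esub>" if "x \<in> carrier A" for x
    using scalar_simps(2)[of x "-1" 1] that by (simp add: scalar_simps)
  note [simp] = L(2-6)
  have abB: "abelian_group B"
  proof (rule abelian_groupI)
    fix x assume "x \<in> carrier B"
    then obtain x' where x': "x' \<in> L" "x = h x'" by auto
    show "\<exists>y\<in>carrier B. y \<oplus>\<^bsub>B\<^esub> x = \<zero>\<^bsub>B\<^esub>"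
      by (rule bexI[of _ "h ((-1) \<odot>\<^bsub>A\<^esub> x')"]) (use x' in \<open>auto simp: neg\<close>)
  qed (auto simp: M.a_ac)
  have cmB: "comm_monoid B"
    by (rule comm_monoidI) (auto simp: m_ac)
  have cB: "cring B"
    by (rule cringI[OF abB cmB]) (auto simp: l_distr)
  have algB: "algebra (ring_of_type_algebra :: 'k ring) B"
    by (rule algebraI[OF R_cring cB])
      (auto simp: scalar_simps ring_of_type_algebra_def)
  have rhom: "r \<in> Ring.ring_hom B A"
    by (rule ring_hom_memI) auto
  interpret B: algebra "ring_of_type_algebra :: 'k ring" B by (rule algB)
  interpret rh: ring_hom_cring B A r
    by (rule ring_hom_cring.intro[OF cB M_cring ring_hom_cring_axioms.intro[OF rhom]])
  have rinj: "inj_on r (carrier B)" by (auto intro!: inj_onI)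
  have rz: "r x = \<zero>\<^bsub>A\<^esub> \<longleftrightarrow> x = \<zero>\<^bsub>B\<^esub>" if "x \<in> carrier B" for x
    using that by auto
  have rgr: "r ` grB d = gr d \<inter> L" for d unfolding grB_def by force
  have rB: "r x \<in> gr d" "r x \<in> L" "x \<in> carrier B" if "x \<in> grB d" for x d
    using that unfolding grB_def by auto
  have fs: "r (\<Oplus>\<^bsub>B\<^esub>d\<in>{d. f d \<noteq> \<zero>\<^bsub>B\<^esub>}. f d) = (\<Oplus>\<^bsub>A\<^esub>d\<in>{d. (r \<circ> f) d \<noteq> \<zero>\<^bsub>A\<^esub>}. (r \<circ> f) d)"
    and fs': "{d. (r \<circ> f) d \<noteq> \<zero>\<^bsub>A\<^esub>} = {d. f d \<noteq> \<zero>\<^bsub>B\<^esub>}"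
    if "\<forall>d. f d \<in> grB d" for f
  proof -
    show e: "{d. (r \<circ> f) d \<noteq> \<zero>\<^bsub>A\<^esub>} = {d. f d \<noteq> \<zero>\<^bsub>B\<^esub>}" 
    proof -
      have "(r (f d) = \<zero>\<^bsub>A\<^esub>) = (f d = \<zero>\<^bsub>B\<^esub>)" for d using rz[OF rB(3)] that by blast
      then show ?thesis by simp
    qed
    show "r (\<Oplus>\<^bsub>B\<^esub>d\<in>{d. f d \<noteq> \<zero>\<^bsub>B\<^esub>}. f d) = (\<Oplus>\<^bsub>A\<^esub>d\<in>{d. (r \<circ> f) d \<noteq> \<zero>\<^bsub>A\<^esub>}. (r \<circ> f) d)"
      unfolding e by (rule rh.hom_finsum) (use that rB(3) in blast)
  qed
  have grB: "graded_algebra B grB"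
  proof (intro graded_algebra.intro graded_algebra_axioms.intro algB)
    show "submodule (grB d) (ring_of_type_algebra :: 'k ring) B" for d
    proof (rule B.submoduleI)
      show "grB d \<subseteq> carrier B" unfolding grB_def by auto
      show "\<zero>\<^bsub>B\<^esub> \<in> grB d" unfolding grB_def using gr_props(2) by auto
      show add: "a \<oplus>\<^bsub>B\<^esub> b \<in> grB d" if "a \<in> grB d" "b \<in> grB d" for a b
        using that unfolding grB_def by (auto intro!: imageI gr_props(3))
      show sm: "c \<odot>\<^bsub>B\<^esub> x \<in> grB d" if "x \<in> grB d" for c x
        using that unfolding grB_def by (auto intro!: imageI gr_props(4))
      show "\<ominus>\<^bsub>B\<^esub> a \<in> grB d" if "a \<in> grB d" for a
      proof -
        have "(-1) \<odot>\<^bsub>B\<^esub> a \<oplus>\<^bsub>B\<^esub> a = \<zero>\<^bsub>B\<^esub>"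
          using that unfolding grB_def by (auto simp: neg)
        then have "\<ominus>\<^bsub>B\<^esub> a = (-1) \<odot>\<^bsub>B\<^esub> a"
          using B.M.minus_equality rB(3)[OF that] rB(3)[OF sm[OF that, of "-1"]] by blast
        then show ?thesis using sm[OF that] by simp
      qed
    qed
    show "\<one>\<^bsub>B\<^esub> \<in> grB 0" unfolding grB_def using one_gr by auto
    show "x \<otimes>\<^bsub>B\<^esub> y \<in> grB (d + e)" if "x \<in> grB d" "y \<in> grB e" for x y d e
      using that unfolding grB_def by (auto intro!: imageI mult_gr)
    fix x assume x: "x \<in> carrier B"
    then obtain x' where x': "x' \<in> L" "x = h x'" by auto
    let ?P = "\<lambda>f. (\<forall>d. f d \<in> grB d) \<and> finite {d. f d \<noteq> \<zero>\<^bsub>B\<^esub>} \<and> x = (\<Oplus>\<^bsub>B\<^esub>d\<in>{d. f d \<noteq> \<zero>\<^bsub>B\<^esub>}. f d)"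
    from comps[OF x'(1)] obtain f where f: "\<forall>d. f d \<in> gr d \<inter> L" "finite {d. f d \<noteq> \<zero>\<^bsub>A\<^esub>}"
      "x' = (\<Oplus>\<^bsub>A\<^esub>d\<in>{d. f d \<noteq> \<zero>\<^bsub>A\<^esub>}. f d)" unfolding graded_sum_def by blast
    have rf: "r \<circ> (h \<circ> f) = f" using f(1) by (auto simp: fun_eq_iff)
    have hf: "\<forall>d. (h \<circ> f) d \<in> grB d" unfolding grB_def using f(1) by auto
    show "\<exists>!f. ?P f"
    proof (rule ex1I)
      have "finite {d. (h \<circ> f) d \<noteq> \<zero>\<^bsub>B\<^esub>}" using f(2) fs'[OF hf] unfolding rf by simp
      moreover have "r (\<Oplus>\<^bsub>B\<^esub>d\<in>{d. (h \<circ> f) d \<noteq> \<zero>\<^bsub>B\<^esub>}. (h \<circ> f) d) = r x"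
        using fs[OF hf] f(3) x' unfolding rf by simp
      moreover have "(\<Oplus>\<^bsub>B\<^esub>d\<in>{d. (h \<circ> f) d \<noteq> \<zero>\<^bsub>B\<^esub>}. (h \<circ> f) d) \<in> carrier B"
        by (rule B.M.finsum_closed) (use hf rB(3) in blast)
      ultimately show "?P (h \<circ> f)" using hf x rinj by (simp add: inj_on_eq_iff)
    next
      fix f' assume f': "?P f'"
      have "(\<forall>d. (r \<circ> f') d \<in> gr d) \<and> finite {d. (r \<circ> f') d \<noteq> \<zero>\<^bsub>A\<^esub>} \<and>
        x' = (\<Oplus>\<^bsub>A\<^esub>d\<in>{d. (r \<circ> f') d \<noteq> \<zero>\<^bsub>A\<^esub>}. (r \<circ> f') d)"
      proof (intro conjI)
        show "\<forall>d. (r \<circ> f') d \<in> gr d" using f' rB by auto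
        show "finite {d. (r \<circ> f') d \<noteq> \<zero>\<^bsub>A\<^esub>}" using f' fs' by simp
        show "x' = (\<Oplus>\<^bsub>A\<^esub>d\<in>{d. (r \<circ> f') d \<noteq> \<zero>\<^bsub>A\<^esub>}. (r \<circ> f') d)"
          using f' fs[of f'] x' by (metis rh)
      qed
      moreover have "(\<forall>d. f d \<in> gr d) \<and> finite {d. f d \<noteq> \<zero>\<^bsub>A\<^esub>} \<and>
        x' = (\<Oplus>\<^bsub>A\<^esub>d\<in>{d. f d \<noteq> \<zero>\<^bsub>A\<^esub>}. f d)" using f by blast
      ultimately have eq: "r \<circ> f' = f" using decomposition[of x'] x' Lc by blast
      show "f' = h \<circ> f"
      proof
        fix d
        have "f' d \<in> h ` L" using f' rB(3)[of "f' d" d] by simp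
        then show "f' d = (h \<circ> f) d" using eq by auto
      qed
    qed
  qed
  have \<psi>h: "\<psi> g (h x) = h (\<phi> g x)" if "x \<in> L" for g x
    using that by (simp add: \<psi>_def)
  have bij: "bij_betw (\<psi> g) (h ` L) (h ` L)" if g: "g \<in> carrier G" for g
  proof -
    have gi: "inv\<^bsub>G\<^esub> g \<in> carrier G"
      using g group_hom group_hom.axioms(1) group.inv_closed by metis
    have c1: "\<phi> (inv\<^bsub>G\<^esub> g) (\<phi> g x) = x" "\<phi> g (\<phi> (inv\<^bsub>G\<^esub> g) x) = x" if "x \<in> carrier A" for x
      using orbit_sym_aux[OF g that] orbit_sym_aux[OF gi that] g
        group_hom group_hom.axioms(1) group.inv_inv by metis+
    show ?thesis
      by (rule bij_betw_byWitness[where f' = "\<psi> (inv\<^bsub>G\<^esub> g)"])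
        (use g gi c1 in \<open>auto simp: \<psi>_def\<close>)
  qed
  have act: "group_action G (carrier B) \<psi>"
    unfolding group_action_def group_hom_def
  proof (intro conjI)
    show G: "Group.group G" using group_hom by (rule group_hom.axioms(1))
    show "Group.group (BijGroup (carrier B))" by (rule group_BijGroup)
    show "group_hom_axioms G (BijGroup (carrier B)) \<psi>"
    proof
      have Bij: "\<psi> g \<in> Bij (h ` L)" if "g \<in> carrier G" for g
        using bij[OF that] unfolding Bij_def by (auto simp: \<psi>_def)
      have "\<psi> (g \<otimes>\<^bsub>G\<^esub> g') = \<psi> g \<otimes>\<^bsub>BijGroup (h ` L)\<^esub> \<psi> g'" if g: "g \<in> carrier G" "g' \<in> carrier G" for g g'
      proof -
        have "compose (h ` L) (\<psi> g) (\<psi> g') = \<psi> (g \<otimes>\<^bsub>G\<^esub> g')"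
        proof
          fix x show "compose (h ` L) (\<psi> g) (\<psi> g') x = \<psi> (g \<otimes>\<^bsub>G\<^esub> g') x"
          proof (cases "x \<in> h ` L")
            case True
            then obtain x' where x': "x' \<in> L" "x = h x'" by auto
            then have "\<phi> g' x' \<in> L" "h (\<phi> g' x') \<in> h ` L" using g by auto
            then show ?thesis using g x' by (simp add: compose_def \<psi>_def composition_rule)
          qed (simp add: compose_def \<psi>_def)
        qed
        then show ?thesis unfolding BijGroup_def using Bij g by simp
      qed
      then show "\<psi> \<in> hom G (BijGroup (carrier B))"
        unfolding hom_def using Bij by (auto simp: BijGroup_def)
    qed
  qed
  have homA: "\<phi> g x \<in> carrier A" "\<phi> g (x \<otimes>\<^bsub>A\<^esub> y) = \<phi> g x \<otimes>\<^bsub>A\<^esub> \<phi> g y"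
    "\<phi> g (x \<oplus>\<^bsub>A\<^esub> y) = \<phi> g x \<oplus>\<^bsub>A\<^esub> \<phi> g y" "\<phi> g \<one>\<^bsub>A\<^esub> = \<one>\<^bsub>A\<^esub>"
    if "g \<in> carrier G" "x \<in> carrier A" "y \<in> carrier A" for g x y
    using ring_hom_memE[OF action_ring_hom[OF that(1)]] that by auto
  have GB: "graded_G_algebra B grB G \<psi>"
  proof (intro graded_G_algebra.intro grB act graded_G_algebra_axioms.intro)
    fix g assume g: "g \<in> carrier G"
    show "\<psi> g \<in> Ring.ring_hom B B"
      by (rule ring_hom_memI) (use g homA[OF g] homA(4)[OF g Lc[OF L(2)] Lc[OF L(2)]] in \<open>auto simp: \<psi>h\<close>)
    show "\<psi> g (c \<odot>\<^bsub>B\<^esub> x) = c \<odot>\<^bsub>B\<^esub> \<psi> g x" if "x \<in> carrier B" for c x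
      using that g by (auto simp: \<psi>h action_smult)
    show "\<psi> g x \<in> grB d" if "x \<in> grB d" for x d
      using that g by (auto simp: \<psi>h grB_def intro!: imageI action_gr)
  qed
  have inv: "r ` invariant_elements G \<psi> B = invariant_elements G \<phi> A \<inter> L"
  proof -
    have "invariant_elements G \<psi> B = h ` (invariant_elements G \<phi> A \<inter> L)"
      unfolding invariant_elements_def using inj
      by (auto simp: \<psi>_def inj_on_eq_iff)
    then show ?thesis by force
  qed
  show thesis
    by (rule that[OF GB rhom rinj _ rgr inv]) force
qed

lemma generate_ring_superset: "x \<in> generate_ring R F \<Longrightarrow> F \<subseteq> F' \<Longrightarrow> x \<in> generate_ring R F'"
  by (induction rule: generate_ring.induct) (auto intro: generate_ring.intros)

lemma generate_ring_finite:
  "x \<in> generate_ring R H \<Longrightarrow> \<exists>F. finite F \<and> F \<subseteq> H \<and> x \<in> generate_ring R F"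
proof (induction rule: generate_ring.induct)
  case one
  show ?case by (intro exI[of _ "{}"]) (auto intro: generate_ring.one)
next
  case (incl x)
  then show ?case by (intro exI[of _ "{x}"]) (auto intro: generate_ring.incl)
next
  case (a_inv x)
  then show ?case by (auto intro: generate_ring.a_inv)
next
  case (eng_add x y)
  then obtain F F' where "finite F" "F \<subseteq> H" "x \<in> generate_ring R F"
    "finite F'" "F' \<subseteq> H" "y \<in> generate_ring R F'" by auto
  then show ?case
    by (intro exI[of _ "F \<union> F'"]) (auto intro!: generate_ring.eng_add elim: generate_ring_superset)
next
  case (eng_mult x y)
  then obtain F F' where "finite F" "F \<subseteq> H" "x \<in> generate_ring R F"
    "finite F'" "F' \<subseteq> H" "y \<in> generate_ring R F'" by auto
  then show ?case
    by (intro exI[of _ "F \<union> F'"]) (auto intro!: generate_ring.eng_mult elim: generate_ring_superset)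
qed

inductive_set scalar_span :: "('k, 'a) module \<Rightarrow> 'a set \<Rightarrow> 'a set" for A M where
  zero: "\<zero>\<^bsub>A\<^esub> \<in> scalar_span A M"
| step: "\<lbrakk>m \<in> M; y \<in> scalar_span A M\<rbrakk> \<Longrightarrow> (c \<odot>\<^bsub>A\<^esub> m) \<oplus>\<^bsub>A\<^esub> y \<in> scalar_span A M"

context graded_G_algebra
begin

lemma A_ring: "ring A"
  using M_cring by (rule cring.axioms(1))

lemma action_hom:
  assumes "g \<in> carrier G"
  shows "x \<in> carrier A \<Longrightarrow> \<phi> g x \<in> carrier A"
    "\<lbrakk>x \<in> carrier A; y \<in> carrier A\<rbrakk> \<Longrightarrow> \<phi> g (x \<otimes>\<^bsub>A\<^esub> y) = \<phi> g x \<otimes>\<^bsub>A\<^esub> \<phi> g y"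
    "\<lbrakk>x \<in> carrier A; y \<in> carrier A\<rbrakk> \<Longrightarrow> \<phi> g (x \<oplus>\<^bsub>A\<^esub> y) = \<phi> g x \<oplus>\<^bsub>A\<^esub> \<phi> g y"
    "\<phi> g \<one>\<^bsub>A\<^esub> = \<one>\<^bsub>A\<^esub>"
    "\<phi> g \<zero>\<^bsub>A\<^esub> = \<zero>\<^bsub>A\<^esub>"
    "x \<in> carrier A \<Longrightarrow> \<phi> g (\<ominus>\<^bsub>A\<^esub> x) = \<ominus>\<^bsub>A\<^esub> \<phi> g x"
proof -
  interpret h: ring_hom_cring A A "\<phi> g"
    by (rule ring_hom_cring.intro[OF M_cring M_cring ring_hom_cring_axioms.intro[OF action_ring_hom[OF assms]]])
  show "x \<in> carrier A \<Longrightarrow> \<phi> g x \<in> carrier A"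
    "\<lbrakk>x \<in> carrier A; y \<in> carrier A\<rbrakk> \<Longrightarrow> \<phi> g (x \<otimes>\<^bsub>A\<^esub> y) = \<phi> g x \<otimes>\<^bsub>A\<^esub> \<phi> g y"
    "\<lbrakk>x \<in> carrier A; y \<in> carrier A\<rbrakk> \<Longrightarrow> \<phi> g (x \<oplus>\<^bsub>A\<^esub> y) = \<phi> g x \<oplus>\<^bsub>A\<^esub> \<phi> g y"
    "\<phi> g \<one>\<^bsub>A\<^esub> = \<one>\<^bsub>A\<^esub>"
    "\<phi> g \<zero>\<^bsub>A\<^esub> = \<zero>\<^bsub>A\<^esub>"
    "x \<in> carrier A \<Longrightarrow> \<phi> g (\<ominus>\<^bsub>A\<^esub> x) = \<ominus>\<^bsub>A\<^esub> \<phi> g x"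
    by simp_all
qed

lemma beta_invariants_le_iff:
  "beta_invariants G \<phi> A gr \<le> enat n \<longleftrightarrow>
    generate_ring A (\<Union>d\<le>n. gr d \<inter> invariant_elements G \<phi> A) = invariant_elements G \<phi> A"
proof -
  let ?I = "invariant_elements G \<phi> A"
  let ?R = "A\<lparr>carrier := ?I\<rparr>"
  have "subring ?I A"
    by (rule subringI) (auto simp: invariant_elements_def action_hom)
  then have R: "ring ?R" by (rule subring_is_ring)
  have z: "\<zero>\<^bsub>A\<^esub> \<in> ?I" by (auto simp: invariant_elements_def action_hom)
  have "(\<lambda>x. x) \<in> Ring.ring_hom ?R A"
    by (rule ring_hom_memI) (auto simp: invariant_elements_def)
  from generate_ring_hom[OF R A_ring this, of "\<Union>d\<le>n. gr d \<inter> ?I"]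
  have "generate_ring A (\<Union>d\<le>n. gr d \<inter> ?I) = generate_ring ?R (\<Union>d\<le>n. gr d \<inter> ?I)"
    by (simp add: UN_subset_iff)
  moreover have "beta ?R (\<lambda>d. gr d \<inter> ?I) \<le> enat n \<longleftrightarrow>
      generate_ring ?R (\<Union>d\<le>n. gr d \<inter> ?I) = carrier ?R"
    by (rule beta_le_iff[OF R]) (use z gr_props(2) in auto)
  ultimately show ?thesis unfolding beta_invariants_def by simp
qed

lemma finitely_generated_subalgebra:
  assumes fin: "finite (carrier G)" and b: "beta A gr \<le> 1" and a: "a \<in> carrier A"
  obtains L and h :: "'a \<Rightarrow> (nat \<Rightarrow>\<^sub>0 'k)" where "a \<in> L"
    "L \<subseteq> carrier A" "\<one>\<^bsub>A\<^esub> \<in> L"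
    "\<And>x y. \<lbrakk>x \<in> L; y \<in> L\<rbrakk> \<Longrightarrow> x \<oplus>\<^bsub>A\<^esub> y \<in> L"
    "\<And>x y. \<lbrakk>x \<in> L; y \<in> L\<rbrakk> \<Longrightarrow> x \<otimes>\<^bsub>A\<^esub> y \<in> L"
    "\<And>c x. x \<in> L \<Longrightarrow> c \<odot>\<^bsub>A\<^esub> x \<in> L"
    "\<And>g x. \<lbrakk>g \<in> carrier G; x \<in> L\<rbrakk> \<Longrightarrow> \<phi> g x \<in> L"
    "\<And>x. x \<in> L \<Longrightarrow> graded_sum L x" "inj_on h L"
    "L \<subseteq> generate_ring A (\<Union>d\<le>1. gr d \<inter> L)"
proof -
  have G: "Group.group G" using group_hom by (rule group_hom.axioms(1))
  have "generate_ring A (\<Union>d\<le>1. gr d) = carrier A"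
    using beta_le_iff[of A gr 1, OF A_ring gr_props(1,2)] b by (simp add: one_enat_def)
  then obtain X0 where X0: "finite X0" "X0 \<subseteq> (\<Union>d\<le>1. gr d)" "a \<in> generate_ring A X0"
    using generate_ring_finite[of a A "\<Union>d\<le>1. gr d"] a by auto
  define Y where "Y = (\<Union>g\<in>carrier G. \<phi> g ` X0)"
  have finX: "finite Y" unfolding Y_def using fin X0(1) by auto
  have Ygr: "Y \<subseteq> (\<Union>d\<le>1. gr d)"
    unfolding Y_def using X0(2) by (auto dest!: subsetD intro: action_gr)
  have Xc: "x \<in> carrier A" if "x \<in> Y" for x using that Ygr gr_props(1) by blast
  have X0c: "x \<in> carrier A" if "x \<in> X0" for x using that X0(2) gr_props(1) by blast
  have "X0 \<subseteq> Y"
  proof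
    fix x assume x: "x \<in> X0"
    then have "\<phi> \<one>\<^bsub>G\<^esub> x = x" using id_eq_one X0c by (metis restrict_apply')
    then show "x \<in> Y" unfolding Y_def using x G group.is_monoid monoid.one_closed
      by (metis UN_iff image_eqI)
  qed
  then have aX: "a \<in> generate_ring A Y" using X0(3) generate_ring_superset by metis
  have XG: "\<phi> g x \<in> Y" if "g \<in> carrier G" "x \<in> Y" for g x
  proof -
    note t = that
    obtain g' y where y: "g' \<in> carrier G" "y \<in> X0" "x = \<phi> g' y" using t unfolding Y_def by auto
    then have "\<phi> g x = \<phi> (g \<otimes>\<^bsub>G\<^esub> g') y" using composition_rule[of y g g'] X0c that by simp
    moreover have "g \<otimes>\<^bsub>G\<^esub> g' \<in> carrier G"
      using G that(1) y(1) by (simp add: group.is_monoid monoid.m_closed)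
    ultimately show ?thesis unfolding Y_def using y by auto
  qed
  define word where "word w = foldr (\<lambda>x y. x \<otimes>\<^bsub>A\<^esub> y) w \<one>\<^bsub>A\<^esub>" for w
  define M where "M = word ` lists Y"
  have wc: "word w \<in> carrier A" if "w \<in> lists Y" for w
    using that by (induction w) (auto simp: word_def Xc)
  have Mc: "m \<in> carrier A" if "m \<in> M" for m using that wc unfolding M_def by auto
  have M1: "\<one>\<^bsub>A\<^esub> \<in> M" unfolding M_def by (rule image_eqI[of _ _ "[]"]) (auto simp: word_def)
  have MX: "Y \<subseteq> M"
  proof
    fix x assume "x \<in> Y"
    then show "x \<in> M" unfolding M_def by (intro image_eqI[of _ _ "[x]"]) (auto simp: word_def Xc)
  qed
  have MM: "m \<otimes>\<^bsub>A\<^esub> m' \<in> M" if "m \<in> M" "m' \<in> M" for m m'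
  proof -
    note t = that
    obtain v w where vw: "v \<in> lists Y" "w \<in> lists Y" "m = word v" "m' = word w"
      using t unfolding M_def by auto
    have "word v \<otimes>\<^bsub>A\<^esub> word w = word (v @ w)"
      using vw(1) wc[OF vw(2)]
    proof (induction v)
      case (Cons x v)
      then show ?case using wc[of v] by (simp add: word_def Xc m_assoc)
    qed (simp add: word_def)
    then show ?thesis unfolding M_def using vw by auto
  qed
  have MG: "\<phi> g m \<in> M" if "g \<in> carrier G" "m \<in> M" for g m
  proof -
    note t = that
    obtain w where w: "w \<in> lists Y" "m = word w" using t unfolding M_def by auto
    have "\<phi> g (word w) = word (map (\<phi> g) w)" using w(1)
    proof (induction w)
      case (Cons x w)
      then show ?case using wc[of w] that(1) by (simp add: word_def Xc action_hom)
    qed (simp add: word_def action_hom that(1))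
    moreover have "map (\<phi> g) w \<in> lists Y" using w(1) XG[OF that(1)] by auto
    ultimately show ?thesis unfolding M_def using w by auto
  qed
  have Mgr: "\<exists>e. m \<in> gr e" if "m \<in> M" for m
  proof -
    note t = that
    obtain w where w: "w \<in> lists Y" "m = word w" using t unfolding M_def by auto
    have "\<exists>e. word w \<in> gr e" using w(1)
    proof (induction w)
      case Nil
      then show ?case using one_gr by (auto simp: word_def)
    next
      case (Cons x w)
      then obtain e where "word w \<in> gr e" by auto
      moreover obtain d where "x \<in> gr d" using Cons Ygr by auto
      ultimately have "x \<otimes>\<^bsub>A\<^esub> word w \<in> gr (d + e)" by (simp add: mult_gr)
      then show ?case by (auto simp: word_def)
    qed
    then show ?thesis using w by simp
  qed
  define L where "L = scalar_span A M"
  note L0 = scalar_span.zero[of A M, folded L_def]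
  note Lstep = scalar_span.step[of _ M _ A, folded L_def]
  note Linduct = scalar_span.induct[of _ A M, folded L_def, consumes 1, case_names zero step]
  have Lc: "x \<in> carrier A" if "x \<in> L" for x
    using that by (induction rule: Linduct) (auto simp: Mc scalar_simps)
  have Ladd: "x \<oplus>\<^bsub>A\<^esub> y \<in> L" if "x \<in> L" "y \<in> L" for x y
    using that(1)
  proof (induction rule: Linduct)
    case zero
    then show ?case using that(2) Lc by simp
  next
    case (step m z c)
    have "c \<odot>\<^bsub>A\<^esub> m \<oplus>\<^bsub>A\<^esub> z \<oplus>\<^bsub>A\<^esub> y = c \<odot>\<^bsub>A\<^esub> m \<oplus>\<^bsub>A\<^esub> (z \<oplus>\<^bsub>A\<^esub> y)"
      using step Lc that(2) Mc by (simp add: M.a_assoc scalar_simps)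
    then show ?case using step Lstep by simp
  qed
  have Lsm: "c \<odot>\<^bsub>A\<^esub> x \<in> L" if "x \<in> L" for c x
    using that
  proof (induction rule: Linduct)
    case zero
    have "c \<odot>\<^bsub>A\<^esub> \<zero>\<^bsub>A\<^esub> = \<zero>\<^bsub>A\<^esub>" using smult_r_null[of c] by (simp add: ring_of_type_algebra_def)
    then show ?case using L0 by simp
  next
    case (step m z e)
    have "c \<odot>\<^bsub>A\<^esub> (e \<odot>\<^bsub>A\<^esub> m \<oplus>\<^bsub>A\<^esub> z) = (c * e) \<odot>\<^bsub>A\<^esub> m \<oplus>\<^bsub>A\<^esub> c \<odot>\<^bsub>A\<^esub> z"
      using step Lc Mc by (simp add: scalar_simps)
    then show ?case using step Lstep by simp
  qed
  have LM: "c \<odot>\<^bsub>A\<^esub> m \<in> L" if "m \<in> M" for c m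
    using Lstep[OF that L0, of c] Mc[OF that] by (simp add: scalar_simps)
  have MsubL: "M \<subseteq> L" using LM[of _ 1] Mc by (auto simp: scalar_simps)
  have Lmult1: "m \<otimes>\<^bsub>A\<^esub> y \<in> L" if "m \<in> M" "y \<in> L" for m y
    using that(2)
  proof (induction rule: Linduct)
    case zero
    then show ?case using L0 Mc[OF that(1)] by simp
  next
    case (step m' z e)
    have "m \<otimes>\<^bsub>A\<^esub> (e \<odot>\<^bsub>A\<^esub> m') = e \<odot>\<^bsub>A\<^esub> (m \<otimes>\<^bsub>A\<^esub> m')"
      using Mc[OF step(1)] Mc[OF that(1)] m_comm[of m "e \<odot>\<^bsub>A\<^esub> m'"] m_comm[of m m']
      by (simp add: scalar_simps)
    then have "m \<otimes>\<^bsub>A\<^esub> (e \<odot>\<^bsub>A\<^esub> m' \<oplus>\<^bsub>A\<^esub> z) = e \<odot>\<^bsub>A\<^esub> (m \<otimes>\<^bsub>A\<^esub> m') \<oplus>\<^bsub>A\<^esub> m \<otimes>\<^bsub>A\<^esub> z"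
      using step Lc Mc that(1) by (simp add: r_distr scalar_simps)
    then show ?case using step Lstep MM that(1) by simp
  qed
  have Lmult: "x \<otimes>\<^bsub>A\<^esub> y \<in> L" if "x \<in> L" "y \<in> L" for x y
    using that(1)
  proof (induction rule: Linduct)
    case zero
    then show ?case using that(2) Lc L0 by simp
  next
    case (step m z c)
    have "(c \<odot>\<^bsub>A\<^esub> m \<oplus>\<^bsub>A\<^esub> z) \<otimes>\<^bsub>A\<^esub> y = c \<odot>\<^bsub>A\<^esub> (m \<otimes>\<^bsub>A\<^esub> y) \<oplus>\<^bsub>A\<^esub> z \<otimes>\<^bsub>A\<^esub> y"
      using step Lc that(2) Mc by (simp add: l_distr scalar_simps)
    then show ?case using step Ladd Lsm Lmult1 that(2) by simp
  qed
  have LG: "\<phi> g x \<in> L" if "g \<in> carrier G" "x \<in> L" for g x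
    using that(2)
  proof (induction rule: Linduct)
    case zero
    then show ?case using L0 that(1) by (simp add: action_hom)
  next
    case (step m z c)
    have "\<phi> g (c \<odot>\<^bsub>A\<^esub> m \<oplus>\<^bsub>A\<^esub> z) = c \<odot>\<^bsub>A\<^esub> \<phi> g m \<oplus>\<^bsub>A\<^esub> \<phi> g z"
      using step Lc that(1) Mc by (simp add: action_hom action_smult scalar_simps)
    then show ?case using step Lstep MG that(1) by simp
  qed
  have neg: "(-1) \<odot>\<^bsub>A\<^esub> x = \<ominus>\<^bsub>A\<^esub> x" if "x \<in> carrier A" for x
  proof -
    have "(-1) \<odot>\<^bsub>A\<^esub> x \<oplus>\<^bsub>A\<^esub> x = \<zero>\<^bsub>A\<^esub>"
      using scalar_simps(2)[of x "-1" 1] that by (simp add: scalar_simps)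
    then show ?thesis using M.minus_equality[OF _ that scalar_simps(1)[OF that]] by simp
  qed
  have sub: "subring L A"
  proof (rule subringI)
    show "L \<subseteq> carrier A" using Lc by blast
    show "\<one>\<^bsub>A\<^esub> \<in> L" using MsubL M1 by blast
    show "\<ominus>\<^bsub>A\<^esub> x \<in> L" if "x \<in> L" for x using Lsm[OF that, of "-1"] neg[OF Lc[OF that]] by simp
  qed (simp_all add: Ladd Lmult)
  have aL: "a \<in> L"
    using generate_ring_min_subring1[OF _ sub, of Y] aX MX MsubL Xc by blast
  have gen: "L \<subseteq> generate_ring A (\<Union>d\<le>1. gr d \<inter> L)" (is "_ \<subseteq> ?g")
  proof
    fix x assume "x \<in> L"
    then show "x \<in> ?g"
    proof (induction rule: Linduct)
      case zero
      show ?case by (rule zero_in_generate)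
    next
      case (step m z c)
      obtain w where w: "w \<in> lists Y" "m = word w" using step unfolding M_def by auto
      have "word w \<in> ?g" using w(1)
      proof (induction w)
        case Nil
        show ?case by (simp add: word_def generate_ring.one)
      next
        case (Cons x w)
        then have "x \<in> Y" by simp
        then have "x \<in> (\<Union>d\<le>1. gr d \<inter> L)" using Ygr MX MsubL by (auto dest!: subsetD)
        then have "x \<in> ?g" by (rule generate_ring.incl)
        then show ?case using Cons by (simp add: word_def generate_ring.eng_mult)
      qed
      moreover have "c \<odot>\<^bsub>A\<^esub> \<one>\<^bsub>A\<^esub> \<in> ?g"
        by (rule generate_ring.incl) (use gr_props(4)[OF one_gr] LM[OF M1] in auto)
      moreover have "c \<odot>\<^bsub>A\<^esub> m = c \<odot>\<^bsub>A\<^esub> \<one>\<^bsub>A\<^esub> \<otimes>\<^bsub>A\<^esub> m" using step Mc by (simp add: scalar_simps)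
      ultimately show ?case using step w by (simp add: generate_ring.eng_add generate_ring.eng_mult)
    qed
  qed
  have grs: "graded_sum L x" if "x \<in> L" for x
  proof -
    have "\<exists>n f. (\<forall>d. f d \<in> gr d \<inter> L) \<and> (\<forall>d>n. f d = \<zero>\<^bsub>A\<^esub>) \<and> x = (\<Oplus>\<^bsub>A\<^esub>d\<in>{..n}. f d)"
      using that
    proof (induction rule: Linduct)
      case zero
      show ?case
        by (rule exI[of _ 0], rule exI[of _ "\<lambda>_. \<zero>\<^bsub>A\<^esub>"]) (simp add: gr_props(2) L0)
    next
      case (step m z c)
      then obtain n f where f: "\<forall>d. f d \<in> gr d \<inter> L" "\<forall>d>n. f d = \<zero>\<^bsub>A\<^esub>"
        "z = (\<Oplus>\<^bsub>A\<^esub>d\<in>{..n}. f d)" by blast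
      obtain e where e: "m \<in> gr e" using Mgr step by blast
      define N where "N = max n e"
      let ?s = "\<lambda>d. if e = d then c \<odot>\<^bsub>A\<^esub> m else \<zero>\<^bsub>A\<^esub>"
      have cm: "c \<odot>\<^bsub>A\<^esub> m \<in> carrier A" using step Mc by (simp add: scalar_simps)
      have fc: "f d \<in> carrier A" for d using f(1) Lc by blast
      have z: "z = (\<Oplus>\<^bsub>A\<^esub>d\<in>{..N}. f d)" unfolding f(3)
        by (rule M.add.finprod_mono_neutral_cong_left) (use f(2) fc in \<open>auto simp: N_def\<close>)
      have s: "(\<Oplus>\<^bsub>A\<^esub>d\<in>{..N}. ?s d) = c \<odot>\<^bsub>A\<^esub> m"
        using M.add.finprod_singleton[of e "{..N}" "\<lambda>_. c \<odot>\<^bsub>A\<^esub> m"] cm by (simp add: N_def)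
      have "c \<odot>\<^bsub>A\<^esub> m \<oplus>\<^bsub>A\<^esub> z = (\<Oplus>\<^bsub>A\<^esub>d\<in>{..N}. ?s d \<oplus>\<^bsub>A\<^esub> f d)"
        using M.finsum_addf[of ?s "{..N}" f] s z fc cm by (simp add: Pi_def)
      moreover have "?s d \<oplus>\<^bsub>A\<^esub> f d \<in> gr d \<inter> L" for d
        using f(1) gr_props(2)[of d] gr_props(3)[of _ d] gr_props(4)[OF e] LM[OF step(1)] Ladd L0 fc
        by auto
      moreover have "\<forall>d>N. ?s d \<oplus>\<^bsub>A\<^esub> f d = \<zero>\<^bsub>A\<^esub>" using f(2) by (auto simp: N_def)
      ultimately show ?case by (intro exI[of _ N] exI[of _ "\<lambda>d. ?s d \<oplus>\<^bsub>A\<^esub> f d"]) blast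
    qed
    then obtain n f where f: "\<forall>d. f d \<in> gr d \<inter> L" "\<forall>d>n. f d = \<zero>\<^bsub>A\<^esub>" "x = (\<Oplus>\<^bsub>A\<^esub>d\<in>{..n}. f d)"
      by blast
    have s: "{d. f d \<noteq> \<zero>\<^bsub>A\<^esub>} \<subseteq> {..n}" using f(2) by (auto simp: not_less[symmetric])
    have "(\<Oplus>\<^bsub>A\<^esub>d\<in>{d. f d \<noteq> \<zero>\<^bsub>A\<^esub>}. f d) = (\<Oplus>\<^bsub>A\<^esub>d\<in>{..n}. f d)"
      by (rule M.add.finprod_mono_neutral_cong_left) (use s f(1) Lc in auto)
    then show ?thesis unfolding graded_sum_def using f s finite_subset[OF s] by (intro exI[of _ f]) simp
  qed
  have "countable M" unfolding M_def using finX by (intro countable_image countable_lists countable_finite)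
  define mon where "mon = from_nat_into M"
  have mon: "range mon = M" unfolding mon_def using M1 \<open>countable M\<close> by (intro range_from_nat_into) auto
  have monc: "mon i \<in> carrier A" for i using mon Mc by blast
  define E where "E p = (\<Oplus>\<^bsub>A\<^esub>i\<in>Poly_Mapping.keys p. Poly_Mapping.lookup p i \<odot>\<^bsub>A\<^esub> mon i)" for p :: "nat \<Rightarrow>\<^sub>0 'k"
  have E_sup: "E p = (\<Oplus>\<^bsub>A\<^esub>i\<in>K. Poly_Mapping.lookup p i \<odot>\<^bsub>A\<^esub> mon i)"
    if "finite K" "Poly_Mapping.keys p \<subseteq> K" for p K
    unfolding E_def
    by (rule M.add.finprod_mono_neutral_cong_left)
      (use that monc in \<open>auto simp: scalar_simps in_keys_iff\<close>)
  have surj: "\<exists>p. E p = y" if "y \<in> L" for y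
    using that
  proof (induction rule: Linduct)
    case zero
    have "E 0 = \<zero>\<^bsub>A\<^esub>" unfolding E_def by simp
    then show ?case by blast
  next
    case (step m z c)
    then obtain p where p: "E p = z" by blast
    obtain j where j: "m = mon j" using step mon by blast
    let ?q = "Poly_Mapping.single j c"
    let ?K = "insert j (Poly_Mapping.keys p)"
    have K: "finite ?K" by simp
    have kq: "Poly_Mapping.keys ?q \<subseteq> ?K" by (simp add: keys_single)
    have kp: "Poly_Mapping.keys p \<subseteq> ?K" by auto
    have kqp: "Poly_Mapping.keys (?q + p) \<subseteq> ?K" using Poly_Mapping.keys_add[of ?q p] kq kp by blast
    have "E (?q + p) = (\<Oplus>\<^bsub>A\<^esub>i\<in>?K. Poly_Mapping.lookup ?q i \<odot>\<^bsub>A\<^esub> mon i \<oplus>\<^bsub>A\<^esub> Poly_Mapping.lookup p i \<odot>\<^bsub>A\<^esub> mon i)"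
      unfolding E_sup[OF K kqp] by (simp add: lookup_add scalar_simps monc)
    also have "\<dots> = E ?q \<oplus>\<^bsub>A\<^esub> E p"
      unfolding E_sup[OF K kq] E_sup[OF K kp]
      by (rule M.finsum_addf) (auto simp: scalar_simps monc)
    also have "E ?q = c \<odot>\<^bsub>A\<^esub> mon j"
      using E_sup[of "{j}" ?q] monc by (simp add: keys_single scalar_simps)
    finally show ?case using p j by blast
  qed
  define h where "h y = (SOME p. E p = y)" for y
  have Eh: "E (h y) = y" if "y \<in> L" for y unfolding h_def using surj[OF that] by (rule someI_ex)
  have injL: "inj_on h L" by (rule inj_on_inverseI[of _ E]) (rule Eh)
  show thesis
  proof (rule that[of L h])
    show "L \<subseteq> carrier A" using Lc by blast
    show "\<one>\<^bsub>A\<^esub> \<in> L" using MsubL M1 by blast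
    show "L \<subseteq> generate_ring A (\<Union>d\<le>1. gr d \<inter> L)" by (rule gen)
  qed (simp_all add: aL Ladd Lmult Lsm LG grs injL)
qed

end

lemma beta_group_upper:
  fixes A :: "('k::field, 'a) module"
  assumes "graded_G_algebra A gr G \<phi>" and fin: "finite (carrier G)" and b: "beta A gr \<le> 1"
  shows "beta_invariants G \<phi> A gr \<le> beta_group G TYPE('k)"
proof (cases "beta_group G TYPE('k)")
  case (enat N)
  interpret graded_G_algebra A gr G \<phi> by fact
  let ?I = "invariant_elements G \<phi> A"
  have U: "(\<Union>d\<le>N. gr d \<inter> ?I) \<subseteq> carrier A" using gr_props(1) by blast
  have "?I \<subseteq> generate_ring A (\<Union>d\<le>N. gr d \<inter> ?I)"
  proof
    fix a assume a: "a \<in> ?I"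
    then have "a \<in> carrier A" by (simp add: invariant_elements_def)
    then obtain L and h :: "'a \<Rightarrow> (nat \<Rightarrow>\<^sub>0 'k)" where L: "a \<in> L"
      "L \<subseteq> carrier A" "\<one>\<^bsub>A\<^esub> \<in> L"
      "\<And>x y. \<lbrakk>x \<in> L; y \<in> L\<rbrakk> \<Longrightarrow> x \<oplus>\<^bsub>A\<^esub> y \<in> L"
      "\<And>x y. \<lbrakk>x \<in> L; y \<in> L\<rbrakk> \<Longrightarrow> x \<otimes>\<^bsub>A\<^esub> y \<in> L"
      "\<And>c x. x \<in> L \<Longrightarrow> c \<odot>\<^bsub>A\<^esub> x \<in> L"
      "\<And>g x. \<lbrakk>g \<in> carrier G; x \<in> L\<rbrakk> \<Longrightarrow> \<phi> g x \<in> L"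
      "\<And>x. x \<in> L \<Longrightarrow> graded_sum L x" "inj_on h L"
      "L \<subseteq> generate_ring A (\<Union>d\<le>1. gr d \<inter> L)"
      by (rule finitely_generated_subalgebra[OF fin b]) (rule that)
    obtain B :: "('k, nat \<Rightarrow>\<^sub>0 'k) module" and grB \<psi> r where B: "graded_G_algebra B grB G \<psi>"
      "r \<in> Ring.ring_hom B A" "inj_on r (carrier B)" "r ` carrier B = L"
      "\<And>d. r ` grB d = gr d \<inter> L" "r ` invariant_elements G \<psi> B = ?I \<inter> L"
      by (rule graded_G_algebra_copy[OF assms(1) L(2-9)]) (assumption | rule that)+
    interpret B: graded_G_algebra B grB G \<psi> by (rule B(1))
    note hom = generate_ring_hom[OF B.A_ring A_ring B(2)]
    have UB: "(\<Union>d\<le>n. grB d) \<subseteq> carrier B" for n :: nat using B.gr_props(1) by blast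
    have "r ` generate_ring B (\<Union>d\<le>1. grB d) = generate_ring A (\<Union>d\<le>1. gr d \<inter> L)"
      using hom[OF UB, of 1] by (simp add: image_UN B(5))
    then have sub: "r ` carrier B \<subseteq> r ` generate_ring B (\<Union>d\<le>1. grB d)" using L(10) B(4) by simp
    have "x \<in> generate_ring B (\<Union>d\<le>1. grB d)" if x: "x \<in> carrier B" for x
    proof -
      have "r x \<in> r ` generate_ring B (\<Union>d\<le>1. grB d)" using sub x by (rule subsetD[OF _ imageI])
      then show ?thesis using inj_on_image_mem_iff[OF B(3) x B.generate_ring_incl[OF UB]] by simp
    qed
    then have "generate_ring B (\<Union>d\<le>1. grB d) = carrier B"
      using B.generate_ring_incl[OF UB] by (intro subset_antisym subsetI) auto
    then have "beta B grB \<le> 1"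
      using beta_le_iff[of B grB 1, OF B.A_ring B.gr_props(1,2)] by (simp add: one_enat_def)
    then have "beta_invariants G \<psi> B grB \<le> beta_group G TYPE('k)"
      unfolding beta_group_def using B(1) by (intro Sup_upper) blast
    then have "generate_ring B (\<Union>d\<le>N. grB d \<inter> invariant_elements G \<psi> B) = invariant_elements G \<psi> B"
      unfolding enat B.beta_invariants_le_iff .
    then have "?I \<inter> L = r ` generate_ring B (\<Union>d\<le>N. grB d \<inter> invariant_elements G \<psi> B)"
      using B(6) by simp
    also have "\<dots> = generate_ring A (r ` (\<Union>d\<le>N. grB d \<inter> invariant_elements G \<psi> B))"
      by (rule hom[symmetric]) (use UB[of N] in blast)
    also have "\<dots> \<subseteq> generate_ring A (\<Union>d\<le>N. gr d \<inter> ?I)"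
    proof (rule mono_generate_ring[OF _ U])
      show "r ` (\<Union>d\<le>N. grB d \<inter> invariant_elements G \<psi> B) \<subseteq> (\<Union>d\<le>N. gr d \<inter> ?I)"
        using B(5,6) by blast
    qed
    finally show "a \<in> generate_ring A (\<Union>d\<le>N. gr d \<inter> ?I)" using a L(1) by blast
  qed
  moreover have "generate_ring A (\<Union>d\<le>N. gr d \<inter> ?I) \<subseteq> ?I"
    by (rule generate_ring_min_subring1[OF U])
      (auto intro!: subringI simp: invariant_elements_def action_hom)
  ultimately show ?thesis unfolding enat beta_invariants_le_iff by blast
qed simp

end

theory Submission
  imports Defs
begin

text \<open>
  Let $q = p - 1$ if $p = \mathrm{char}\,k$ is positive and let $q$ be arbitrary otherwise. The heart
  of the matter is that every polynomial on $U \oplus V^{\oplus m}$ of degree at most $nq$ in $V$ is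
  a combination of $GL(m)$-translates of polynomials on $U \oplus V^{\oplus n}$ when
  $n \ge \dim V$. Given this, an invariant of degree at most $nq$ is a combination of translates of
  invariants on $U \oplus V^{\oplus n}$ by the Reynolds operator, and the definition of
  $\beta_k(G)$, applied to the grading by the degree in $V$, provides generators of these degrees.
  The Reynolds operator exists because $\beta_k(G)$ is infinite if $p$ divides $|G|$.

  For the main claim consider a linear functional on polynomials that vanishes on the submodule
  generated by the polynomials in $n$ copies, and let it be nonzero on a monomial involving a
  minimal number $t > n$ of copies, of minimal degree in one of them. Replacing this copy by any of
  the other ones lowers the degree, so the functional solves the linear system $\sum_a y_{ja} w_a = 0$
  for the $t - 1 \ge \dim V$ other copies $j$, with variables $y_{ja}$ acting as on divided powers.
  A nonzero solution has degree at least $(t - 1) q$ in the $y_{ja}$, which is too large.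
\<close>

section \<open>Polarization operators on functionals\<close>

text \<open>Functionals on polynomials form a completed divided power algebra, in which variables
  are zero divisors in positive characteristic: y times the divided power of degree p - 1 is 0. A
  system with at least as many equations as unknowns may thus have nonzero solutions, and only a
  degree bound survives. It is proved by deleting one row n and one column b. If row n of an
  exponent is concentrated in column b, equation n keeps b out of row l, the row of the unknowns,
  and a smaller system remains. Such exponents are found by column operators. These preserve
  solutions because they commute with the row operators, but the argument divides by numbers up to
  the degree of row n, which therefore must not exceed q. If the total degree is too small, some row
  has degree below q, and taking this degree maximal among all counterexamples controls the other
  rows. Functions on U have degree 0 in the grading used, which the condition beta(A) \<le> 1
  admits; so only dim V and beta enter the bound on n. In characteristic 0, q can grow with the
  degree, and all polynomials are reached.\<close>

text \<open>
  A function \<open>z\<close> of exponents stands for the linear functional on polynomials, in variables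
  indexed by \<open>'e\<close>, that takes the value \<open>z c\<close> at the monomial with exponent \<open>c\<close>. The operators
  \<open>shift e\<close> and \<open>mult_var e\<close> are the transposes of multiplication by the variable \<open>e\<close> and of the
  partial derivative; in \<open>mult_var\<close> the truncated subtraction is harmless because of the factor
  \<open>c e\<close>. For exponents of matrices of variables, \<open>row_op\<close> and \<open>col_op\<close> are then
  transposes of the polarization operators of the rows and of the columns.
\<close>

definition shift :: "'e \<Rightarrow> (('e \<Rightarrow> nat) \<Rightarrow> 'k) \<Rightarrow> ('e \<Rightarrow> nat) \<Rightarrow> 'k" where
  "shift e z = (\<lambda>c. z (c(e := Suc (c e))))"

definition mult_var :: "'e \<Rightarrow> (('e \<Rightarrow> nat) \<Rightarrow> 'k) \<Rightarrow> ('e \<Rightarrow> nat) \<Rightarrow> 'k::comm_ring_1" where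
  "mult_var e z = (\<lambda>c. of_nat (c e) * z (c(e := c e - 1)))"

lemma shift_apply: "shift e z c = z (c(e := Suc (c e)))"
  by (simp add: shift_def)

lemma shift_commute: "shift e (shift f z) = shift f (shift e z)"
proof (cases "e = f")
  case False
  then have "c(e := x, f := y) = c(f := y, e := x)" for c :: "'a \<Rightarrow> nat" and x y by (rule fun_upd_twist)
  then show ?thesis using False by (simp add: shift_def)
qed simp

lemma mult_var_commute: "mult_var e (mult_var f z) = mult_var f (mult_var e z)"
proof (cases "e = f")
  case False
  then have "c(e := x, f := y) = c(f := y, e := x)" for c :: "'a \<Rightarrow> nat" and x y by (rule fun_upd_twist)
  then show ?thesis using False by (simp add: mult_var_def mult.left_commute)
qed simp

text \<open>The Weyl relation: on divided powers, \<open>shift e\<close> is differentiation by the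
  variable e and \<open>mult_var f\<close> is multiplication by the variable f.\<close>

lemma shift_mult_var:
  "shift e (mult_var f z) = (\<lambda>c. mult_var f (shift e z) c + (if e = f then z c else 0))"
proof (cases "e = f")
  case True
  show ?thesis
  proof
    fix c
    show "shift e (mult_var f z) c = mult_var f (shift e z) c + (if e = f then z c else 0)"
      using True by (cases "c f") (simp_all add: shift_def mult_var_def algebra_simps fun_upd_idem)
  qed
next
  case False
  then have "c(e := x, f := y) = c(f := y, e := x)" for c :: "'a \<Rightarrow> nat" and x y by (rule fun_upd_twist)
  then show ?thesis using False by (simp add: shift_def mult_var_def)
qed

lemma shift_linear [simp]:
  "shift e (\<lambda>c. x c + y c) = (\<lambda>c. shift e x c + shift e y c)"
  "shift e (\<lambda>c. \<Sum>a\<in>A. w a c) = (\<lambda>c. \<Sum>a\<in>A. shift e (w a) c)"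
  "shift e (\<lambda>c. 0) = (\<lambda>c. 0)"
  by (simp_all add: shift_def)

lemma mult_var_linear [simp]:
  "mult_var e (\<lambda>c. x c + y c) = (\<lambda>c. mult_var e x c + mult_var e y c)"
  "mult_var e (\<lambda>c. \<Sum>a\<in>A. w a c) = (\<lambda>c. \<Sum>a\<in>A. mult_var e (w a) c)"
  "mult_var e (\<lambda>c. 0) = (\<lambda>c. 0)"
  by (simp_all add: mult_var_def algebra_simps sum_distrib_left)

section \<open>Operators of the two commuting Lie algebras and their commutators\<close>

definition row_op :: "'c set \<Rightarrow> 'i \<Rightarrow> 'i \<Rightarrow> (('i \<times> 'c \<Rightarrow> nat) \<Rightarrow> 'k) \<Rightarrow> ('i \<times> 'c \<Rightarrow> nat) \<Rightarrow> 'k::comm_ring_1" where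
  "row_op C i j z = (\<lambda>c. \<Sum>a\<in>C. mult_var (j, a) (shift (i, a) z) c)"

definition col_op :: "'i set \<Rightarrow> 'c \<Rightarrow> 'c \<Rightarrow> (('i \<times> 'c \<Rightarrow> nat) \<Rightarrow> 'k) \<Rightarrow> ('i \<times> 'c \<Rightarrow> nat) \<Rightarrow> 'k::comm_ring_1" where
  "col_op R a b z = (\<lambda>c. \<Sum>i\<in>R. mult_var (i, b) (shift (i, a) z) c)"

lemma mult_var_if: "mult_var e (\<lambda>c. if P then z c else 0) = (\<lambda>c. if P then mult_var e z c else 0)"
  by (auto simp: mult_var_def)

lemma weyl_product:
  "mult_var e (shift f (mult_var g (shift h z))) c =
     mult_var e (mult_var g (shift f (shift h z))) c + (if f = g then mult_var e (shift h z) c else 0)"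
  by (simp add: shift_mult_var mult_var_if)

text \<open>Row operators and column operators come from linear groups acting on a matrix of
  variables from its two sides. After normal ordering, both products leave the same additional term,
  \<open>mult_var (j, b) (shift (i, a) z)\<close>.\<close>

lemma row_col_commute:
  assumes "finite R" "finite C" "i \<in> R" "j \<in> R" "a \<in> C" "b \<in> C"
  shows "row_op C i j (col_op R a b z) = col_op R a b (row_op C i j z)"
proof
  fix c
  have "row_op C i j (col_op R a b z) c =
     (\<Sum>a'\<in>C. \<Sum>i'\<in>R. mult_var (j,a') (mult_var (i',b) (shift (i,a') (shift (i',a) z))) c)
     + (\<Sum>a'\<in>C. \<Sum>i'\<in>R. if i = i' \<and> a' = b then mult_var (j,a') (shift (i',a) z) c else 0)"
    unfolding row_op_def col_op_def sum.distrib[symmetric]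
    by (simp add: weyl_product sum.distrib)
  also have "(\<Sum>a'\<in>C. \<Sum>i'\<in>R. if i = i' \<and> a' = b then mult_var (j,a') (shift (i',a) z) c else 0)
     = mult_var (j,b) (shift (i,a) z) c"
    using assms by (simp add: if_if_eq_conj[symmetric])
  finally have 1: "row_op C i j (col_op R a b z) c =
     (\<Sum>a'\<in>C. \<Sum>i'\<in>R. mult_var (j,a') (mult_var (i',b) (shift (i,a') (shift (i',a) z))) c)
     + mult_var (j,b) (shift (i,a) z) c" .
  have "col_op R a b (row_op C i j z) c =
     (\<Sum>i'\<in>R. \<Sum>a'\<in>C. mult_var (i',b) (mult_var (j,a') (shift (i',a) (shift (i,a') z))) c)
     + (\<Sum>i'\<in>R. \<Sum>a'\<in>C. if i' = j \<and> a = a' then mult_var (i',b) (shift (i,a') z) c else 0)"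
    unfolding row_op_def col_op_def sum.distrib[symmetric]
    by (simp add: weyl_product sum.distrib)
  also have "(\<Sum>i'\<in>R. \<Sum>a'\<in>C. if i' = j \<and> a = a' then mult_var (i',b) (shift (i,a') z) c else 0)
     = mult_var (j,b) (shift (i,a) z) c"
    using assms by (subst sum.swap) (simp add: if_if_eq_conj[symmetric])
  also have "(\<Sum>i'\<in>R. \<Sum>a'\<in>C. mult_var (i',b) (mult_var (j,a') (shift (i',a) (shift (i,a') z))) c)
    = (\<Sum>a'\<in>C. \<Sum>i'\<in>R. mult_var (j,a') (mult_var (i',b) (shift (i,a') (shift (i',a) z))) c)"
    by (subst sum.swap) (simp add: mult_var_commute shift_commute)
  finally show "row_op C i j (col_op R a b z) c = col_op R a b (row_op C i j z) c"
    using 1 by simp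
qed

lemma row_op_zero [simp]: "row_op C i j (\<lambda>c. 0) = (\<lambda>c. 0)" "col_op R a b (\<lambda>c. 0) = (\<lambda>c. 0)"
  by (simp_all add: row_op_def col_op_def)

text \<open>The commutator of the operators from l to i and from j to n is, up to sign, the operator
  from l to n if i = j; otherwise it vanishes, because l and n differ. So moving degree from row j
  to row n maps solutions to solutions.\<close>

lemma row_op_solution:
  assumes "finite C" "l \<noteq> n" "row_op C l i z = (\<lambda>c. 0)" "row_op C l n z = (\<lambda>c. 0)"
  shows "row_op C l i (row_op C j n z) = (\<lambda>c. 0)"
proof
  fix c
  have "row_op C l i (row_op C j n z) c =
     (\<Sum>a\<in>C. \<Sum>b\<in>C. mult_var (i,a) (mult_var (n,b) (shift (l,a) (shift (j,b) z))) c)"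
    unfolding row_op_def using assms(2) by (simp add: weyl_product)
  moreover have "row_op C j n (row_op C l i z) c =
     (\<Sum>b\<in>C. \<Sum>a\<in>C. mult_var (n,b) (mult_var (i,a) (shift (j,b) (shift (l,a) z))) c)
     + (\<Sum>b\<in>C. \<Sum>a\<in>C. if j = i \<and> b = a then mult_var (n,b) (shift (l,a) z) c else 0)"
    unfolding row_op_def sum.distrib[symmetric]
    by (simp add: weyl_product sum.distrib)
  moreover have "(\<Sum>b\<in>C. \<Sum>a\<in>C. if j = i \<and> b = a then mult_var (n,b) (shift (l,a) z) c else 0)
    = (if j = i then row_op C l n z c else 0)"
    using assms(1) by (simp add: row_op_def if_if_eq_conj[symmetric])
  moreover have "(\<Sum>b\<in>C. \<Sum>a\<in>C. mult_var (n,b) (mult_var (i,a) (shift (j,b) (shift (l,a) z))) c)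
    = (\<Sum>a\<in>C. \<Sum>b\<in>C. mult_var (i,a) (mult_var (n,b) (shift (l,a) (shift (j,b) z))) c)"
    by (subst sum.swap) (simp add: mult_var_commute shift_commute)
  ultimately show "row_op C l i (row_op C j n z) c = 0" using assms(3,4) by (auto split: if_splits)
qed

lemma row_op_shift:
  assumes "finite C" "a \<in> C" "n \<noteq> j"
  shows "row_op C j n (shift (n, a) u) = (\<lambda>c. shift (n, a) (row_op C j n u) c - shift (j, a) u c)"
    and "row_op C j n (shift (j, a) u) = shift (j, a) (row_op C j n u)"
proof -
  have "shift (n, a) (row_op C j n u) c =
     (\<Sum>b\<in>C. mult_var (n,b) (shift (n,a) (shift (j,b) u)) c + (if a = b then shift (j,b) u c else 0))" for c
    unfolding row_op_def by (simp add: shift_mult_var)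
  also have "\<dots> c = row_op C j n (shift (n, a) u) c + shift (j,a) u c" for c
    using assms by (simp add: sum.distrib row_op_def shift_commute)
  finally show "row_op C j n (shift (n, a) u) = (\<lambda>c. shift (n, a) (row_op C j n u) c - shift (j, a) u c)"
    by simp
  show "row_op C j n (shift (j, a) u) = shift (j, a) (row_op C j n u)"
    unfolding row_op_def using assms by (simp add: shift_mult_var shift_commute)
qed

lemma row_op_diff: "row_op C i j (\<lambda>c. x c - r * y c) = (\<lambda>c. row_op C i j x c - r * row_op C i j y c)"
proof -
  have "mult_var (j, a) (shift (i, a) (\<lambda>c. x c - r * y c)) c =
      mult_var (j, a) (shift (i, a) x) c - r * mult_var (j, a) (shift (i, a) y) c" for a c
    by (simp add: mult_var_def shift_def right_diff_distrib mult.left_commute)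
  then show ?thesis by (simp add: row_op_def sum_subtractf sum_distrib_left)
qed

text \<open>Iterates the commutator with a derivative in row n, which is minus the derivative in row
  j and commutes with the operator itself. The factor k + 1 collected here is what has to be
  invertible later.\<close>

lemma row_op_pow_shift:
  assumes "finite C" "a \<in> C" "n \<noteq> j"
  shows "(row_op C j n ^^ Suc k) (shift (n, a) u) =
    (\<lambda>c. shift (n, a) ((row_op C j n ^^ Suc k) u) c - of_nat (Suc k) * shift (j, a) ((row_op C j n ^^ k) u) c)"
    and "(row_op C j n ^^ k) (shift (j, a) u) = shift (j, a) ((row_op C j n ^^ k) u)"
proof -
  show 2: "(row_op C j n ^^ k) (shift (j, a) u) = shift (j, a) ((row_op C j n ^^ k) u)" for k
    by (induction k) (simp_all add: row_op_shift(2)[OF assms])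
  show "(row_op C j n ^^ Suc k) (shift (n, a) u) =
    (\<lambda>c. shift (n, a) ((row_op C j n ^^ Suc k) u) c - of_nat (Suc k) * shift (j, a) ((row_op C j n ^^ k) u) c)"
  proof (induction k)
    case 0
    then show ?case by (simp add: row_op_shift(1)[OF assms])
  next
    case (Suc k)
    have "(row_op C j n ^^ Suc (Suc k)) (shift (n, a) u) = row_op C j n ((row_op C j n ^^ Suc k) (shift (n, a) u))"
      by simp
    also have "\<dots> = (\<lambda>c. row_op C j n (shift (n, a) ((row_op C j n ^^ Suc k) u)) c
        - of_nat (Suc k) * row_op C j n (shift (j, a) ((row_op C j n ^^ k) u)) c)"
      unfolding Suc by (rule row_op_diff)
    also have "\<dots> = (\<lambda>c. shift (n, a) ((row_op C j n ^^ Suc (Suc k)) u) c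
        - of_nat (Suc (Suc k)) * shift (j, a) ((row_op C j n ^^ Suc k) u) c)"
      by (simp add: row_op_shift[OF assms] algebra_simps)
    finally show ?case .
  qed
qed

section \<open>Degrees in the rows, and injectivity of row operators\<close>

definition row_sum :: "'c set \<Rightarrow> ('i \<times> 'c \<Rightarrow> nat) \<Rightarrow> 'i \<Rightarrow> nat" where
  "row_sum C c i = (\<Sum>a\<in>C. c (i, a))"

lemma row_sum_inc:
  assumes "finite C" "a \<in> C"
  shows "row_sum C (c((j, a) := Suc (c (j, a)))) i = row_sum C c i + (if i = j then 1 else 0)"
proof (cases "i = j")
  case True
  have "row_sum C (c((j, a) := Suc (c (j, a)))) j = (\<Sum>b\<in>C. c (j, b) + (if b = a then 1 else 0))"
    unfolding row_sum_def by (intro sum.cong) auto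
  then show ?thesis using True assms by (simp add: sum.distrib row_sum_def)
qed (simp add: row_sum_def)

lemma row_sum_dec:
  assumes "finite C" "a \<in> C" "c (j, a) > 0"
  shows "row_sum C (c((j, a) := c (j, a) - 1)) i + (if i = j then 1 else 0) = row_sum C c i"
proof -
  have "(c((j, a) := c (j, a) - 1))((j, a) := Suc ((c((j, a) := c (j, a) - 1)) (j, a))) = c"
    using assms(3) by (simp add: fun_eq_iff)
  then show ?thesis using row_sum_inc[OF assms(1,2), of "c((j, a) := c (j, a) - 1)" j i] by simp
qed

lemma row_sum_pos: "finite C \<Longrightarrow> row_sum C c i > 0 \<longleftrightarrow> (\<exists>a\<in>C. c (i, a) > 0)"
  unfolding row_sum_def by (simp flip: neq0_conv)

text \<open>Differentiating a divided power produces no factor, so the derivatives in row n recover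
  every coefficient in which row n occurs. Unlike Euler's formula this needs no division.\<close>

lemma shift_zero_all:
  assumes "finite C" "\<And>a. a \<in> C \<Longrightarrow> shift (n, a) u = (\<lambda>c. 0)" "\<And>c. u c \<noteq> 0 \<Longrightarrow> row_sum C c n > 0"
  shows "u = (\<lambda>c. 0)"
proof (rule ccontr)
  assume "u \<noteq> (\<lambda>c. 0)"
  then obtain c where c: "u c \<noteq> 0" by auto
  then obtain a where a: "a \<in> C" "c (n, a) > 0" using assms(3)[OF c] row_sum_pos[OF assms(1)] by metis
  have "shift (n, a) u (c((n, a) := c (n, a) - 1)) = u c"
    using a unfolding shift_def by (intro arg_cong[of _ _ u]) auto
  then show False using assms(2)[OF a(1)] c by simp
qed

text \<open>Representation theory of sl2 for the two rows: the operator moves degree from j to n and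
  is injective while row j is ahead. A derivative in row n lowers a by one and, by the commutator
  formula, raises k by one, so a + k stays constant. Division happens only once row n is empty; then
  the formula leaves k times a derivative in row j, and k \<le> q.\<close>

lemma row_op_pow_injective:
  fixes u :: "('i \<times> 'c \<Rightarrow> nat) \<Rightarrow> 'k::idom"
  assumes C: "finite C" and nj: "n \<noteq> j" and q: "\<And>k. 0 < k \<Longrightarrow> k \<le> q \<Longrightarrow> of_nat k \<noteq> (0::'k)"
  shows "(row_op C j n ^^ k) u = (\<lambda>c. 0) \<Longrightarrow> (\<And>c. u c \<noteq> 0 \<Longrightarrow> row_sum C c n = a) \<Longrightarrow>
    (\<And>c. u c \<noteq> 0 \<Longrightarrow> row_sum C c j \<ge> a + k) \<Longrightarrow> a + k \<le> q \<Longrightarrow> u = (\<lambda>c. 0)"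
proof (induction a arbitrary: k u)
  case 0
  from 0 show ?case
  proof (induction k arbitrary: u)
    case (Suc k)
    have "shift (j, b) u = (\<lambda>c. 0)" if b: "b \<in> C" for b
    proof (rule Suc.IH)
      have "shift (n, b) u c = 0" for c
        using Suc.prems(2)[of "c((n, b) := Suc (c (n, b)))"] row_sum_inc[OF C b, of c n n]
        by (auto simp: shift_apply simp del: fun_upd_apply)
      then have "shift (n, b) u = (\<lambda>c. 0)" by auto
      then have "(row_op C j n ^^ Suc k) (shift (n, b) u) = (\<lambda>c. 0)"
        by (induction k) auto
      then have "of_nat (Suc k) * shift (j, b) ((row_op C j n ^^ k) u) c = 0" for c
        using row_op_pow_shift(1)[OF C b nj, of k u, unfolded Suc.prems(1)]
        by (auto simp: fun_eq_iff simp del: funpow.simps of_nat_Suc)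
      then show "(row_op C j n ^^ k) (shift (j, b) u) = (\<lambda>c. 0)"
        using q[of "Suc k"] Suc.prems(4) row_op_pow_shift(2)[OF C b nj, of k u] by (auto simp del: of_nat_Suc)
      show "row_sum C c n = 0" if "shift (j, b) u c \<noteq> 0" for c
        using Suc.prems(2)[of "c((j, b) := Suc (c (j, b)))"] row_sum_inc[OF C b, of c j n] that nj
        by (auto simp: shift_apply simp del: fun_upd_apply)
      show "0 + k \<le> row_sum C c j" if "shift (j, b) u c \<noteq> 0" for c
        using Suc.prems(3)[of "c((j, b) := Suc (c (j, b)))"] row_sum_inc[OF C b, of c j j] that nj
        by (auto simp: shift_apply simp del: fun_upd_apply)
      show "0 + k \<le> q" using Suc.prems(4) by simp
    qed
    moreover have "row_sum C c j > 0" if "u c \<noteq> 0" for c using Suc.prems(3)[OF that] by simp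
    ultimately show ?case by (rule shift_zero_all[OF C])
  qed simp
next
  case (Suc a)
  have "shift (n, b) u = (\<lambda>c. 0)" if b: "b \<in> C" for b
  proof (rule Suc.IH)
    have "(row_op C j n ^^ Suc k) u = (\<lambda>c. 0)" using Suc.prems(1) by simp
    then show "(row_op C j n ^^ Suc k) (shift (n, b) u) = (\<lambda>c. 0)"
      using row_op_pow_shift(1)[OF C b nj, of k u] Suc.prems(1) by simp
    show "row_sum C c n = a" if "shift (n, b) u c \<noteq> 0" for c
      using Suc.prems(2)[of "c((n, b) := Suc (c (n, b)))"] row_sum_inc[OF C b, of c n n] that
      by (auto simp: shift_apply simp del: fun_upd_apply)
    show "a + Suc k \<le> row_sum C c j" if "shift (n, b) u c \<noteq> 0" for c
      using Suc.prems(3)[of "c((n, b) := Suc (c (n, b)))"] row_sum_inc[OF C b, of c n j] that nj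
      by (auto simp: shift_apply simp del: fun_upd_apply)
    show "a + Suc k \<le> q" using Suc.prems(4) by simp
  qed
  moreover have "row_sum C c n > 0" if "u c \<noteq> 0" for c using Suc.prems(2)[OF that] by simp
  ultimately show ?case by (rule shift_zero_all[OF C])
qed

text \<open>Read as a propagation principle: if no member of a family closed under moving degree
  into column b sees an exponent whose row n lies in column b alone, the family is zero. The
  induction is on the number of units of row n outside column b.\<close>

lemma col_op_vanishing:
  fixes Q :: "(('i \<times> 'c \<Rightarrow> nat) \<Rightarrow> 'k::idom) set"
  assumes C: "finite C" and R: "finite R" "n \<in> R" and b: "b \<in> C"
    and q: "\<And>k. 0 < k \<Longrightarrow> k \<le> t \<Longrightarrow> of_nat k \<noteq> (0::'k)"
    and closed: "\<And>z a. z \<in> Q \<Longrightarrow> a \<in> C - {b} \<Longrightarrow> col_op R a b z \<in> Q"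
    and deg: "\<And>z c. z \<in> Q \<Longrightarrow> z c \<noteq> 0 \<Longrightarrow> row_sum C c n = t"
    and top: "\<And>z c. z \<in> Q \<Longrightarrow> (\<forall>a\<in>C - {b}. c (n, a) = 0) \<Longrightarrow> z c = 0"
  shows "z \<in> Q \<Longrightarrow> z c = 0"
proof (induction "\<Sum>a\<in>C - {b}. c (n, a)" arbitrary: z c rule: less_induct)
  case less
  show ?case
  proof (cases "\<forall>a\<in>C - {b}. c (n, a) = 0")
    case True
    then show ?thesis using top less.prems by blast
  next
    case False
    then obtain a where a: "a \<in> C - {b}" "c (n, a) > 0" by auto
    show ?thesis
    proof (rule ccontr)
      assume nz: "z c \<noteq> 0"
      \<comment> \<open>One unit of row n moves from a to b. At \<open>c'\<close> the summand of the
        column operator for row n is \<open>z c\<close> times \<open>Suc (c (n, b))\<close>; in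
        every other summand row n is that of \<open>c'\<close>, which already has fewer units
        outside b.\<close>
      define c' where "c' = c((n, a) := c (n, a) - 1, (n, b) := Suc (c (n, b)))"
      have "(\<Sum>x\<in>C - {b}. c' (n, x)) < (\<Sum>x\<in>C - {b}. c (n, x))"
        by (rule sum_strict_mono_ex1) (use a C in \<open>auto simp: c'_def\<close>)
      note lt = this
      have "col_op R a b z c' = 0"
        using less.hyps[OF lt closed[OF less.prems a(1)]] .
      moreover have "col_op R a b z c' = mult_var (n, b) (shift (n, a) z) c'"
        unfolding col_op_def
      proof (rule sum.remove[OF R(1,2), THEN trans])
        have "mult_var (i, b) (shift (i, a) z) c' = 0" if "i \<in> R - {n}" for i
        proof -
          define d where "d = (c'((i, b) := c' (i, b) - 1))"
          have "d (n, x) = c' (n, x)" for x using that by (auto simp: d_def)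
          then have "(\<Sum>x\<in>C - {b}. (d((i, a) := Suc (d (i, a)))) (n, x)) = (\<Sum>x\<in>C - {b}. c' (n, x))"
            using that by (intro sum.cong) auto
          then have "z (d((i, a) := Suc (d (i, a)))) = 0" using less.hyps[OF _ less.prems] lt by simp
          then show ?thesis unfolding mult_var_def shift_def d_def by simp
        qed
        then show "mult_var (n, b) (shift (n, a) z) c' + (\<Sum>i\<in>R - {n}. mult_var (i, b) (shift (i, a) z) c')
           = mult_var (n, b) (shift (n, a) z) c'" by simp
      qed
      moreover have "mult_var (n, b) (shift (n, a) z) c' = of_nat (Suc (c (n, b))) * z c"
      proof -
        have "c'((n, b) := c' (n, b) - 1, (n, a) := Suc ((c'((n, b) := c' (n, b) - 1)) (n, a))) = c"
          using a by (auto simp: c'_def fun_eq_iff)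
        then show ?thesis unfolding mult_var_def shift_def by (simp add: c'_def)
      qed
      moreover have "Suc (c (n, b)) \<le> t"
      proof -
        have "row_sum C c n = t" using deg[OF less.prems nz] .
        moreover have "row_sum C c n = c (n, b) + (c (n, a) + (\<Sum>x\<in>C - {b} - {a}. c (n, x)))"
          unfolding row_sum_def using a b C by (simp add: sum.remove)
        ultimately show ?thesis using a by simp
      qed
      ultimately show False using nz q[of "Suc (c (n, b))"] by (simp del: of_nat_Suc)
    qed
  qed
qed

section \<open>Effect of the operators on supports and row degrees\<close>

lemma row_op_support:
  assumes C: "finite C" and ij: "i \<noteq> j" and nz: "row_op C i j z c \<noteq> 0"
  obtains a where "a \<in> C" "c (j, a) > 0" "z (c((j, a) := c (j, a) - 1, (i, a) := Suc (c (i, a)))) \<noteq> 0"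
proof -
  obtain a where a: "a \<in> C" "mult_var (j, a) (shift (i, a) z) c \<noteq> 0"
    using nz unfolding row_op_def by (meson sum.neutral)
  then have "c (j, a) > 0" "z (c((j, a) := c (j, a) - 1, (i, a) := Suc (c (i, a)))) \<noteq> 0"
    using ij by (auto simp: mult_var_def shift_def intro: Nat.gr0I)
  then show thesis using that a by blast
qed

lemma row_op_row_sum:
  assumes C: "finite C" and ij: "i \<noteq> j" and nz: "row_op C i j z c \<noteq> 0"
    and deg: "\<And>c. z c \<noteq> 0 \<Longrightarrow> row_sum C c k = d"
  shows "row_sum C c k + (if k = i then 1 else 0) = d + (if k = j then 1 else 0)"
proof -
  obtain a where a: "a \<in> C" "c (j, a) > 0" "z (c((j, a) := c (j, a) - 1, (i, a) := Suc (c (i, a)))) \<noteq> 0"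
    using row_op_support[OF C ij nz] .
  let ?c = "c((j, a) := c (j, a) - 1)"
  have "?c((i, a) := Suc (?c (i, a))) = c((j, a) := c (j, a) - 1, (i, a) := Suc (c (i, a)))"
    using ij by auto
  then have "row_sum C ?c k + (if k = i then 1 else 0) = d"
    using deg[OF a(3)] row_sum_inc[OF C a(1), of ?c i k] by simp
  then show ?thesis using row_sum_dec[of C a c j k, OF C a(1,2)] by simp
qed

lemma col_op_row_sum:
  assumes C: "finite C" "a \<in> C" "b \<in> C" "a \<noteq> b" and nz: "col_op R a b z c \<noteq> 0"
    and deg: "\<And>c. z c \<noteq> 0 \<Longrightarrow> row_sum C c k = d"
  shows "row_sum C c k = d"
proof -
  obtain i where i: "i \<in> R" "mult_var (i, b) (shift (i, a) z) c \<noteq> 0"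
    using nz unfolding col_op_def by (meson sum.neutral)
  let ?c = "c((i, b) := c (i, b) - 1)"
  have "c (i, b) > 0" "z (?c((i, a) := Suc (?c (i, a)))) \<noteq> 0"
    using i(2) C(4) by (auto simp: mult_var_def shift_def intro: Nat.gr0I)
  then show ?thesis
    using deg row_sum_inc[OF C(1,2), of ?c i k] row_sum_dec[of C b c i k, OF C(1,3)]
    by fastforce
qed

text \<open>At exponents whose row n lies in column b alone, equation n has a single term and forces
  row l to avoid column b. The part of z at these exponents then solves the system without row n and
  column b, to which \<open>IH\<close>, the degree bound for smaller systems, applies.\<close>

lemma top_exponent_bound:
  fixes z :: "('i \<times> 'c \<Rightarrow> nat) \<Rightarrow> 'k::idom"
  assumes C: "finite C" and R: "finite R" and n: "n \<in> R" and l: "l \<notin> R" and b: "b \<in> C"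
    and q: "\<And>k. 0 < k \<Longrightarrow> k \<le> q \<Longrightarrow> of_nat k \<noteq> (0::'k)"
    and IH: "\<And>z :: ('i \<times> 'c \<Rightarrow> nat) \<Rightarrow> 'k. \<And>c. (\<And>j. j \<in> R - {n} \<Longrightarrow> row_op (C - {b}) l j z = (\<lambda>c. 0)) \<Longrightarrow>
      z c \<noteq> 0 \<Longrightarrow> row_sum (C - {b}) c l > 0 \<Longrightarrow> card (R - {n}) * q \<le> (\<Sum>j\<in>R - {n}. row_sum (C - {b}) c j)"
    and z: "\<And>j. j \<in> R \<Longrightarrow> row_op C l j z = (\<lambda>c. 0)"
    and deg: "\<And>c. z c \<noteq> 0 \<Longrightarrow> row_sum C c n < q"
    and pos: "row_sum C c l > 0"
    and top: "\<And>a. a \<in> C - {b} \<Longrightarrow> c (n, a) = 0" and nz: "z c \<noteq> 0"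
  shows "card (R - {n}) * q \<le> (\<Sum>j\<in>R - {n}. row_sum (C - {b}) c j) \<and> row_sum (C - {b}) c l > 0"
proof
  have ln: "l \<noteq> n" using l n by auto
  have lb: "c (l, b) = 0" if top: "\<forall>a\<in>C - {b}. c (n, a) = 0" and nz: "z c \<noteq> 0" for c
  proof (rule ccontr)
    assume lb: "c (l, b) \<noteq> 0"
    \<comment> \<open>The exponent at which equation n is evaluated: its term for column b returns
      to c with a factor at most q, and the other terms have factor 0.\<close>
    define c' where "c' = c((n, b) := Suc (c (n, b)), (l, b) := c (l, b) - 1)"
    have "mult_var (n, a) (shift (l, a) z) c' = 0" if "a \<in> C - {b}" for a
      using that top by (simp add: mult_var_def c'_def)
    then have "row_op C l n z c' = mult_var (n, b) (shift (l, b) z) c'"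
      unfolding row_op_def using C b by (subst sum.remove[of _ b]) auto
    also have "\<dots> = of_nat (Suc (c (n, b))) * z c"
    proof -
      have "c'((n, b) := c (n, b), (l, b) := c (l, b)) = c"
        using ln by (auto simp: c'_def fun_eq_iff)
      then show ?thesis using lb ln by (simp add: mult_var_def shift_def c'_def fun_upd_twist)
    qed
    finally have "of_nat (Suc (c (n, b))) * z c = 0" using z[OF n] by simp
    moreover have "c (n, b) < q"
    proof -
      have "row_sum C c n = c (n, b) + (\<Sum>a\<in>C - {b}. c (n, a))"
        unfolding row_sum_def using C b by (rule sum.remove)
      then show ?thesis using deg[OF nz] by simp
    qed
    ultimately show False using q[of "Suc (c (n, b))"] nz by (simp del: of_nat_Suc)
  qed
  define z0 where "z0 c = (if \<forall>a\<in>C - {b}. c (n, a) = 0 then z c else 0)" for c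
  have "row_op (C - {b}) l j z0 = (\<lambda>c. 0)" if j: "j \<in> R - {n}" for j
  proof
    fix c
    show "row_op (C - {b}) l j z0 c = 0"
    proof (cases "\<forall>a\<in>C - {b}. c (n, a) = 0")
      case True
      have tr: "(\<forall>x\<in>C - {b}. (c((j, a) := r, (l, a) := s)) (n, x) = 0)" for a r s
        using True j ln by auto
      have e: "c((j, a) := r, (l, a) := Suc ((c((j, a) := r)) (l, a))) = c((j, a) := r, (l, a) := Suc (c (l, a)))" for a r
        using j l by auto
      have "mult_var (j, a) (shift (l, a) z0) c = mult_var (j, a) (shift (l, a) z) c" for a
        unfolding mult_var_def shift_def e z0_def using tr[of a] by simp
      moreover have "z (c((j, b) := c (j, b) - 1, (l, b) := Suc (c (l, b)))) = 0"
      proof (rule ccontr)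
        assume "z (c((j, b) := c (j, b) - 1, (l, b) := Suc (c (l, b)))) \<noteq> 0"
        from lb[OF tr this] show False by simp
      qed
      then have "mult_var (j, b) (shift (l, b) z) c = 0"
        unfolding mult_var_def shift_def e by simp
      ultimately have "row_op (C - {b}) l j z0 c = row_op C l j z c"
        unfolding row_op_def using C b by (simp add: sum.remove[of C b])
      then show ?thesis using z j by simp
    next
      case False
      then obtain x where x: "x \<in> C - {b}" "c (n, x) \<noteq> 0" by auto
      have "mult_var (j, a) (shift (l, a) z0) c = 0" for a
      proof -
        have "(c((j, a) := r, (l, a) := s)) (n, x) \<noteq> 0" for r s using x j ln by auto
        then show ?thesis unfolding mult_var_def shift_def z0_def using x by (smt (verit) mult_zero_right)
      qed
      then show ?thesis unfolding row_op_def by simp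
    qed
  qed
  note h = this
  have z0c: "z0 c \<noteq> 0" using top nz by (simp add: z0_def)
  have "row_sum C c l = c (l, b) + row_sum (C - {b}) c l"
    unfolding row_sum_def using C b by (rule sum.remove)
  moreover have "c (l, b) = 0" using lb[of c] top nz by blast
  ultimately show p: "row_sum (C - {b}) c l > 0" using pos by simp
  show "card (R - {n}) * q \<le> (\<Sum>j\<in>R - {n}. row_sum (C - {b}) c j)"
    by (rule IH[OF h z0c p])
qed

section \<open>Lower bound for the degree of a solution\<close>

definition homogeneous_solutions ::
    "'i set \<Rightarrow> 'c set \<Rightarrow> 'i \<Rightarrow> ('i \<Rightarrow> nat) \<Rightarrow> (('i \<times> 'c \<Rightarrow> nat) \<Rightarrow> 'k::comm_ring_1) set" where
  "homogeneous_solutions R C l \<delta> = {z. (\<forall>j\<in>R. row_op C l j z = (\<lambda>c. 0)) \<and>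
     (\<forall>c. z c \<noteq> 0 \<longrightarrow> (\<forall>i\<in>insert l R. row_sum C c i = \<delta> i))}"

lemma homogeneous_solutions_col_op:
  assumes "finite C" "finite R" "l \<notin> R" "a \<in> C" "b \<in> C" "a \<noteq> b" "z \<in> homogeneous_solutions R C l \<delta>"
  shows "col_op (insert l R) a b z \<in> homogeneous_solutions R C l \<delta>"
  unfolding homogeneous_solutions_def
proof (intro CollectI conjI ballI allI impI)
  fix j assume j: "j \<in> R"
  then have "row_op C l j (col_op (insert l R) a b z) = col_op (insert l R) a b (row_op C l j z)"
    using assms by (intro row_col_commute) auto
  then show "row_op C l j (col_op (insert l R) a b z) = (\<lambda>c. 0)"
    using assms(7) j by (simp add: homogeneous_solutions_def)
next
  fix c i assume c: "col_op (insert l R) a b z c \<noteq> 0" "i \<in> insert l R"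
  show "row_sum C c i = \<delta> i"
    by (rule col_op_row_sum[OF assms(1,4,5,6) c(1)]) (use assms(7) c(2) in \<open>auto simp: homogeneous_solutions_def\<close>)
qed

lemma homogeneous_solutions_row_op:
  assumes "finite C" "l \<notin> R" "n \<in> R" "j \<in> R" "n \<noteq> j" "z \<in> homogeneous_solutions R C l \<delta>"
  shows "row_op C j n z \<in> homogeneous_solutions R C l (\<delta>(n := Suc (\<delta> n), j := \<delta> j - 1))"
  unfolding homogeneous_solutions_def
proof (intro CollectI conjI ballI allI impI)
  fix i assume "i \<in> R"
  then show "row_op C l i (row_op C j n z) = (\<lambda>c. 0)"
    using assms by (intro row_op_solution) (auto simp: homogeneous_solutions_def)
next
  fix c i assume c: "row_op C j n z c \<noteq> 0" "i \<in> insert l R"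
  have "row_sum C c i + (if i = j then 1 else 0) = \<delta> i + (if i = n then 1 else 0)"
    by (rule row_op_row_sum[OF assms(1) _ c(1)]) (use assms(5,6) c(2) in \<open>auto simp: homogeneous_solutions_def\<close>)
  then show "row_sum C c i = (\<delta>(n := Suc (\<delta> n), j := \<delta> j - 1)) i"
    using assms(5) by (auto split: if_splits)
qed

text \<open>In an extremal counterexample every operator into row n vanishes on y, so no row is
  longer than row n. At an exponent with row n in column b alone, \<open>IH\<close> would make the
  other rows too long, so there is no such exponent in the support of a solution of this degree; by
  \<open>col_op_vanishing\<close> there is then no nonzero solution at all.\<close>

lemma solution_degree_bound_square:
  fixes z :: "('i \<times> 'c \<Rightarrow> nat) \<Rightarrow> 'k::idom"
  assumes C: "finite C" and R: "finite R" and l: "l \<notin> R" and card: "card C = card R"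
    and q: "\<And>k. 0 < k \<Longrightarrow> k \<le> q \<Longrightarrow> of_nat k \<noteq> (0::'k)"
    and IH: "\<And>(z :: ('i \<times> 'c \<Rightarrow> nat) \<Rightarrow> 'k) c n b. n \<in> R \<Longrightarrow> b \<in> C \<Longrightarrow>
      (\<And>j. j \<in> R - {n} \<Longrightarrow> row_op (C - {b}) l j z = (\<lambda>c. 0)) \<Longrightarrow>
      z c \<noteq> 0 \<Longrightarrow> row_sum (C - {b}) c l > 0 \<Longrightarrow> card (R - {n}) * q \<le> (\<Sum>j\<in>R - {n}. row_sum (C - {b}) c j)"
    and z: "z \<in> homogeneous_solutions R C l \<delta>" and nz: "z \<noteq> (\<lambda>c. 0)"
    and pos: "\<delta> l > 0"
  shows "card R * q \<le> (\<Sum>j\<in>R. \<delta> j)"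
proof (rule ccontr)
  assume small: "\<not> card R * q \<le> (\<Sum>j\<in>R. \<delta> j)"
  define sol :: "('i \<Rightarrow> nat) \<Rightarrow> (('i \<times> 'c \<Rightarrow> nat) \<Rightarrow> 'k) set" where "sol = homogeneous_solutions R C l"
  define good where "good \<delta> \<longleftrightarrow> (\<exists>z\<in>sol \<delta>. z \<noteq> (\<lambda>c. 0)) \<and> \<delta> l > 0 \<and> (\<Sum>j\<in>R. \<delta> j) < card R * q" for \<delta>
  \<comment> \<open>The maximum is taken over all row degrees of counterexamples at once, since
    moving degree between rows changes \<delta> but neither the total degree nor the degree in
    l.\<close>
  define D where "D = {\<delta> n | \<delta> n. good \<delta> \<and> n \<in> R \<and> \<delta> n < q}"
  obtain c0 where c0: "z c0 \<noteq> 0" using nz by auto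
  have "good \<delta>" unfolding good_def sol_def using z nz pos small by auto
  moreover have "\<exists>n\<in>R. \<delta> n < q"
  proof (rule ccontr)
    assume "\<not> (\<exists>n\<in>R. \<delta> n < q)"
    then have "(\<Sum>j\<in>R. q) \<le> (\<Sum>j\<in>R. \<delta> j)" by (intro sum_mono) (auto simp: not_less)
    then show False using small by simp
  qed
  ultimately have "D \<noteq> {}" unfolding D_def by blast
  have "finite D" by (rule finite_subset[of _ "{..<q}"]) (auto simp: D_def)
  then have "Max D \<in> D" using \<open>D \<noteq> {}\<close> by (rule Max_in)
  then obtain \<delta>' n where dn: "Max D = \<delta>' n" "good \<delta>'" "n \<in> R" "\<delta>' n < q" unfolding D_def by blast
  then obtain y where y: "y \<in> sol \<delta>'" "y \<noteq> (\<lambda>c. 0)" unfolding good_def by blast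
  have lpos: "\<delta>' l > 0" and tot: "(\<Sum>j\<in>R. \<delta>' j) < card R * q" using dn(2) by (auto simp: good_def)
  have hom: "row_sum C c i = \<delta>' i" if "x \<in> sol \<delta>'" "x c \<noteq> 0" "i \<in> insert l R" for x c i
    using that by (auto simp: sol_def homogeneous_solutions_def)
  have "C \<noteq> {}"
    using dn(3) card R by auto
  then obtain b where b: "b \<in> C" by blast
  have top: "card (R - {n}) * q \<le> (\<Sum>j\<in>R - {n}. row_sum (C - {b}) c j)" "row_sum (C - {b}) c l > 0"
    if "x \<in> sol \<delta>'" "x c \<noteq> 0" "\<forall>a\<in>C - {b}. c (n, a) = 0" for x c
  proof -
    have "card (R - {n}) * q \<le> (\<Sum>j\<in>R - {n}. row_sum (C - {b}) c j) \<and> row_sum (C - {b}) c l > 0"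
    proof (rule top_exponent_bound[OF C R dn(3) l b, where z = x])
      show "card (R - {n}) * q \<le> (\<Sum>j\<in>R - {n}. row_sum (C - {b}) d j)"
        if "\<And>j. j \<in> R - {n} \<Longrightarrow> row_op (C - {b}) l j y = (\<lambda>c. 0)" "y d \<noteq> 0" "row_sum (C - {b}) d l > 0"
        for y :: "('i \<times> 'c \<Rightarrow> nat) \<Rightarrow> 'k" and d
        by (rule IH[OF dn(3) b that])
      show "\<And>c. x c \<noteq> 0 \<Longrightarrow> row_sum C c n < q" using hom[OF that(1)] dn(3,4) by auto
      show "row_sum C c l > 0" using hom[OF that(1,2)] lpos by auto
      show "\<And>j. j \<in> R \<Longrightarrow> row_op C l j x = (\<lambda>c. 0)"
      using that(1) by (auto simp: sol_def homogeneous_solutions_def)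
    qed (use q that in auto)
    then show "card (R - {n}) * q \<le> (\<Sum>j\<in>R - {n}. row_sum (C - {b}) c j)" "row_sum (C - {b}) c l > 0"
      by blast+
  qed
  have cardn: "card R = Suc (card (R - {n}))" using R dn(3) by (rule card.remove)
  have sumn: "(\<Sum>j\<in>R. \<delta>' j) = \<delta>' n + (\<Sum>j\<in>R - {n}. \<delta>' j)" using R dn(3) by (rule sum.remove)
  \<comment> \<open>A nonzero image is a counterexample with one more unit in row n, so maximality
    leaves only the case q = \<delta>' n + 1. An image seen at an exponent with row n in column b
    comes from a solution with a unit at (j, b), which the bound for the remaining columns does not
    count. This strict inequality supplies the one unit missing for a contradiction.\<close>
  have kill: "row_op C j n y = (\<lambda>c. 0)" if j: "j \<in> R - {n}" for j
  proof (rule ccontr)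
    assume nz: "row_op C j n y \<noteq> (\<lambda>c. 0)"
    let ?\<delta> = "\<delta>'(n := Suc (\<delta>' n), j := \<delta>' j - 1)"
    have rs: "row_op C j n x \<in> sol ?\<delta>" if "x \<in> sol \<delta>'" for x
      using homogeneous_solutions_row_op[OF C l dn(3), of j x \<delta>'] that j by (auto simp: sol_def)
    obtain c where c: "row_op C j n y c \<noteq> 0" using nz by auto
    have "row_sum C c j + 1 = \<delta>' j"
      using row_op_row_sum[OF C _ c, of j "\<delta>' j"] hom[OF y(1)] j by auto
    then have dj: "\<delta>' j > 0" by simp
    have "(\<Sum>i\<in>R. ?\<delta> i) = (\<Sum>i\<in>R. \<delta>' i)"
    proof -
      have jn: "j \<in> R - {n}" "finite (R - {n})" "n \<noteq> j" using j R by auto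
      have "(\<Sum>i\<in>R. ?\<delta> i) = Suc (\<delta>' n) + ((\<delta>' j - 1) + (\<Sum>i\<in>R - {n} - {j}. \<delta>' i))"
        using jn(3) by (simp add: sum.remove[OF R dn(3)] sum.remove[OF jn(2,1)])
      also have "\<dots> = \<delta>' n + (\<delta>' j + (\<Sum>i\<in>R - {n} - {j}. \<delta>' i))" using dj by simp
      also have "\<dots> = (\<Sum>i\<in>R. \<delta>' i)" by (simp add: sum.remove[OF R dn(3)] sum.remove[OF jn(2,1)])
      finally show ?thesis .
    qed
    moreover have "?\<delta> l > 0" using lpos l j dn(3) by auto
    ultimately have "good ?\<delta>" unfolding good_def using rs[OF y(1)] nz tot by auto
    have "\<not> Suc (\<delta>' n) < q"
    proof
      assume "Suc (\<delta>' n) < q"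
      then have "?\<delta> n \<in> D" unfolding D_def using \<open>good ?\<delta>\<close> dn(3) j by fastforce
      then have "?\<delta> n \<le> Max D" using \<open>finite D\<close> by simp
      then show False using dn(1) j by auto
    qed
    then have qn: "q = Suc (\<delta>' n)" using dn(4) by simp
    have "row_op C j n y c = 0"
    proof (rule col_op_vanishing[OF C _ _ b, of "insert l R" n "Suc (\<delta>' n)" "row_op C j n ` sol \<delta>'"])
      show "finite (insert l R)" "n \<in> insert l R" using R dn by auto
      show "of_nat k \<noteq> (0::'k)" if "0 < k" "k \<le> Suc (\<delta>' n)" for k using q that dn(4) by auto
      show "row_op C j n y \<in> row_op C j n ` sol \<delta>'" using y by blast
      show "col_op (insert l R) a b x \<in> row_op C j n ` sol \<delta>'" if x: "x \<in> row_op C j n ` sol \<delta>'" and a: "a \<in> C - {b}" for x a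
      proof -
        obtain w where w: "w \<in> sol \<delta>'" "x = row_op C j n w" using x by blast
        have "col_op (insert l R) a b w \<in> sol \<delta>'"
          using homogeneous_solutions_col_op[OF C R l _ b] a w(1) unfolding sol_def by blast
        moreover have "col_op (insert l R) a b x = row_op C j n (col_op (insert l R) a b w)"
          unfolding w(2) using row_col_commute[of "insert l R" C j n a b w] C R j dn(3) a b by auto
        ultimately show ?thesis by blast
      qed
      show "row_sum C d n = Suc (\<delta>' n)" if "x \<in> row_op C j n ` sol \<delta>'" "x d \<noteq> 0" for x d
      proof -
        note xd = that
        obtain w where w: "w \<in> sol \<delta>'" "x = row_op C j n w" using xd(1) by blast
        have "row_op C j n w d \<noteq> 0" using xd(2) w(2) by simp
        then have "\<forall>i\<in>insert l R. row_sum C d i = ?\<delta> i"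
          using rs[OF w(1)] unfolding sol_def homogeneous_solutions_def by blast
        then have "row_sum C d n = ?\<delta> n" using dn(3) by blast
        moreover have "n \<noteq> j" using j by auto
        ultimately show ?thesis by simp
      qed
      show "x d = 0" if x: "x \<in> row_op C j n ` sol \<delta>'" and d: "\<forall>a\<in>C - {b}. d (n, a) = 0" for x d
      proof (rule ccontr)
        assume xd: "x d \<noteq> 0"
        obtain w where w: "w \<in> sol \<delta>'" "x = row_op C j n w" using x by blast
        have "j \<noteq> n" using j by auto
        from row_op_support[OF C this xd[unfolded w(2)]]
        obtain a where a: "a \<in> C" "d (n, a) > 0" "w (d((n, a) := d (n, a) - 1, (j, a) := Suc (d (j, a)))) \<noteq> 0" .
        have ab: "a = b"
        proof (rule ccontr)
          assume "a \<noteq> b"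
          then have "d (n, a) = 0" using d a(1) by blast
          then show False using a(2) by simp
        qed
        define d' where "d' = d((n, b) := d (n, b) - 1, (j, b) := Suc (d (j, b)))"
        have wd': "w d' \<noteq> 0" using a unfolding ab d'_def by simp
        have "\<forall>a\<in>C - {b}. d' (n, a) = 0" using d by (auto simp: d'_def)
        from top(1)[OF w(1) wd' this]
        have "card (R - {n}) * q \<le> (\<Sum>i\<in>R - {n}. row_sum (C - {b}) d' i)" .
        also have "\<dots> < (\<Sum>i\<in>R - {n}. row_sum C d' i)"
        proof (rule sum_strict_mono_ex1)
          have e: "row_sum C d' i = d' (i, b) + row_sum (C - {b}) d' i" for i
            unfolding row_sum_def using C b by (rule sum.remove)
          show "\<forall>i\<in>R - {n}. row_sum (C - {b}) d' i \<le> row_sum C d' i" by (simp add: e)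
          show "\<exists>i\<in>R - {n}. row_sum (C - {b}) d' i < row_sum C d' i"
          proof
            have "d' (j, b) > 0" by (simp add: d'_def)
            then show "row_sum (C - {b}) d' j < row_sum C d' j" by (simp add: e[of j])
          qed (rule j)
        qed (use R in simp)
        also have "\<dots> = (\<Sum>i\<in>R - {n}. \<delta>' i)" using hom[OF w(1) wd'] by simp
        finally show False using tot sumn cardn qn by simp
      qed
    qed
    then show False using c by simp
  qed
  \<comment> \<open>Injectivity for k = 1: if row j were longer than row n, \<open>kill\<close>
    would give y = 0.\<close>
  have le: "\<delta>' j \<le> \<delta>' n" if j: "j \<in> R - {n}" for j
  proof (rule ccontr)
    assume gt: "\<not> \<delta>' j \<le> \<delta>' n"
    have "y = (\<lambda>c. 0)"
    proof (rule row_op_pow_injective[OF C, of n j q 1 y "\<delta>' n"])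
      show "n \<noteq> j" using j by auto
      show "(row_op C j n ^^ 1) y = (\<lambda>c. 0)" using kill[OF j] by simp
    qed (use q hom[OF y(1)] gt dn j in auto)
    then show False using y by simp
  qed
  have "y c = 0" for c
  proof (rule col_op_vanishing[OF C _ _ b, of "insert l R" n "\<delta>' n" "sol \<delta>'"])
    show "finite (insert l R)" "n \<in> insert l R" using R dn by auto
    show "of_nat k \<noteq> (0::'k)" if "0 < k" "k \<le> \<delta>' n" for k using q that dn(4) by auto
    show "y \<in> sol \<delta>'" by fact
    show "col_op (insert l R) a b x \<in> sol \<delta>'" if "x \<in> sol \<delta>'" "a \<in> C - {b}" for x a
      using homogeneous_solutions_col_op[OF C R l _ b] that unfolding sol_def by blast
    show "row_sum C d n = \<delta>' n" if "x \<in> sol \<delta>'" "x d \<noteq> 0" for x d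
      using hom that dn(3) by auto
    show "x d = 0" if x: "x \<in> sol \<delta>'" and d: "\<forall>a\<in>C - {b}. d (n, a) = 0" for x d
    proof (rule ccontr)
      assume xd: "x d \<noteq> 0"
      have "card (R - {n}) * q \<le> (\<Sum>i\<in>R - {n}. row_sum (C - {b}) d i)" by (rule top(1)[OF x xd d])
      also have "\<dots> \<le> (\<Sum>i\<in>R - {n}. row_sum C d i)"
        unfolding row_sum_def using C by (intro sum_mono sum_mono2) auto
      also have "\<dots> = (\<Sum>i\<in>R - {n}. \<delta>' i)" using hom[OF x xd] by simp
      also have "\<dots> \<le> (\<Sum>i\<in>R - {n}. \<delta>' n)" using le by (intro sum_mono) auto
      finally have "card (R - {n}) * q \<le> card (R - {n}) * \<delta>' n" by simp
      \<comment> \<open>What remains is a system with one row and one column. Row l has positive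
        degree but would have to avoid its only column.\<close>
      then have "card (R - {n}) = 0" using dn(4) by simp
      then have "card C = 1" using cardn card by simp
      then have "C - {b} = {}" using b by (auto simp: card_Suc_eq)
      then have "row_sum (C - {b}) d l = 0" unfolding row_sum_def by (simp only: sum.empty)
      then show False using top(2)[OF x xd d] by simp
    qed
  qed
  then show False using y by auto
qed

text \<open>
  The equations say that \<open>z\<close> is a solution of a linear system whose matrix has the independent
  variables \<open>(j, a)\<close> as entries. Such a variable is not injective on functions of exponents,
  since a divided power of degree divisible by the characteristic is not a multiple of it; the
  bound is attained by products of $q$-th powers of one variable in each row.
\<close>

theorem solution_degree_bound:
  fixes z :: "('i \<times> 'c \<Rightarrow> nat) \<Rightarrow> 'k::idom"
  assumes "finite C" "finite R" "l \<notin> R" "card C \<le> card R"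
    and q: "\<And>k. 0 < k \<Longrightarrow> k \<le> q \<Longrightarrow> of_nat k \<noteq> (0::'k)"
    and "\<And>j. j \<in> R \<Longrightarrow> row_op C l j z = (\<lambda>c. 0)" "z c \<noteq> 0" "row_sum C c l > 0"
  shows "card R * q \<le> (\<Sum>j\<in>R. row_sum C c j)"
  using assms(1-4,6-)
proof (induction "card R" arbitrary: R C z c rule: less_induct)
  case less
  note C = less.prems(1) and R = less.prems(2)
  have "C \<noteq> {}" using less.prems(7) by (auto simp: row_sum_def)
  then have "card C > 0" using C by auto
  then have R0: "card R > 0" using less.prems(4) by simp
  have smaller: "card (R - {n}) < card R" if "n \<in> R" for n
    using that R by (rule card_Diff1_less[rotated])
  show ?case
  proof (cases "card C = card R")
    case False
    show ?thesis
    proof (rule ccontr)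
      assume small: "\<not> ?thesis"
      have lo: "(card R - 1) * q \<le> (\<Sum>i\<in>R - {j}. row_sum C c i)" if j: "j \<in> R" for j
        using less.hyps[OF smaller[OF j] C, of z c] less.prems False j by auto
      have sm: "row_sum C c j < q" if j: "j \<in> R" for j
      proof -
        have "(\<Sum>i\<in>R. row_sum C c i) = row_sum C c j + (\<Sum>i\<in>R - {j}. row_sum C c i)"
          using R j by (rule sum.remove)
        then have "row_sum C c j + (card R - 1) * q < card R * q" using small lo[OF j] by simp
        moreover have "card R * q = q + (card R - 1) * q" using R0 by (cases "card R") auto
        ultimately show ?thesis by simp
      qed
      obtain j where j: "j \<in> R" using R0 by (metis card.empty equals0I less_irrefl)
      have "R - {j} \<noteq> {}" using False less.prems(4) \<open>card C > 0\<close> R j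
        by (metis One_nat_def card_Suc_Diff1 card.empty le_antisym Suc_leI)
      then have "(\<Sum>i\<in>R - {j}. row_sum C c i) < (\<Sum>i\<in>R - {j}. q)"
        using R sm by (intro sum_strict_mono) auto
      then show False using lo[OF j] R j by simp
    qed
  next
    case True
    \<comment> \<open>The component of z in the row degrees of c. The operators are homogeneous for
      these degrees, so it solves the same equations.\<close>
    define z1 where "z1 d = (if \<forall>i\<in>insert l R. row_sum C d i = row_sum C c i then z d else 0)" for d
    define \<delta> where "\<delta> = row_sum C c"
    have "z1 c \<noteq> 0" using less.prems by (simp add: z1_def)
    define P where "P d \<longleftrightarrow> (\<forall>i\<in>insert l R. row_sum C d i = row_sum C c i)" for d
    have sol: "row_op C l j z1 = (\<lambda>d. 0)" if j: "j \<in> R" for j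
    proof (rule ccontr)
      have lj: "l \<noteq> j" using j less.prems(3) by auto
      assume "row_op C l j z1 \<noteq> (\<lambda>d. 0)"
      then obtain d where d: "row_op C l j z1 d \<noteq> 0" by auto
      have *: "row_sum C d i + (if i = l then 1 else 0) = row_sum C c i + (if i = j then 1 else 0)"
        if "i \<in> insert l R" for i
        by (rule row_op_row_sum[OF C lj d]) (use that in \<open>auto simp: z1_def split: if_splits\<close>)
      have "mult_var (j, a) (shift (l, a) z1) d = mult_var (j, a) (shift (l, a) z) d" if a: "a \<in> C" for a
      proof (cases "d (j, a) = 0")
        case False
        let ?d = "d((j, a) := d (j, a) - 1)"
        have "row_sum C (?d((l, a) := Suc (?d (l, a)))) i = row_sum C c i" if "i \<in> insert l R" for i
          using row_sum_inc[OF C a, of ?d l i] row_sum_dec[of C a d j i, OF C a] *[OF that] False lj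
          by (auto split: if_splits)
        then show ?thesis by (simp add: mult_var_def shift_def z1_def)
      qed (simp add: mult_var_def)
      then have "row_op C l j z1 d = row_op C l j z d" by (simp add: row_op_def)
      then show False using d less.prems(5)[OF j] by simp
    qed
    have "card R * q \<le> sum \<delta> R"
    proof (rule solution_degree_bound_square[OF C R less.prems(3) True q])
      show "z1 \<in> homogeneous_solutions R C l \<delta>"
        using sol by (auto simp: homogeneous_solutions_def z1_def \<delta>_def split: if_splits)
      show "z1 \<noteq> (\<lambda>c. 0)" using \<open>z1 c \<noteq> 0\<close> by auto
      show "\<delta> l > 0" using less.prems by (simp add: \<delta>_def)
      fix y :: "('i \<times> 'c \<Rightarrow> nat) \<Rightarrow> 'k" and d n b
      assume a: "n \<in> R" "b \<in> C" "\<And>j. j \<in> R - {n} \<Longrightarrow> row_op (C - {b}) l j y = (\<lambda>c. 0)"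
        "y d \<noteq> 0" "row_sum (C - {b}) d l > 0"
      show "card (R - {n}) * q \<le> (\<Sum>j\<in>R - {n}. row_sum (C - {b}) d j)"
        using less.hyps[OF smaller[OF a(1)], of "C - {b}" y d] a C R less.prems(3) True by auto
    qed
    then show ?thesis by (simp add: \<delta>_def)
  qed
qed

section \<open>From the degree bound to generation by few rows\<close>

lemma vector_space_mult: "vector_space ((*) :: 'k::field \<Rightarrow> 'k \<Rightarrow> 'k)"
  by unfold_locales (simp_all add: algebra_simps)

context vector_space
begin

lemma separating_functional:
  assumes N: "subspace N" and x: "x \<notin> N"
  obtains l where "Vector_Spaces.linear scale (*) l" "\<And>y. y \<in> N \<Longrightarrow> l y = 0" "l x = 1"
proof -
  interpret pair: vector_space_pair scale "(*) :: 'a \<Rightarrow> 'a \<Rightarrow> 'a"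
    using vector_space_axioms vector_space_mult by (rule vector_space_pair.intro)
  obtain B where B: "B \<subseteq> N" "independent B" "N \<subseteq> span B" by (rule maximal_independent_subset)
  have "span B \<subseteq> N" using N B(1) by (rule span_minimal[rotated])
  then have "x \<notin> span B" using x by blast
  then have "independent (insert x B)" using B(2) by (simp add: independent_insert)
  then obtain l where l: "Vector_Spaces.linear scale (*) l"
    "\<forall>y\<in>insert x B. l y = (if y = x then 1 else 0)"
    using pair.linear_independent_extend[of "insert x B" "\<lambda>y. if y = x then 1 else 0"] by blast
  have "l y = 0" if "y \<in> N" for y
  proof (rule pair.linear_eq_0_on_span[OF l(1)])
    show "y \<in> span B" using that B(3) by blast
    show "l b = 0" if "b \<in> B" for b using l(2) that B(1) x by auto
  qed
  then show thesis using that l by simp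
qed

text \<open>N will be the span of the GL(m)-translates; \<open>few\<close> will come from
  permutation matrices and \<open>move\<close> from transvections. The outer induction on the number
  of rows and the inner one on the degree in row l implement the choice of a minimal
  counterexample.\<close>

lemma few_rows_generate:
  fixes mon :: "('i \<times> 'c \<Rightarrow> nat) \<Rightarrow> 'b"
  assumes N: "subspace N" and C: "finite C" "card C \<le> n"
    and q: "\<And>k. 0 < k \<Longrightarrow> k \<le> q \<Longrightarrow> of_nat k \<noteq> (0::'a)"
    and few: "\<And>R c. R \<subseteq> M \<Longrightarrow> finite R \<Longrightarrow> card R \<le> n \<Longrightarrow> {e. c e \<noteq> 0} \<subseteq> R \<times> C \<Longrightarrow> mon c \<in> N"
    and move: "\<And>c i j. mon c \<in> N \<Longrightarrow> {e. c e \<noteq> 0} \<subseteq> M \<times> C \<Longrightarrow> i \<in> M \<Longrightarrow> j \<in> M \<Longrightarrow> i \<noteq> j \<Longrightarrow>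
      (\<Sum>a\<in>C. of_nat (c (j, a)) *s mon (c((j, a) := c (j, a) - 1, (i, a) := Suc (c (i, a))))) \<in> N"
    and R: "R \<subseteq> M" "finite R" and supp: "{e. c e \<noteq> 0} \<subseteq> R \<times> C"
    and deg: "(\<Sum>j\<in>R. row_sum C c j) \<le> n * q"
  shows "mon c \<in> N"
  using R supp deg
proof (induction "card R" arbitrary: R c rule: less_induct)
  case less
  show ?case
  proof (cases "card R \<le> n")
    case True
    then show ?thesis using few less.prems by blast
  next
    case False
    then obtain l where l: "l \<in> R" using less.prems(2) by (cases "R = {}") auto
    have cR: "card R = Suc (card (R - {l}))" using less.prems(2) l by (rule card.remove)
    define good where "good c \<longleftrightarrow> {e. c e \<noteq> 0} \<subseteq> R \<times> C \<and> (\<Sum>j\<in>R. row_sum C c j) \<le> n * q" for c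
    have "good c" using less.prems(3,4) by (simp add: good_def)
    then show ?thesis
    proof (induction "row_sum C c l" arbitrary: c)
      case 0
      have "c (l, a) = 0" if "a \<in> C" for a
        using row_sum_pos[OF C(1), of c l] 0(1) that by auto
      then have "{e. c e \<noteq> 0} \<subseteq> (R - {l}) \<times> C" using 0(2) by (auto simp: good_def)
      moreover have "(\<Sum>j\<in>R - {l}. row_sum C c j) \<le> n * q"
        using 0(2) sum.remove[OF less.prems(2) l, of "row_sum C c"] by (simp add: good_def)
      ultimately show ?case using less.hyps[of "R - {l}" c] cR less.prems(1,2) by auto
    next
      case (Suc s)
      show ?case
      proof (rule ccontr)
        assume "mon c \<notin> N"
        then obtain f where f: "Vector_Spaces.linear scale (*) f" "\<And>y. y \<in> N \<Longrightarrow> f y = 0" "f (mon c) = 1"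
          using separating_functional[OF N] by metis
        interpret f: Vector_Spaces.linear scale "(*)" f by (rule f(1))
        define P where "P d \<longleftrightarrow> good d \<and> row_sum C d l = Suc s" for d
        \<comment> \<open>For d of degree s in row l, the operator from l to j sends z to f of the
          polarization of \<open>mon d\<close> from j to l. This lies in N, as \<open>mon d\<close>
          does by the inner induction; hence z solves the system.\<close>
        define z where "z d = (if P d then f (mon d) else 0)" for d
        have "row_op C l j z = (\<lambda>d. 0)" if j: "j \<in> R - {l}" for j
        proof (rule ccontr)
          have lj: "l \<noteq> j" using j by auto
          assume "row_op C l j z \<noteq> (\<lambda>d. 0)"
          then obtain d where d: "row_op C l j z d \<noteq> 0" by auto
          define m where "m a = d((j, a) := d (j, a) - 1, (l, a) := Suc (d (l, a)))" for a
          have sm: "row_sum C (m a) i + (if i = j then 1 else 0) = row_sum C d i + (if i = l then 1 else 0)"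
            if "a \<in> C" "d (j, a) > 0" for a i
          proof -
            let ?d = "d((j, a) := d (j, a) - 1)"
            have "?d((l, a) := Suc (?d (l, a))) = m a" using lj by (auto simp: m_def)
            then show ?thesis
              using row_sum_inc[OF C(1) that(1), of ?d l i] row_sum_dec[of C a d j i, OF C(1) that] by simp
          qed
          have tot: "(\<Sum>i\<in>R. row_sum C (m a) i) = (\<Sum>i\<in>R. row_sum C d i)" if "a \<in> C" "d (j, a) > 0" for a
          proof -
            have "(\<Sum>i\<in>R. row_sum C (m a) i + (if i = j then 1 else 0)) =
                (\<Sum>i\<in>R. row_sum C d i + (if i = l then 1 else 0))"
              using sm[OF that] by (intro sum.cong) auto
            then show ?thesis using less.prems(2) j l by (simp add: sum.distrib)
          qed
          obtain a where a: "a \<in> C" "d (j, a) > 0" "z (m a) \<noteq> 0"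
            using row_op_support[OF C(1) lj d] unfolding m_def .
          then have Pm: "P (m a)" by (auto simp: z_def split: if_splits)
          have supp_iff: "{e. m a e \<noteq> 0} \<subseteq> R \<times> C \<longleftrightarrow> {e. d e \<noteq> 0} \<subseteq> R \<times> C" if "a \<in> C" "d (j, a) > 0" for a
          proof -
            have "(j, a) \<in> R \<times> C" "(l, a) \<in> R \<times> C" using that j l by auto
            then have "(m a e \<noteq> 0 \<longrightarrow> e \<in> R \<times> C) \<longleftrightarrow> (d e \<noteq> 0 \<longrightarrow> e \<in> R \<times> C)" for e
              by (cases "e = (l, a)"; cases "e = (j, a)") (simp_all add: m_def)
            then show ?thesis by blast
          qed
          have gd: "good d" using Pm supp_iff[OF a(1,2)] tot[OF a(1,2)] by (simp add: good_def P_def)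
          have sd: "s = row_sum C d l" using Pm sm[OF a(1,2), of l] lj by (simp add: P_def)
          have P: "P (m a)" if "a \<in> C" "d (j, a) > 0" for a
            using gd sd supp_iff[OF that] tot[OF that] sm[OF that, of l] lj by (simp add: good_def P_def)
          have "mon d \<in> N" using Suc.hyps(1)[OF sd gd] .
          moreover have "{e. d e \<noteq> 0} \<subseteq> M \<times> C" using gd less.prems(1) by (auto simp: good_def)
          ultimately have "(\<Sum>a\<in>C. of_nat (d (j, a)) *s mon (m a)) \<in> N"
            unfolding m_def using j l less.prems(1) by (intro move) auto
          then have "0 = f (\<Sum>a\<in>C. of_nat (d (j, a)) *s mon (m a))" using f(2) by simp
          also have "\<dots> = (\<Sum>a\<in>C. of_nat (d (j, a)) * f (mon (m a)))"
            by (simp add: f.sum f.scale)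
          also have "\<dots> = row_op C l j z d"
            unfolding row_op_def
          proof (intro sum.cong refl)
            fix a assume "a \<in> C"
            then show "of_nat (d (j, a)) * f (mon (m a)) = mult_var (j, a) (shift (l, a) z) d"
              using P[of a] lj by (cases "d (j, a) = 0") (auto simp: mult_var_def shift_def z_def m_def)
          qed
          finally show False using d by simp
        qed
        moreover have "z c \<noteq> 0" using Suc f(3) by (simp add: z_def P_def)
        moreover have "card C \<le> card (R - {l})" using C(2) False cR by simp
        ultimately have "card (R - {l}) * q \<le> (\<Sum>j\<in>R - {l}. row_sum C c j)"
          using Suc(2) C(1) less.prems(2) q by (intro solution_degree_bound[where l = l and z = z]) auto
        moreover have "(\<Sum>j\<in>R. row_sum C c j) = Suc s + (\<Sum>j\<in>R - {l}. row_sum C c j)"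
          using sum.remove[OF less.prems(2) l, of "row_sum C c"] Suc(2) by simp
        \<comment> \<open>There are at least n rows besides l, so these alone already use the
          admissible degree nq, while row l has \<open>Suc s\<close> further units.\<close>
        moreover have "n * q \<le> card (R - {l}) * q" using False cR by simp
        moreover have "(\<Sum>j\<in>R. row_sum C c j) \<le> n * q" using Suc.prems unfolding good_def by (rule conjunct2)
        ultimately show False by linarith
      qed
    qed
  qed
qed

end

section \<open>Graded algebras of functions\<close>

text \<open>A nonzero polynomial has finitely many roots. Over an infinite field this splits a
  family depending polynomially on t into its coefficients.\<close>

lemma vanishing_polynomial_coefficients:
  fixes a :: "nat \<Rightarrow> 'k::field"
  assumes "infinite (UNIV :: 'k set)" "\<And>t. (\<Sum>d\<le>D. t ^ d * a d) = 0" "d \<le> D"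
  shows "a d = 0"
proof -
  define p where "p = (\<Sum>d\<le>D. Polynomial.monom (a d) d)"
  have "poly p t = 0" for t
    using assms(2)[of t] by (simp add: p_def poly_sum poly_monom mult.commute)
  then have "{x. poly p x = 0} = UNIV" by auto
  then have "p = 0" using poly_roots_finite[of p] assms(1) by auto
  moreover have "Polynomial.coeff p d = a d" using assms(3) by (simp add: p_def coeff_sum)
  ultimately show ?thesis by simp
qed

lemma sum_fun_apply: "(\<Sum>i\<in>I. F i) w = (\<Sum>i\<in>I. F i w)"
  by (induction I rule: infinite_finite_induct) simp_all

lemma prod_fun_apply: "(\<Prod>i\<in>I. F i) w = (\<Prod>i\<in>I. F i w)"
  by (induction I rule: infinite_finite_induct) simp_all

text \<open>The map \<open>sc\<close> is a parameter since the scaling may affect only some of the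
  coordinates; the resulting degree is then the degree in those.\<close>

definition homogeneous_functions :: "('k::field \<Rightarrow> 'w \<Rightarrow> 'w) \<Rightarrow> nat \<Rightarrow> ('w \<Rightarrow> 'k) set" where
  "homogeneous_functions sc d = {f. \<forall>t w. f (sc t w) = t ^ d * f w}"

lemma homogeneous_unique:
  fixes F :: "nat \<Rightarrow> 'w \<Rightarrow> 'k::field"
  assumes inf: "infinite (UNIV :: 'k set)" and F: "\<And>d. F d \<in> homogeneous_functions sc d"
    and F': "\<And>d. F' d \<in> homogeneous_functions sc d"
    and eq: "(\<Sum>d\<le>D. F d) = (\<Sum>d\<le>D. F' d)" and d: "d \<le> D"
  shows "F d = F' d"
proof
  fix w
  have "(\<Sum>d\<le>D. t ^ d * (F d w - F' d w)) = 0" for t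
  proof -
    have "(\<Sum>d\<le>D. F d (sc t w)) = (\<Sum>d\<le>D. F' d (sc t w))" using fun_cong[OF eq, of "sc t w"] by (simp add: sum_fun_apply)
    then show ?thesis
      using F F' by (simp add: homogeneous_functions_def right_diff_distrib sum_subtractf)
  qed
  from vanishing_polynomial_coefficients[OF inf this d] show "F d w = F' d w" by simp
qed

section \<open>Finite sums of homogeneous elements\<close>

definition graded_sums :: "(nat \<Rightarrow> 'a::comm_monoid_add set) \<Rightarrow> 'a set" where
  "graded_sums H = {\<Sum>d\<le>D. F d | D F. \<forall>d. F d \<in> H d}"

lemma graded_sums_add:
  assumes H: "\<And>d. 0 \<in> H d" "\<And>d x y. x \<in> H d \<Longrightarrow> y \<in> H d \<Longrightarrow> x + y \<in> H d"
    and "x \<in> graded_sums H" "y \<in> graded_sums H"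
  shows "x + y \<in> graded_sums H"
proof -
  obtain D F where F: "x = (\<Sum>d\<le>D. F d)" "\<forall>d. F d \<in> H d" using assms(3) by (auto simp: graded_sums_def)
  obtain E F' where F': "y = (\<Sum>d\<le>E. F' d)" "\<forall>d. F' d \<in> H d" using assms(4) by (auto simp: graded_sums_def)
  let ?F = "\<lambda>d. (if d \<le> D then F d else 0) + (if d \<le> E then F' d else 0)"
  have "x = (\<Sum>d\<le>max D E. if d \<le> D then F d else 0)" unfolding F(1)
    by (rule sum.mono_neutral_cong_left) auto
  moreover have "y = (\<Sum>d\<le>max D E. if d \<le> E then F' d else 0)" unfolding F'(1)
    by (rule sum.mono_neutral_cong_left) auto
  ultimately have "x + y = (\<Sum>d\<le>max D E. ?F d)" by (simp only: sum.distrib)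
  moreover have "\<forall>d. ?F d \<in> H d" using F(2) F'(2) H by simp
  ultimately show ?thesis unfolding graded_sums_def by blast
qed

lemma graded_sums_incl:
  assumes "\<And>d. 0 \<in> H d" "x \<in> H d"
  shows "x \<in> graded_sums H"
proof -
  have "x = (\<Sum>e\<le>d. if e = d then x else 0)" by simp
  moreover have "\<forall>e. (if e = d then x else 0) \<in> H e" using assms by simp
  ultimately show ?thesis unfolding graded_sums_def by (intro CollectI exI[of _ d] exI[of _ "\<lambda>e. if e = d then x else 0"]) simp
qed

lemma graded_sums_sum:
  assumes "\<And>d. 0 \<in> H d" "\<And>d x y. x \<in> H d \<Longrightarrow> y \<in> H d \<Longrightarrow> x + y \<in> H d"
    and "finite I" "\<And>i. i \<in> I \<Longrightarrow> f i \<in> graded_sums H"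
  shows "(\<Sum>i\<in>I. f i) \<in> graded_sums H"
  using assms(3,4)
proof (induction I)
  case empty
  then show ?case using graded_sums_incl[of H 0 0] assms(1) by simp
next
  case (insert i I)
  then show ?case using graded_sums_add[OF assms(1,2)] by simp
qed

lemma algebra_generated_graded:
  fixes H :: "nat \<Rightarrow> ('w \<Rightarrow> 'k::comm_ring_1) set"
  assumes H: "\<And>d. 0 \<in> H d" "\<And>d x y. x \<in> H d \<Longrightarrow> y \<in> H d \<Longrightarrow> x + y \<in> H d"
    and const: "\<And>c. (\<lambda>_. c) \<in> H 0" and mult: "\<And>d e x y. x \<in> H d \<Longrightarrow> y \<in> H e \<Longrightarrow> x * y \<in> H (d + e)"
    and S: "S \<subseteq> graded_sums H" and f: "f \<in> algebra_generated S"
  shows "f \<in> graded_sums H"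
  using f
proof (induction rule: algebra_generated.induct)
  case (const c)
  show ?case by (rule graded_sums_incl[of H _ 0]) (rule H(1) assms(3))+
next
  case (incl f)
  then show ?case using S by blast
next
  case (add f h)
  then show ?case using graded_sums_add[of H f h] H by blast
next
  case (mult f h)
  then obtain D F E F' where F: "f = (\<Sum>d\<le>D. F d)" "\<forall>d. F d \<in> H d" "h = (\<Sum>d\<le>E. F' d)" "\<forall>d. F' d \<in> H d"
    by (auto simp: graded_sums_def)
  have "f * h = (\<Sum>d\<le>D. \<Sum>e\<le>E. F d * F' e)"
    unfolding F(1,3) by (simp add: sum_product)
  also have "\<dots> \<in> graded_sums H"
  proof (intro graded_sums_sum)
    show "F d * F' e \<in> graded_sums H" for d e
      using graded_sums_incl[of H "F d * F' e" "d + e"] assms(4)[of "F d" d "F' e" e] F(2,4) H(1) by blast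
  qed (use H in auto)
  finally show ?case .
qed

lemma algebra_generated_mono:
  assumes "S \<subseteq> algebra_generated T"
  shows "algebra_generated S \<subseteq> algebra_generated T"
proof
  fix f assume "f \<in> algebra_generated S"
  then show "f \<in> algebra_generated T"
    by (induction rule: algebra_generated.induct) (use assms in \<open>blast intro: algebra_generated.intros\<close>)+
qed

lemma algebra_generated_closed:
  shows algebra_generated_scale: "f \<in> algebra_generated S \<Longrightarrow> (\<lambda>w. c * f w) \<in> algebra_generated S"
    and algebra_generated_zero: "0 \<in> algebra_generated S"
    and algebra_generated_one: "1 \<in> algebra_generated S"
    and algebra_generated_uminus: "f \<in> algebra_generated S \<Longrightarrow> - f \<in> algebra_generated S"
    and algebra_generated_sum: "(\<And>i. i \<in> I \<Longrightarrow> F i \<in> algebra_generated S) \<Longrightarrow> (\<Sum>i\<in>I. F i) \<in> algebra_generated S"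
    and algebra_generated_prod: "(\<And>i. i \<in> I \<Longrightarrow> F i \<in> algebra_generated S) \<Longrightarrow> (\<Prod>i\<in>I. F i) \<in> algebra_generated S"
proof -
  show s: "(\<lambda>w. c * f w) \<in> algebra_generated S" if "f \<in> algebra_generated S" for c f
    using algebra_generated.mult[OF algebra_generated.const[of c] that] by (simp add: times_fun_def)
  show z: "0 \<in> algebra_generated S" using algebra_generated.const[of 0 S] by (simp add: zero_fun_def)
  show o: "1 \<in> algebra_generated S" using algebra_generated.const[of 1 S] by (simp add: one_fun_def)
  show "- f \<in> algebra_generated S" if "f \<in> algebra_generated S"
    using s[OF that, of "-1"] by (simp add: fun_Compl_def)
  show "(\<Sum>i\<in>I. F i) \<in> algebra_generated S" if "\<And>i. i \<in> I \<Longrightarrow> F i \<in> algebra_generated S"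
    using that z by (induction I rule: infinite_finite_induct) (auto intro: algebra_generated.add)
  show "(\<Prod>i\<in>I. F i) \<in> algebra_generated S" if "\<And>i. i \<in> I \<Longrightarrow> F i \<in> algebra_generated S"
    using that o by (induction I rule: infinite_finite_induct) (auto intro: algebra_generated.mult)
qed

section \<open>Algebras of functions as graded algebras with a group action\<close>

definition function_module :: "('w \<Rightarrow> 'k::field) set \<Rightarrow> ('k, 'w \<Rightarrow> 'k) module" where
  "function_module P = \<lparr>carrier = P, monoid.mult = (*), one = 1, ring.zero = 0, add = (+),
     module.smult = (\<lambda>c f w. c * f w)\<rparr>"

lemma function_module_simps [simp]:
  "carrier (function_module P) = P" "x \<otimes>\<^bsub>function_module P\<^esub> y = x * y" "\<one>\<^bsub>function_module P\<^esub> = 1"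
  "\<zero>\<^bsub>function_module P\<^esub> = 0" "x \<oplus>\<^bsub>function_module P\<^esub> y = x + y" "c \<odot>\<^bsub>function_module P\<^esub> x = (\<lambda>w. c * x w)"
  by (simp_all add: function_module_def)

lemma function_module_algebra:
  "algebra (ring_of_type_algebra :: 'k::field ring) (function_module (algebra_generated S))"
proof -
  let ?A = "function_module (algebra_generated S)"
  have ab: "abelian_group ?A"
  proof (rule abelian_groupI)
    fix x assume "x \<in> carrier ?A"
    then show "\<exists>y\<in>carrier ?A. y \<oplus>\<^bsub>?A\<^esub> x = \<zero>\<^bsub>?A\<^esub>"
      by (intro bexI[of _ "- x"]) (auto intro: algebra_generated_uminus)
  qed (auto simp: ac_simps intro: algebra_generated.add algebra_generated_zero)
  have cm: "comm_monoid ?A"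
    by (rule comm_monoidI) (auto simp: ac_simps intro: algebra_generated.mult algebra_generated_one)
  have "cring ?A" by (rule cringI[OF ab cm]) (auto simp: fun_eq_iff distrib_right)
  then show ?thesis
    by (intro algebraI cring_from_type_algebra)
      (auto simp: ring_of_type_algebra_def fun_eq_iff algebra_simps intro: algebra_generated_scale)
qed

lemma finsum_function_module:
  fixes F :: "'i \<Rightarrow> 'w \<Rightarrow> 'k::field"
  assumes "finite I" "\<And>i. i \<in> I \<Longrightarrow> F i \<in> algebra_generated S"
  shows "(\<Oplus>\<^bsub>function_module (algebra_generated S)\<^esub>i\<in>I. F i) = (\<Sum>i\<in>I. F i)"
proof -
  interpret algebra "ring_of_type_algebra :: 'k ring" "function_module (algebra_generated S)"
    by (rule function_module_algebra)
  show ?thesis using assms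
  proof (induction I)
    case (insert i I)
    then show ?case by (subst M.finsum_insert) (auto simp: Pi_def)
  qed simp
qed

text \<open>Serves two purposes: copies of the regular representation with the usual degree, and the
  polynomials on U and copies of V with the degree in V. Members of L need not be homogeneous
  themselves: a functional on U and copies of V is a sum of a part of degree 0 and a part of degree
  1.\<close>

locale graded_function_algebra = Group.group G
  for G :: "('g, 'x) monoid_scheme" and L :: "('w \<Rightarrow> 'k::field) set"
    and sc :: "'k \<Rightarrow> 'w \<Rightarrow> 'w" and act :: "'g \<Rightarrow> 'w \<Rightarrow> 'w" +
  assumes inf: "infinite (UNIV :: 'k set)"
    and generators: "L \<subseteq> algebra_generated (L \<inter> (homogeneous_functions sc 0 \<union> homogeneous_functions sc 1))"
    and act_one: "act \<one>\<^bsub>G\<^esub> w = w"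
    and act_mult: "\<lbrakk>g \<in> carrier G; h \<in> carrier G\<rbrakk> \<Longrightarrow> act (g \<otimes>\<^bsub>G\<^esub> h) w = act g (act h w)"
    and act_sc: "g \<in> carrier G \<Longrightarrow> act g (sc t w) = sc t (act g w)"
    and act_generators: "\<lbrakk>g \<in> carrier G; f \<in> L\<rbrakk> \<Longrightarrow> (\<lambda>w. f (act g w)) \<in> algebra_generated L"
begin

abbreviation "A \<equiv> algebra_generated L"
abbreviation "A_hom d \<equiv> A \<inter> homogeneous_functions sc d"

lemma A_hom_closed:
  "0 \<in> A_hom d" "f \<in> A_hom d \<Longrightarrow> h \<in> A_hom d \<Longrightarrow> f + h \<in> A_hom d"
  "(\<lambda>_. c) \<in> A_hom 0" "f \<in> A_hom d \<Longrightarrow> h \<in> A_hom e \<Longrightarrow> f * h \<in> A_hom (d + e)"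
  "f \<in> A_hom d \<Longrightarrow> (\<lambda>w. c * f w) \<in> A_hom d" "f \<in> A_hom d \<Longrightarrow> - f \<in> A_hom d"
  by (auto simp: homogeneous_functions_def power_add algebra_simps algebra_generated_closed
      intro: algebra_generated.intros)

lemma A_graded_sums: "f \<in> A \<Longrightarrow> f \<in> graded_sums A_hom"
proof -
  assume f: "f \<in> A"
  have "L \<inter> (homogeneous_functions sc 0 \<union> homogeneous_functions sc 1) \<subseteq> graded_sums A_hom"
  proof
    fix x assume "x \<in> L \<inter> (homogeneous_functions sc 0 \<union> homogeneous_functions sc 1)"
    then have "x \<in> A_hom 0 \<or> x \<in> A_hom 1" by (auto intro: algebra_generated.incl)
    then show "x \<in> graded_sums A_hom" using graded_sums_incl[of A_hom, OF A_hom_closed(1)] by blast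
  qed
  moreover have "f \<in> algebra_generated (L \<inter> (homogeneous_functions sc 0 \<union> homogeneous_functions sc 1))"
    using algebra_generated_mono[OF generators] f by blast
  ultimately show ?thesis
    by (intro algebra_generated_graded[of A_hom, OF A_hom_closed(1-4)])
qed

lemma act_A:
  assumes "g \<in> carrier G" "f \<in> A"
  shows "(\<lambda>w. f (act g w)) \<in> A"
  using assms(2)
proof (induction rule: algebra_generated.induct)
  case (add f h)
  then show ?case using algebra_generated.add[of "\<lambda>w. f (act g w)" L "\<lambda>w. h (act g w)"] by (simp add: plus_fun_def)
next
  case (mult f h)
  then show ?case using algebra_generated.mult[of "\<lambda>w. f (act g w)" L "\<lambda>w. h (act g w)"] by (simp add: times_fun_def)
qed (auto intro: algebra_generated.const act_generators[OF assms(1)])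

lemma graded_algebra: "graded_algebra (function_module A) A_hom"
proof (intro graded_algebra.intro graded_algebra_axioms.intro function_module_algebra)
  interpret algebra "ring_of_type_algebra :: 'k ring" "function_module A"
    by (rule function_module_algebra)
  have neg: "\<ominus>\<^bsub>function_module A\<^esub> x = - x" if "x \<in> A" for x
    by (rule M.minus_equality) (use that in \<open>auto intro: algebra_generated_uminus\<close>)
  show "submodule (A_hom d) (ring_of_type_algebra :: 'k ring) (function_module A)" for d
    by (rule submoduleI) (use A_hom_closed neg in \<open>auto simp: ring_of_type_algebra_def\<close>)
  show "\<one>\<^bsub>function_module A\<^esub> \<in> A_hom 0" using A_hom_closed(3)[of 1] by (simp add: one_fun_def)
  show "x \<otimes>\<^bsub>function_module A\<^esub> y \<in> A_hom (d + e)" if "x \<in> A_hom d" "y \<in> A_hom e" for x y d e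
    using A_hom_closed(4)[OF that] by simp
  fix x assume "x \<in> carrier (function_module A)"
  then have "x \<in> graded_sums A_hom" using A_graded_sums by simp
  then obtain D F where F: "x = (\<Sum>d\<le>D. F d)" "\<forall>d. F d \<in> A_hom d" by (auto simp: graded_sums_def)
  \<comment> \<open>Beyond D the family F is unconstrained, whereas a decomposition must have finite
    support.\<close>
  define F0 where "F0 d = (if d \<le> D then F d else 0)" for d
  have F0: "\<forall>d. F0 d \<in> A_hom d" using F(2) A_hom_closed(1) unfolding F0_def by auto
  have fs: "(\<Oplus>\<^bsub>function_module A\<^esub>d\<in>{d. f d \<noteq> 0}. f d) = (\<Sum>d\<le>E. f d)"
    if "\<forall>d. f d \<in> A_hom d" "finite {d. f d \<noteq> 0}" "\<forall>d>E. f d = 0" for f E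
  proof -
    have "(\<Oplus>\<^bsub>function_module A\<^esub>d\<in>{d. f d \<noteq> 0}. f d) = (\<Sum>d\<in>{d. f d \<noteq> 0}. f d)"
      using that by (intro finsum_function_module) auto
    also have "\<dots> = (\<Sum>d\<le>E. f d)"
      using that by (intro sum.mono_neutral_left) (auto simp: not_le[symmetric])
    finally show ?thesis .
  qed
  have sub: "{d. F0 d \<noteq> 0} \<subseteq> {..D}" by (auto simp: F0_def split: if_splits)
  let ?P = "\<lambda>f. (\<forall>d. f d \<in> A_hom d) \<and> finite {d. f d \<noteq> \<zero>\<^bsub>function_module A\<^esub>} \<and>
       x = (\<Oplus>\<^bsub>function_module A\<^esub>d\<in>{d. f d \<noteq> \<zero>\<^bsub>function_module A\<^esub>}. f d)"
  show "\<exists>!f. ?P f"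
  proof (rule ex1I)
    have "(\<Oplus>\<^bsub>function_module A\<^esub>d\<in>{d. F0 d \<noteq> 0}. F0 d) = (\<Sum>d\<le>D. F0 d)"
      using F0 finite_subset[OF sub] by (intro fs) (auto simp: F0_def)
    also have "\<dots> = x" unfolding F(1) F0_def by (intro sum.cong) auto
    finally show "?P F0" using F0 finite_subset[OF sub] by simp
    fix f assume f: "?P f"
    then have fin: "finite {d. f d \<noteq> 0}" by simp
    \<comment> \<open>A common bound for both supports, so that the components can be compared in
      one range; the inserted 0 keeps the maximum meaningful when f vanishes.\<close>
    define E where "E = max D (Max (insert 0 {d. f d \<noteq> 0}))"
    have fE: "\<forall>d>E. f d = 0"
    proof (intro allI impI, rule ccontr)
      fix d assume d: "d > E" "f d \<noteq> 0"
      then have "d \<le> Max (insert 0 {d. f d \<noteq> 0})" using fin by (intro Max_ge) auto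
      then show False using d(1) by (simp add: E_def)
    qed
    have F0E: "\<forall>d>E. F0 d = 0" by (auto simp: F0_def E_def)
    have "(\<Sum>d\<le>E. f d) = x" using f fs[of f E] fin fE by simp
    also have "x = (\<Sum>d\<le>E. F0 d)"
      unfolding F(1) F0_def by (rule sum.mono_neutral_cong_left) (auto simp: E_def)
    finally have eq: "(\<Sum>d\<le>E. f d) = (\<Sum>d\<le>E. F0 d)" .
    show "f = F0"
    proof
      fix d
      show "f d = F0 d"
      proof (cases "d \<le> E")
        case True
        then show ?thesis using homogeneous_unique[OF inf _ _ eq, of sc d] f F0 by auto
      qed (use fE F0E in auto)
    qed
  qed
qed

text \<open>Restricted to A because the elements of \<open>BijGroup\<close> have to be
  extensional.\<close>

definition "act_fun g = (\<lambda>f\<in>A. (\<lambda>w. f (act (inv\<^bsub>G\<^esub> g) w)))"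

lemma act_fun_act_fun:
  assumes "g \<in> carrier G" "h \<in> carrier G" "f \<in> A"
  shows "act_fun g (act_fun h f) = act_fun (g \<otimes>\<^bsub>G\<^esub> h) f"
  using assms by (simp add: act_fun_def act_A inv_mult_group act_mult)

lemma graded_G_algebra: "graded_G_algebra (function_module A) A_hom G act_fun"
proof -
  have cl: "act_fun g f \<in> A" if "g \<in> carrier G" "f \<in> A" for g f
    using that by (simp add: act_fun_def act_A)
  have one: "act_fun \<one>\<^bsub>G\<^esub> f = f" if "f \<in> A" for f using that by (simp add: act_fun_def act_one)
  have bij: "act_fun g \<in> Bij A" if g: "g \<in> carrier G" for g
  proof -
    have "bij_betw (act_fun g) A A"
      by (rule bij_betw_byWitness[where f' = "act_fun (inv\<^bsub>G\<^esub> g)"])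
        (use g cl in \<open>auto simp: act_fun_act_fun one\<close>)
    then show ?thesis by (simp add: Bij_def act_fun_def)
  qed
  have ga: "group_action G (carrier (function_module A)) act_fun"
    unfolding group_action_def group_hom_def group_hom_axioms_def
  proof (intro conjI homI)
    show "Group.group G" by (rule group_axioms)
    show "Group.group (BijGroup (carrier (function_module A)))" by (rule group_BijGroup)
    show "act_fun g \<in> carrier (BijGroup (carrier (function_module A)))" if "g \<in> carrier G" for g
      using bij[OF that] by (simp add: BijGroup_def)
    fix g h assume gh: "g \<in> carrier G" "h \<in> carrier G"
    have "act_fun (g \<otimes>\<^bsub>G\<^esub> h) = compose A (act_fun g) (act_fun h)"
      using gh by (auto simp: compose_def fun_eq_iff act_fun_act_fun) (simp add: act_fun_def)
    then show "act_fun (g \<otimes>\<^bsub>G\<^esub> h) = act_fun g \<otimes>\<^bsub>BijGroup (carrier (function_module A))\<^esub> act_fun h"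
      using gh bij by (simp add: BijGroup_def)
  qed
  show ?thesis
  proof (intro graded_G_algebra.intro graded_algebra ga graded_G_algebra_axioms.intro)
    fix g assume g: "g \<in> carrier G"
    show "act_fun g \<in> Ring.ring_hom (function_module A) (function_module A)"
      using g cl by (intro ring_hom_memI)
        (auto simp: act_fun_def fun_eq_iff algebra_generated.add algebra_generated.mult algebra_generated_one)
    show "act_fun g (c \<odot>\<^bsub>function_module A\<^esub> x) = c \<odot>\<^bsub>function_module A\<^esub> act_fun g x"
      if "x \<in> carrier (function_module A)" for c x
      using that by (simp add: act_fun_def algebra_generated_scale)
    show "act_fun g x \<in> A_hom d" if "x \<in> A_hom d" for x d
      using that g cl[OF g] by (auto simp: act_fun_def homogeneous_functions_def act_sc)
  qed
qed

text \<open>\<open>beta\<close> is about generation as a ring; scalars are available nevertheless,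
  since constants have degree 0.\<close>

lemma beta_one: "beta (function_module A) A_hom \<le> 1"
proof -
  interpret graded_algebra "function_module A" A_hom by (rule graded_algebra)
  have R: "ring (function_module A)" using M_cring by (rule cring.axioms(1))
  let ?U = "\<Union>d\<le>1. A_hom d"
  have UA: "?U \<subseteq> A" by blast
  have "f \<in> generate_ring (function_module A) ?U"
    if "f \<in> algebra_generated (L \<inter> (homogeneous_functions sc 0 \<union> homogeneous_functions sc 1))" for f
    using that
  proof (induction rule: algebra_generated.induct)
    case (const c)
    show ?case using A_hom_closed(3)[of c] by (intro generate_ring.incl) auto
  next
    case (incl f)
    then have "f \<in> A_hom 0 \<or> f \<in> A_hom 1" by (auto intro: algebra_generated.incl)
    then show ?case by (intro generate_ring.incl) force
  next
    case (add f h)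
    from generate_ring.eng_add[OF add.IH] show ?case by (simp only: function_module_simps)
  next
    case (mult f h)
    from generate_ring.eng_mult[OF mult.IH] show ?case by (simp only: function_module_simps)
  qed
  then have "A \<subseteq> generate_ring (function_module A) ?U"
    using algebra_generated_mono[OF generators] by blast
  moreover have "generate_ring (function_module A) ?U \<subseteq> A"
    using ring.generate_ring_incl[OF R, of ?U] UA by simp
  ultimately have "generate_ring (function_module A) ?U = carrier (function_module A)" by simp
  then show ?thesis
    using beta_le_iff[of "function_module A" A_hom 1, OF R] A_hom_closed(1) by (simp add: one_enat_def)
qed

text \<open>The point where the number beta of the group is used, through
  \<open>beta_group_upper\<close>, which covers algebras of functions on an arbitrary type.\<close>

lemma invariants_generated:
  assumes fin: "finite (carrier G)" and N: "beta_group G TYPE('k) \<le> enat N"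
    and f: "f \<in> A" "\<And>g w. g \<in> carrier G \<Longrightarrow> f (act g w) = f w"
  shows "f \<in> algebra_generated {h. (\<exists>d\<le>N. h \<in> A_hom d) \<and> (\<forall>g\<in>carrier G. \<forall>w. h (act g w) = h w)}"
proof -
  interpret GA: graded_G_algebra "function_module A" A_hom G act_fun by (rule graded_G_algebra)
  let ?I = "invariant_elements G act_fun (function_module A)"
  have I: "h \<in> ?I \<longleftrightarrow> h \<in> A \<and> (\<forall>g\<in>carrier G. \<forall>w. h (act g w) = h w)" for h
  proof
    assume h: "h \<in> ?I"
    then have hA: "h \<in> A" by (simp add: invariant_elements_def)
    have "h (act g w) = h w" if g: "g \<in> carrier G" for g w
    proof -
      have "act_fun (inv\<^bsub>G\<^esub> g) h = h" using h g by (simp add: invariant_elements_def)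
      then show ?thesis using g hA by (simp add: act_fun_def fun_eq_iff)
    qed
    then show "h \<in> A \<and> (\<forall>g\<in>carrier G. \<forall>w. h (act g w) = h w)" using hA by blast
  next
    assume "h \<in> A \<and> (\<forall>g\<in>carrier G. \<forall>w. h (act g w) = h w)"
    then show "h \<in> ?I" by (simp add: invariant_elements_def act_fun_def)
  qed
  have "beta_invariants G act_fun (function_module A) A_hom \<le> enat N"
    using beta_group_upper[OF graded_G_algebra fin beta_one] N by (rule order_trans)
  then have "generate_ring (function_module A) (\<Union>d\<le>N. A_hom d \<inter> ?I) = ?I"
    by (simp add: GA.beta_invariants_le_iff)
  moreover have "f \<in> ?I" using f I by blast
  ultimately have fgen: "f \<in> generate_ring (function_module A) (\<Union>d\<le>N. A_hom d \<inter> ?I)" by simp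
  have neg: "\<ominus>\<^bsub>function_module A\<^esub> h = - h" if "h \<in> A" for h
    by (rule GA.M.minus_equality) (use that in \<open>auto intro: algebra_generated_uminus\<close>)
  have UA: "(\<Union>d\<le>N. A_hom d \<inter> ?I) \<subseteq> carrier (function_module A)" by auto
  note in_A = GA.generate_ring_in_carrier[OF UA, unfolded function_module_simps]
  from fgen show ?thesis
  proof (induction rule: generate_ring.induct)
    case one
    show ?case unfolding function_module_simps by (rule algebra_generated_one)
  next
    case (incl h)
    then show ?case using I by (intro algebra_generated.incl) blast
  next
    case (a_inv h)
    then show ?case unfolding neg[OF in_A[OF a_inv(1)]] by (intro algebra_generated_uminus)
  next
    case (eng_add h k)
    then show ?case unfolding function_module_simps by (intro algebra_generated.add)
  next
    case (eng_mult h k)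
    then show ?case unfolding function_module_simps by (intro algebra_generated.mult)
  qed
qed

end

section \<open>Groups of order divisible by the characteristic\<close>

definition line_polynomial :: "(('e \<Rightarrow> 'k::field) \<Rightarrow> 'k) \<Rightarrow> ('e \<Rightarrow> 'k) \<Rightarrow> ('e \<Rightarrow> 'k) \<Rightarrow> 'k Polynomial.poly \<Rightarrow> bool" where
  "line_polynomial f w v r \<longleftrightarrow> (\<forall>t. f (\<lambda>e. w e + t * v e) = poly r t)"

text \<open>Polynomials are functions here, so the restriction to a line must be recovered as a
  polynomial before its linear coefficient can be taken. Over an infinite field it is unique if it
  exists; otherwise the value is unspecified.\<close>

definition dir_deriv :: "('e \<Rightarrow> 'k::field) \<Rightarrow> (('e \<Rightarrow> 'k) \<Rightarrow> 'k) \<Rightarrow> ('e \<Rightarrow> 'k) \<Rightarrow> 'k" where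
  "dir_deriv v f w = Polynomial.coeff (THE r. line_polynomial f w v r) 1"

primrec iterated_deriv :: "(nat \<Rightarrow> 'e \<Rightarrow> 'k::field) \<Rightarrow> nat \<Rightarrow> (('e \<Rightarrow> 'k) \<Rightarrow> 'k) \<Rightarrow> ('e \<Rightarrow> 'k) \<Rightarrow> 'k" where
  "iterated_deriv v 0 f = f"
| "iterated_deriv v (Suc k) f = dir_deriv (v k) (iterated_deriv v k f)"

abbreviation coordinates :: "'e set \<Rightarrow> (('e \<Rightarrow> 'k::field) \<Rightarrow> 'k) set" where
  "coordinates E \<equiv> {\<lambda>w. w e | e. e \<in> E}"

context
  fixes E :: "'e set" and K :: "'k::field itself"
  assumes inf: "infinite (UNIV :: 'k set)"
begin

abbreviation P :: "(('e \<Rightarrow> 'k) \<Rightarrow> 'k) set" where "P \<equiv> algebra_generated (coordinates E)"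

lemma poly_eq_infinite: "(\<And>t. poly r t = poly s t) \<Longrightarrow> r = (s :: 'k Polynomial.poly)"
proof -
  assume "\<And>t. poly r t = poly s t"
  then have "{x. poly (r - s) x = 0} = UNIV" by simp
  then have "r - s = 0" using poly_roots_finite[of "r - s"] inf by auto
  then show ?thesis by simp
qed

lemma dir_derivI: "line_polynomial f w v r \<Longrightarrow> dir_deriv v f w = Polynomial.coeff r (1 :: nat)"
  for f :: "('e \<Rightarrow> 'k) \<Rightarrow> 'k"
proof -
  assume r: "line_polynomial f w v r"
  then have "(THE r. line_polynomial f w v r) = r"
    by (rule the_equality) (use r in \<open>auto simp: line_polynomial_def intro!: poly_eq_infinite\<close>)
  then show ?thesis by (simp add: dir_deriv_def)
qed

lemma line_polynomial_exists: "f \<in> P \<Longrightarrow> \<exists>r. line_polynomial f w v r"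
proof (induction f rule: algebra_generated.induct)
  case (const c)
  show ?case by (rule exI[of _ "[:c:]"]) (simp add: line_polynomial_def)
next
  case (incl f)
  then obtain e where "f = (\<lambda>w. w e)" by auto
  then have "line_polynomial f w v [:w e, v e:]" by (simp add: line_polynomial_def)
  then show ?case by blast
next
  case (add f h)
  then obtain r s where "line_polynomial f w v r" "line_polynomial h w v s" by blast
  then have "line_polynomial (f + h) w v (r + s)" by (simp add: line_polynomial_def)
  then show ?case by blast
next
  case (mult f h)
  then obtain r s where "line_polynomial f w v r" "line_polynomial h w v s" by blast
  then have "line_polynomial (f * h) w v (r * s)" by (simp add: line_polynomial_def)
  then show ?case by blast
qed

lemma line_polynomial_0: "line_polynomial f w v r \<Longrightarrow> Polynomial.coeff r 0 = f w"
  unfolding line_polynomial_def by (drule spec[of _ 0]) (simp add: poly_0_coeff_0)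

lemma dir_deriv_rules:
  fixes f h :: "('e \<Rightarrow> 'k) \<Rightarrow> 'k"
  shows dir_deriv_const: "dir_deriv v (\<lambda>_. c :: 'k) = (\<lambda>w. 0)"
    and dir_deriv_coordinate: "dir_deriv v (\<lambda>w. w e) = (\<lambda>w. v e :: 'k)"
    and dir_deriv_add: "f \<in> P \<Longrightarrow> h \<in> P \<Longrightarrow> dir_deriv v (f + h) = dir_deriv v f + dir_deriv v h"
    and dir_deriv_mult: "f \<in> P \<Longrightarrow> h \<in> P \<Longrightarrow> dir_deriv v (f * h) = f * dir_deriv v h + h * dir_deriv v f"
proof -
  show "dir_deriv v (\<lambda>_. c :: 'k) = (\<lambda>w. 0)"
  proof
    fix w show "dir_deriv v (\<lambda>_. c) w = 0"
      by (subst dir_derivI[of _ _ _ "[:c:]"]) (simp_all add: line_polynomial_def)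
  qed
  show "dir_deriv v (\<lambda>w. w e) = (\<lambda>w. v e)"
  proof
    fix w show "dir_deriv v (\<lambda>w. w e) w = v e"
      by (subst dir_derivI[of _ _ _ "[:w e, v e:]"]) (simp_all add: line_polynomial_def)
  qed
  assume fh: "f \<in> P" "h \<in> P"
  show "dir_deriv v (f + h) = dir_deriv v f + dir_deriv v h"
  proof
    fix w
    obtain r s where rs: "line_polynomial f w v r" "line_polynomial h w v s"
      using line_polynomial_exists fh by blast
    then have "line_polynomial (f + h) w v (r + s)" by (simp add: line_polynomial_def)
    then show "dir_deriv v (f + h) w = (dir_deriv v f + dir_deriv v h) w"
      using rs by (simp add: dir_derivI)
  qed
  show "dir_deriv v (f * h) = f * dir_deriv v h + h * dir_deriv v f"
  proof
    fix w
    obtain r s where rs: "line_polynomial f w v r" "line_polynomial h w v s"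
      using line_polynomial_exists fh by blast
    then have "line_polynomial (f * h) w v (r * s)" by (simp add: line_polynomial_def)
    then have "dir_deriv v (f * h) w = Polynomial.coeff (r * s) 1" by (rule dir_derivI)
    also have "\<dots> = f w * Polynomial.coeff s 1 + h w * Polynomial.coeff r 1"
      using rs by (simp add: Polynomial.coeff_mult line_polynomial_0)
    finally show "dir_deriv v (f * h) w = (f * dir_deriv v h + h * dir_deriv v f) w"
      using rs by (simp add: dir_derivI)
  qed
qed

lemma dir_deriv_closed: "f \<in> P \<Longrightarrow> dir_deriv v f \<in> P"
proof (induction f rule: algebra_generated.induct)
  case (const c)
  show ?case unfolding dir_deriv_const by (rule algebra_generated.const)
next
  case (incl f)
  then obtain e where "f = (\<lambda>w. w e)" by auto
  then show ?case by (simp only: dir_deriv_coordinate algebra_generated.const)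
next
  case (add f h)
  then show ?case unfolding dir_deriv_add[OF add.hyps] by (intro algebra_generated.add)
next
  case (mult f h)
  then show ?case unfolding dir_deriv_mult[OF mult.hyps]
    by (intro algebra_generated.add algebra_generated.mult)
qed

lemma dir_deriv_direction_sum:
  assumes "f \<in> P" "finite I"
  shows "dir_deriv (\<lambda>e. \<Sum>i\<in>I. v i e) f w = (\<Sum>i\<in>I. dir_deriv (v i) f w)"
  using assms(1)
proof (induction f arbitrary: w rule: algebra_generated.induct)
  case (const c)
  show ?case by (simp add: dir_deriv_const)
next
  case (incl f)
  then obtain e where "f = (\<lambda>w. w e)" by auto
  then show ?case by (simp add: dir_deriv_coordinate)
next
  case (add f h)
  then show ?case unfolding dir_deriv_add[OF add.hyps] by (simp add: sum.distrib)
next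
  case (mult f h)
  then show ?case unfolding dir_deriv_mult[OF mult.hyps] by (simp add: sum.distrib sum_distrib_left)
qed

text \<open>For nonzero t, scaling carries lines through w to lines through tw, which gives the
  claim after division by t.\<close>

lemma dir_deriv_homogeneous:
  assumes f: "f \<in> P" and hom: "f \<in> homogeneous_functions (\<lambda>t w e. t * w e) d"
  shows "d > 0 \<Longrightarrow> dir_deriv v f \<in> homogeneous_functions (\<lambda>t w e. t * w e) (d - 1)"
    and "d = 0 \<Longrightarrow> dir_deriv v f = (\<lambda>w. 0)"
proof -
  assume d: "d = 0"
  have "f = (\<lambda>_. f (\<lambda>e. 0))"
  proof
    fix w show "f w = f (\<lambda>e. 0)"
    proof -
      have "f (\<lambda>e. 0 * w e) = 0 ^ d * f w" using hom unfolding homogeneous_functions_def by blast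
      then show ?thesis using d by simp
    qed
  qed
  then show "dir_deriv v f = (\<lambda>w. 0)" using dir_deriv_const by metis
next
  assume d: "d > 0"
  have nonzero: "dir_deriv v f (\<lambda>e. t * w e) = t ^ (d - 1) * dir_deriv v f w" if t: "t \<noteq> 0" for t w
  proof -
    obtain r where r: "line_polynomial f w v r" using line_polynomial_exists f by blast
    have "line_polynomial f (\<lambda>e. t * w e) v (smult (t ^ d) (r \<circ>\<^sub>p [:0, 1 / t:]))"
      unfolding line_polynomial_def
    proof
      fix s
      have "f (\<lambda>e. t * w e + s * v e) = f (\<lambda>e. t * (w e + (s / t) * v e))"
        using t by (simp add: distrib_left)
      also have "\<dots> = t ^ d * f (\<lambda>e. w e + (s / t) * v e)"
        using hom unfolding homogeneous_functions_def by simp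
      also have "\<dots> = t ^ d * poly r (s / t)"
        using r unfolding line_polynomial_def by (intro arg_cong2[of _ _ _ _ "(*)"] refl) (rule spec)
      finally show "f (\<lambda>e. t * w e + s * v e) = poly (smult (t ^ d) (r \<circ>\<^sub>p [:0, 1 / t:])) s"
        by (simp add: poly_pcompose)
    qed
    from dir_derivI[OF this] have "dir_deriv v f (\<lambda>e. t * w e) = t ^ d * Polynomial.coeff (r \<circ>\<^sub>p [:0, 1 / t:]) 1" by simp
    also have "Polynomial.coeff (r \<circ>\<^sub>p [:0, 1 / t:]) 1 = Polynomial.coeff r 1 / t"
      using coeff_pcompose_linear[of r "1 / t" 1] by simp
    also have "t ^ d * (Polynomial.coeff r 1 / t) = t ^ (d - 1) * Polynomial.coeff r 1"
      using t d by (cases d) auto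
    finally show ?thesis using dir_derivI[OF r] by simp
  qed
  have "dir_deriv v f (\<lambda>e. t * w e) = t ^ (d - 1) * dir_deriv v f w" for t w
  proof -
    obtain r where r: "line_polynomial (dir_deriv v f) (\<lambda>e. 0) w r"
      using line_polynomial_exists dir_deriv_closed[OF f] by blast
    \<comment> \<open>At t = 0 the scaling argument breaks down; there it is used that both sides
      are polynomials in t that agree for all other t.\<close>
    define s where "s = r - Polynomial.monom (dir_deriv v f w) (d - 1)"
    have "poly s x = 0" if "x \<noteq> 0" for x
      using r nonzero[OF that, of w] by (simp add: s_def line_polynomial_def poly_monom mult.commute)
    then have "UNIV - {0} \<subseteq> {x. poly s x = 0}" by auto
    then have "s = 0" using poly_roots_finite[of s] inf finite_subset by fastforce
    then have "poly r t = t ^ (d - 1) * dir_deriv v f w" by (simp add: s_def poly_monom mult.commute)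
    then show ?thesis using r by (simp add: line_polynomial_def)
  qed
  then show "dir_deriv v f \<in> homogeneous_functions (\<lambda>t w e. t * w e) (d - 1)"
    unfolding homogeneous_functions_def by blast
qed

lemma iterated_deriv_closed: "f \<in> P \<Longrightarrow> iterated_deriv v k f \<in> P"
  by (induction k) (simp_all add: dir_deriv_closed)

lemma iterated_deriv_add:
  "f \<in> P \<Longrightarrow> h \<in> P \<Longrightarrow> iterated_deriv v k (f + h) = iterated_deriv v k f + iterated_deriv v k h"
  by (induction k) (simp_all only: iterated_deriv.simps dir_deriv_add iterated_deriv_closed)

lemma iterated_deriv_homogeneous:
  assumes "f \<in> P" "f \<in> homogeneous_functions (\<lambda>t w e. t * w e) d"
  shows "k \<le> d \<Longrightarrow> iterated_deriv v k f \<in> homogeneous_functions (\<lambda>t w e. t * w e) (d - k)"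
    and "k > d \<Longrightarrow> iterated_deriv v k f = (\<lambda>w. 0)"
proof -
  have 1: "iterated_deriv v k f \<in> homogeneous_functions (\<lambda>t w e. t * w e) (d - k)" if "k \<le> d" for k
    using that
  proof (induction k)
    case (Suc k)
    then show ?case
      using dir_deriv_homogeneous(1)[OF iterated_deriv_closed[OF assms(1)], of v k "d - k" "v k"] by simp
  qed (use assms in simp)
  then show "iterated_deriv v k f \<in> homogeneous_functions (\<lambda>t w e. t * w e) (d - k)" if "k \<le> d" using that .
  show "iterated_deriv v k f = (\<lambda>w. 0)" if "k > d" using that
  proof (induction k)
    case (Suc k)
    show ?case
    proof (cases "k = d")
      case True
      then show ?thesis
        using dir_deriv_homogeneous(2)[OF iterated_deriv_closed[OF assms(1)], of v k 0 "v k"] 1[of k] by simp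
    next
      case False
      then have "iterated_deriv v k f = (\<lambda>w. 0)" using Suc by simp
      then show ?thesis using dir_deriv_const[of "v k" 0] by simp
    qed
  qed simp
qed

end

text \<open>
  If the order of \<open>G\<close> vanished in \<open>k\<close>, the orbit sum of $x_{0,1} x_{1,1} \cdots x_{N,1}$ would be
  indecomposable in the invariants of $N + 1$ copies of the regular representation: deriving an
  invariant in the direction of a fixed vector, which is a sum over \<open>G\<close>, gives \<open>|G|\<close> times
  something at fixed points.
\<close>

theorem card_group_nonzero:
  fixes G :: "('g, 'x) monoid_scheme" (structure)
  assumes inf: "infinite (UNIV :: 'k::field set)" and G: "group G" and fin: "finite (carrier G)"
    and N: "beta_group G TYPE('k) \<le> enat N"
  shows "of_nat (card (carrier G)) \<noteq> (0 :: 'k)"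
proof
  assume zero: "of_nat (card (carrier G)) = (0 :: 'k)"
  interpret group G by (rule G)
  define act :: "'g \<Rightarrow> (nat \<times> 'g \<Rightarrow> 'k) \<Rightarrow> nat \<times> 'g \<Rightarrow> 'k" where
    "act g w = (\<lambda>e. if snd e \<in> carrier G then w (fst e, inv g \<otimes> snd e) else w e)" for g w
  define sc :: "'k \<Rightarrow> (nat \<times> 'g \<Rightarrow> 'k) \<Rightarrow> nat \<times> 'g \<Rightarrow> 'k" where "sc = (\<lambda>t w e. t * w e)"
  \<comment> \<open>Infinitely many copies of the regular representation are allowed for
    convenience; the orbit sum T lives on the copies 0 to N.\<close>
  define E :: "(nat \<times> 'g) set" where "E = UNIV \<times> carrier G"
  have hom1: "coordinates E \<subseteq> homogeneous_functions sc 1"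
    by (auto simp: homogeneous_functions_def sc_def)
  interpret graded_function_algebra G "coordinates E" sc act
  proof
    show "infinite (UNIV :: 'k set)" by (rule inf)
    show "coordinates E \<subseteq> algebra_generated (coordinates E \<inter> (homogeneous_functions sc 0 \<union> homogeneous_functions sc 1))"
      using hom1 by (intro subsetI algebra_generated.incl) blast
    show "act \<one> w = w" for w by (simp add: act_def fun_eq_iff)
    show "act (g \<otimes> h) w = act g (act h w)" if "g \<in> carrier G" "h \<in> carrier G" for g h w
      using that by (auto simp: act_def fun_eq_iff inv_mult_group m_assoc)
    show "act g (sc t w) = sc t (act g w)" for g t w by (simp add: act_def sc_def fun_eq_iff)
    fix g and f :: "(nat \<times> 'g \<Rightarrow> 'k) \<Rightarrow> 'k" assume g: "g \<in> carrier G" and "f \<in> coordinates E"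
    then obtain i h where f: "f = (\<lambda>w. w (i, h))" "h \<in> carrier G" by (auto simp: E_def)
    have "(\<lambda>w. f (act g w)) = (\<lambda>w. w (i, inv g \<otimes> h))" using f by (simp add: act_def)
    also have "\<dots> \<in> coordinates E" using f(2) g by (force simp: E_def)
    finally show "(\<lambda>w. f (act g w)) \<in> algebra_generated (coordinates E)" by (rule algebra_generated.incl)
  qed
  note deriv_add = dir_deriv_add[OF inf, of _ E] and deriv_mult = dir_deriv_mult[OF inf, of _ E]
    and deriv_closed = dir_deriv_closed[OF inf, of _ E] and derivI = dir_derivI[OF inf]
    and iter_closed = iterated_deriv_closed[OF inf, of _ E] and iter_add = iterated_deriv_add[OF inf, of _ E]
    and line_ex = line_polynomial_exists[OF inf, of _ E]
  define fixd where "fixd w \<longleftrightarrow> (\<forall>g\<in>carrier G. act g w = w)" for w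
  define inv_fun where "inv_fun f \<longleftrightarrow> f \<in> A \<and> (\<forall>g\<in>carrier G. \<forall>w. f (act g w) = f w)" for f
  have inv_A: "f \<in> A" and inv_act: "g \<in> carrier G \<Longrightarrow> f (act g w) = f w" if "inv_fun f" for f g w
    using that unfolding inv_fun_def by blast+
  define U :: "nat \<Rightarrow> 'g \<Rightarrow> nat \<times> 'g \<Rightarrow> 'k" where "U i g = (\<lambda>e. if e = (i, g) then 1 else 0)" for i g
  \<comment> \<open>A fixed vector in copy i + 1; copy 0 is reserved for the direction
    \<open>U 0 \<one>\<close>.\<close>
  define v :: "nat \<Rightarrow> nat \<times> 'g \<Rightarrow> 'k" where "v i = (\<lambda>e. \<Sum>g\<in>carrier G. U (Suc i) g e)" for i
  have v_eq: "v i e = (if fst e = Suc i \<and> snd e \<in> carrier G then 1 else 0)" for i e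
  proof -
    have "v i e = (\<Sum>g\<in>carrier G. if snd e = g then if fst e = Suc i then 1 else 0 else 0)"
      unfolding v_def by (intro sum.cong) (auto simp: U_def prod_eq_iff)
    then show ?thesis using fin by simp
  qed
  have fixd_comb: "fixd (\<lambda>e. c e + t * d e)" if "fixd c" "fixd d" for c d t
  proof -
    have "act g (\<lambda>e. c e + t * d e) = (\<lambda>e. act g c e + t * act g d e)" for g
      by (simp add: act_def fun_eq_iff)
    then show ?thesis using that by (simp add: fixd_def)
  qed
  have fixd_v: "fixd (v i)" for i by (auto simp: fixd_def act_def v_eq fun_eq_iff)
  have v_zero: "dir_deriv (v i) f c = 0" if f: "inv_fun f" and c: "fixd c" for i f c
  proof -
    have eq: "dir_deriv (U (Suc i) g) f c = dir_deriv (U (Suc i) \<one>) f c" if g: "g \<in> carrier G" for g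
    proof -
      obtain r where r: "line_polynomial f c (U (Suc i) \<one>) r" using line_ex[OF inv_A[OF f]] by blast
      have "line_polynomial f c (U (Suc i) g) r"
        unfolding line_polynomial_def
      proof
        fix t
        have iff: "inv g \<otimes> h = \<one> \<longleftrightarrow> h = g" if "h \<in> carrier G" for h
          using g that by (metis inv_closed inv_equality inv_inv l_inv)
        have "act g (\<lambda>e. c e + t * U (Suc i) \<one> e) = (\<lambda>e. c e + t * U (Suc i) g e)"
        proof
          fix e :: "nat \<times> 'g"
          obtain j h where e: "e = (j, h)" by (cases e)
          show "act g (\<lambda>e. c e + t * U (Suc i) \<one> e) e = c e + t * U (Suc i) g e"
          proof (cases "h \<in> carrier G")
            case True
            have "act g c e = c e" using c g by (simp add: fixd_def)
            then show ?thesis using True iff[OF True] by (auto simp: act_def e U_def)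
          next
            case False
            then show ?thesis using g by (auto simp: act_def e U_def)
          qed
        qed
        then have "f (\<lambda>e. c e + t * U (Suc i) g e) = f (\<lambda>e. c e + t * U (Suc i) \<one> e)"
          using inv_act[OF f g] by metis
        then show "f (\<lambda>e. c e + t * U (Suc i) g e) = poly r t" using r by (simp add: line_polynomial_def)
      qed
      then show ?thesis using r by (simp add: derivI)
    qed
    have "dir_deriv (v i) f c = (\<Sum>g\<in>carrier G. dir_deriv (U (Suc i) g) f c)"
      unfolding v_def by (rule dir_deriv_direction_sum[OF inf inv_A[OF f] fin])
    also have "\<dots> = (\<Sum>g\<in>carrier G. dir_deriv (U (Suc i) \<one>) f c)" by (intro sum.cong refl eq)
    finally have "dir_deriv (v i) f c = of_nat (card (carrier G)) * dir_deriv (U (Suc i) \<one>) f c" by simp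
    then show ?thesis using zero by simp
  qed
  \<comment> \<open>A line through a fixed point in a fixed direction consists of fixed points, so
    only the values at fixed points matter.\<close>
  have tangent: "dir_deriv (v i) H c = dir_deriv (v i) H' c"
    if "H \<in> A" "H' \<in> A" "\<And>c. fixd c \<Longrightarrow> H c = H' c" "fixd c" for i H H' c
  proof -
    obtain r where r: "line_polynomial H c (v i) r" using line_ex[OF \<open>H \<in> A\<close>] by blast
    then have "line_polynomial H' c (v i) r"
      using that(3)[OF fixd_comb[OF that(4) fixd_v]] by (simp add: line_polynomial_def)
    then show ?thesis using r by (simp add: derivI)
  qed
  \<comment> \<open>By \<open>v_zero\<close>, an invariant behaves like a constant under these
    derivatives at fixed points; \<open>tangent\<close> lets this be used repeatedly.\<close>
  have iter_mult: "iterated_deriv v k (f * H) c = f c * iterated_deriv v k H c"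
    if f: "inv_fun f" and H: "H \<in> A" and c: "fixd c" for k f H c
    using c
  proof (induction k arbitrary: c)
    case (Suc k)
    have fA: "f \<in> A" by (rule inv_A[OF f])
    let ?H = "iterated_deriv v k H"
    have HA: "?H \<in> A" by (rule iter_closed[OF H])
    have "dir_deriv (v k) (iterated_deriv v k (f * H)) c = dir_deriv (v k) (f * ?H) c"
    proof (rule tangent)
      show "iterated_deriv v k (f * H) \<in> A" by (intro iter_closed algebra_generated.mult fA H)
      show "f * ?H \<in> A" by (intro algebra_generated.mult fA HA)
      show "iterated_deriv v k (f * H) d = (f * ?H) d" if "fixd d" for d
        unfolding Suc.IH[OF that] by (rule times_fun_apply[symmetric])
      show "fixd c" by (rule Suc.prems)
    qed
    also have "\<dots> = f c * dir_deriv (v k) ?H c"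
      unfolding deriv_mult[OF fA HA] by (simp add: v_zero[OF f Suc.prems])
    finally show ?case unfolding iterated_deriv.simps .
  qed simp
  \<comment> \<open>There are N + 1 derivatives, enough to kill degree at most N. The first
    direction is not fixed: with a sum over G in its place, the value for T at 0 would be |G|, which
    is 0 here.\<close>
  define \<Psi> where "\<Psi> f = iterated_deriv v N (dir_deriv (U 0 \<one>) f)" for f
  have iter_0: "iterated_deriv v k (\<lambda>w. 0) = (\<lambda>w. 0)" for k
    by (induction k) (simp_all add: dir_deriv_const[OF inf])
  have gen: "inv_fun f \<and> (\<forall>c. fixd c \<longrightarrow> \<Psi> f c = 0)"
    if "f \<in> algebra_generated {h. (\<exists>d\<le>N. h \<in> A_hom d) \<and> (\<forall>g\<in>carrier G. \<forall>w. h (act g w) = h w)}" for f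
    using that
  proof (induction f rule: algebra_generated.induct)
    case (const c)
    show ?case
      by (simp add: inv_fun_def algebra_generated.const \<Psi>_def dir_deriv_const[OF inf] iter_0)
  next
    case (incl h)
    then obtain d where d: "d \<le> N" "h \<in> A" "h \<in> homogeneous_functions (\<lambda>t w e. t * w e) d"
      "inv_fun h" unfolding inv_fun_def sc_def by blast
    have "\<Psi> h = (\<lambda>w. 0)"
    proof (cases "d = 0")
      case True
      then show ?thesis
        using dir_deriv_homogeneous(2)[OF inf d(2,3)] by (simp add: \<Psi>_def iter_0)
    next
      case False
      then have "dir_deriv (U 0 \<one>) h \<in> homogeneous_functions (\<lambda>t w e. t * w e) (d - 1)"
        using dir_deriv_homogeneous(1)[OF inf d(2,3)] by simp
      then show ?thesis unfolding \<Psi>_def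
        using iterated_deriv_homogeneous(2)[OF inf deriv_closed[OF d(2)]] False d(1) by simp
    qed
    then show ?case using d(4) by simp
  next
    case (add f h)
    have fh: "f \<in> A" "h \<in> A" using add.IH inv_A by blast+
    have "\<Psi> (f + h) = \<Psi> f + \<Psi> h"
      unfolding \<Psi>_def deriv_add[OF fh] by (intro iter_add deriv_closed fh)
    moreover have "inv_fun (f + h)"
      using add.IH algebra_generated.add[OF fh] unfolding inv_fun_def by simp
    ultimately have "inv_fun (f + h) \<and> (\<forall>c. fixd c \<longrightarrow> \<Psi> (f + h) c = 0)" using add.IH by simp
    then show ?case unfolding plus_fun_def .
  next
    case (mult f h)
    have fh: "f \<in> A" "h \<in> A" using mult.IH inv_A by blast+
    \<comment> \<open>The Leibniz rule for the first derivative; in both terms the invariant factor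
      passes through the others, so \<Psi> is a derivation at fixed points and vanishes there on the
      whole algebra generated.\<close>
    have "\<Psi> (f * h) = iterated_deriv v N (f * dir_deriv (U 0 \<one>) h) + iterated_deriv v N (h * dir_deriv (U 0 \<one>) f)"
      unfolding \<Psi>_def deriv_mult[OF fh] by (intro iter_add algebra_generated.mult deriv_closed fh)
    then have "\<Psi> (f * h) c = f c * \<Psi> h c + h c * \<Psi> f c" if "fixd c" for c
      unfolding \<Psi>_def
      using iter_mult[OF conjunct1[OF mult.IH(1)] deriv_closed[OF fh(2)] that]
        iter_mult[OF conjunct1[OF mult.IH(2)] deriv_closed[OF fh(1)] that]
      by (simp only: plus_fun_apply)
    moreover have "inv_fun (f * h)"
      using mult.IH algebra_generated.mult[OF fh] unfolding inv_fun_def by simp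
    ultimately have "inv_fun (f * h) \<and> (\<forall>c. fixd c \<longrightarrow> \<Psi> (f * h) c = 0)" using mult.IH by simp
    then show ?case unfolding times_fun_def .
  qed
  define T :: "(nat \<times> 'g \<Rightarrow> 'k) \<Rightarrow> 'k" where "T = (\<Sum>g\<in>carrier G. \<Prod>i\<le>N. (\<lambda>w. w (i, g)))"
  have T: "T w = (\<Sum>g\<in>carrier G. \<Prod>i\<le>N. w (i, g))" for w
    by (simp add: T_def sum_fun_apply prod_fun_apply)
  have "T \<in> A" unfolding T_def
    by (intro algebra_generated_sum algebra_generated_prod algebra_generated.incl) (auto simp: E_def)
  moreover have "T (act x w) = T w" if x: "x \<in> carrier G" for x w
  proof -
    have "T (act x w) = (\<Sum>g\<in>carrier G. \<Prod>i\<le>N. w (i, inv x \<otimes> g))"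
      unfolding T by (intro sum.cong prod.cong) (auto simp: act_def)
    also have "\<dots> = (\<Sum>g\<in>carrier G. \<Prod>i\<le>N. w (i, g))"
      by (rule sum.reindex_bij_witness[of _ "\<lambda>g. x \<otimes> g" "\<lambda>g. inv x \<otimes> g"])
        (use x in \<open>auto simp: m_assoc[symmetric]\<close>)
    finally show ?thesis by (simp add: T)
  qed
  ultimately have "T \<in> algebra_generated {h. (\<exists>d\<le>N. h \<in> A_hom d) \<and> (\<forall>g\<in>carrier G. \<forall>w. h (act g w) = h w)}"
    by (rule invariants_generated[OF fin N])
  then have "\<Psi> T (\<lambda>e. 0) = 0" using gen by (auto simp: fixd_def act_def)
  \<comment> \<open>The first derivative selects the summand of the neutral element, and each
    further one removes the variable of the next copy.\<close>
  moreover have "iterated_deriv v k (dir_deriv (U 0 \<one>) T) = (\<lambda>w. \<Prod>i\<in>{Suc k..N}. w (i, \<one>))" if "k \<le> N" for k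
    using that
  proof (induction k)
    case 0
    show ?case
    proof
      fix w
      have "line_polynomial T w (U 0 \<one>) [:T w, \<Prod>i\<in>{Suc 0..N}. w (i, \<one>):]"
        unfolding line_polynomial_def
      proof
        fix t
        have split: "(\<Prod>i\<le>N. y i) = y 0 * (\<Prod>i\<in>{Suc 0..N}. y i)" for y :: "nat \<Rightarrow> 'k"
          by (simp add: atMost_atLeast0 prod.atLeast_Suc_atMost)
        have "(\<Prod>i\<le>N. w (i, g) + t * U 0 \<one> (i, g)) = (\<Prod>i\<le>N. w (i, g)) + (if g = \<one> then t * (\<Prod>i\<in>{Suc 0..N}. w (i, \<one>)) else 0)" for g
        proof -
          have "(\<Prod>i\<in>{Suc 0..N}. w (i, g) + t * U 0 \<one> (i, g)) = (\<Prod>i\<in>{Suc 0..N}. w (i, g))"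
            by (intro prod.cong) (auto simp: U_def)
          then show ?thesis unfolding split by (simp add: U_def distrib_right)
        qed
        then show "T (\<lambda>e. w e + t * U 0 \<one> e) = poly [:T w, \<Prod>i\<in>{Suc 0..N}. w (i, \<one>):] t"
          using fin by (simp add: T sum.distrib)
      qed
      then show "iterated_deriv v 0 (dir_deriv (U 0 \<one>) T) w = (\<Prod>i\<in>{Suc 0..N}. w (i, \<one>))"
        by (simp add: derivI)
    qed
  next
    case (Suc k)
    show ?case
    proof
      fix w
      have "line_polynomial (\<lambda>w. \<Prod>i\<in>{Suc k..N}. w (i, \<one>)) w (v k)
          [:\<Prod>i\<in>{Suc k..N}. w (i, \<one>), \<Prod>i\<in>{Suc (Suc k)..N}. w (i, \<one>):]"
        unfolding line_polynomial_def
      proof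
        fix t
        have split: "(\<Prod>i\<in>{Suc k..N}. y i) = y (Suc k) * (\<Prod>i\<in>{Suc (Suc k)..N}. y i)" for y :: "nat \<Rightarrow> 'k"
          using Suc.prems by (simp add: prod.atLeast_Suc_atMost)
        have "(\<Prod>i\<in>{Suc (Suc k)..N}. w (i, \<one>) + t * v k (i, \<one>)) = (\<Prod>i\<in>{Suc (Suc k)..N}. w (i, \<one>))"
          by (intro prod.cong) (auto simp: v_eq)
        then show "(\<Prod>i\<in>{Suc k..N}. w (i, \<one>) + t * v k (i, \<one>)) =
            poly [:\<Prod>i\<in>{Suc k..N}. w (i, \<one>), \<Prod>i\<in>{Suc (Suc k)..N}. w (i, \<one>):] t"
          unfolding split by (simp add: v_eq distrib_right)
      qed
      then show "iterated_deriv v (Suc k) (dir_deriv (U 0 \<one>) T) w = (\<Prod>i\<in>{Suc (Suc k)..N}. w (i, \<one>))"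
        using Suc by (simp add: derivI)
    qed
  qed
  from this[of N] have "\<Psi> T (\<lambda>e. 0) = 1" by (simp add: \<Psi>_def)
  ultimately show False by simp
qed

section \<open>Polynomials on several copies of a vector space\<close>

lemma vector_space_functions: "vector_space (\<lambda>c f w. c * f w :: 'k::field)"
  by unfold_locales (simp_all add: fun_eq_iff algebra_simps)

interpretation funs: vector_space "\<lambda>c f w. c * f w :: 'k::field"
  by (rule vector_space_functions)

lemma vector_space_scale_sum:
  assumes "vector_space sU" "vector_space sV"
  shows "vector_space (scale_sum sU sV)"
proof -
  interpret U: vector_space sU by fact
  interpret V: vector_space sV by fact
  show ?thesis
    by unfold_locales
      (auto simp: scale_sum_def fun_eq_iff U.scale_right_distrib V.scale_right_distrib
        U.scale_left_distrib V.scale_left_distrib)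
qed

lemma GL_carrierI:
  fixes a b :: "'k::field mat"
  assumes "a \<in> carrier_mat m m" "b \<in> carrier_mat m m" "a * b = 1\<^sub>m m" "b * a = 1\<^sub>m m"
  shows "a \<in> carrier (GL m)"
  unfolding GL_def units_of_carrier Units_def using assms by (auto simp: ring_mat_simps)

lemma GL_props:
  shows GL_group: "Group.group (GL m :: 'k::field mat monoid)"
    and GL_carrier_mat: "a \<in> carrier (GL m) \<Longrightarrow> (a :: 'k mat) \<in> carrier_mat m m"
    and GL_mult: "a \<otimes>\<^bsub>GL m\<^esub> b = (a * b :: 'k mat)"
proof -
  interpret R: ring "ring_mat TYPE('k) m ()" by (rule ring_mat)
  show "Group.group (GL m :: 'k mat monoid)" unfolding GL_def by (rule R.units_group)
  show "a \<in> carrier (GL m) \<Longrightarrow> (a :: 'k mat) \<in> carrier_mat m m"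
    by (auto simp: GL_def units_of_carrier Units_def ring_mat_simps)
  show "a \<otimes>\<^bsub>GL m\<^esub> b = (a * b :: 'k mat)" by (simp add: GL_def units_of_mult ring_mat_simps)
qed

section \<open>Coordinates and monomials on U and copies of V\<close>

locale vector_copies = U: vector_space sU + V: finite_dimensional_vector_space sV B
  for sU :: "'k::field \<Rightarrow> 'u::ab_group_add \<Rightarrow> 'u" and sV :: "'k \<Rightarrow> 'v::ab_group_add \<Rightarrow> 'v" and B +
  assumes inf: "infinite (UNIV :: 'k set)"
begin

abbreviation "Lin \<equiv> linear_functionals sU sV"
abbreviation "Pol \<equiv> polynomial_functions sU sV"
abbreviation "coord v b \<equiv> V.representation B v b"

definition rescale :: "'k \<Rightarrow> 'u \<times> (nat \<Rightarrow> 'v) \<Rightarrow> 'u \<times> (nat \<Rightarrow> 'v)" where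
  "rescale t = (\<lambda>(u, v). (u, \<lambda>i. sV t (v i)))"

sublocale W: vector_space "scale_sum sU sV"
  by (intro vector_space_scale_sum U.vector_space_axioms V.vector_space_axioms)

lemma Lin_iff: "l \<in> Lin m \<longleftrightarrow> (\<forall>x y. l (x + y) = l x + l y) \<and> (\<forall>c x. l (scale_sum sU sV c x) = c * l x) \<and>
    (\<forall>u v v'. (\<forall>i<m. v i = v' i) \<longrightarrow> l (u, v) = l (u, v'))"
  unfolding linear_functionals_def Vector_Spaces.linear_iff
  using W.vector_space_axioms vector_space_mult by blast

lemma coord_add: "coord (v + w) b = coord v b + coord w b"
  by (simp add: V.representation_add V.independent_Basis V.span_Basis)

lemma coord_scale: "coord (sV c v) b = c * coord v b"
  by (simp add: V.representation_scale V.independent_Basis V.span_Basis)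

lemma coord_sum: "(\<Sum>b\<in>B. sV (coord v b) b) = v"
  by (rule V.sum_representation_eq)
    (simp_all add: V.independent_Basis V.span_Basis V.finite_Basis)

lemma coord_Lin: "i < m \<Longrightarrow> (\<lambda>w. coord (snd w i) b) \<in> Lin m"
  by (auto simp: Lin_iff coord_add coord_scale scale_sum_def split: prod.splits)

lemma LinD:
  assumes "l \<in> Lin m"
  shows "l (x + y) = l x + l y" "l (scale_sum sU sV c x) = c * l x"
    "(\<And>i. i < m \<Longrightarrow> v i = v' i) \<Longrightarrow> l (u, v) = l (u, v')"
  using assms unfolding Lin_iff by blast+

lemma Lin_mono: "n \<le> m \<Longrightarrow> Lin n \<subseteq> Lin m"
  unfolding linear_functionals_def by (auto intro: order_less_le_trans)

lemma Pol_mono: "n \<le> m \<Longrightarrow> Pol n \<subseteq> Pol m"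
  unfolding polynomial_functions_def
  by (intro algebra_generated_mono) (use Lin_mono in \<open>auto intro: algebra_generated.incl\<close>)

lemma Lin_U: "l \<in> Lin m \<Longrightarrow> (\<lambda>w. l (fst w, 0)) \<in> Lin 0"
proof -
  assume l: "l \<in> Lin m"
  have 1: "(fst (x + y), 0 :: nat \<Rightarrow> 'v) = (fst x, 0) + (fst y, 0)" for x y :: "'u \<times> (nat \<Rightarrow> 'v)" by simp
  have 2: "(fst (scale_sum sU sV c x), 0 :: nat \<Rightarrow> 'v) = scale_sum sU sV c (fst x, 0)" for c x
    by (simp add: scale_sum_def case_prod_beta fun_eq_iff)
  show ?thesis unfolding Lin_iff 1 2 LinD(1,2)[OF l] by simp
qed

lemma Lin_V: "l \<in> Lin m \<Longrightarrow> (\<lambda>w. l (0, snd w)) \<in> Lin m"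
proof -
  assume l: "l \<in> Lin m"
  have 1: "(0 :: 'u, snd (x + y)) = (0, snd x) + (0, snd y)" for x y :: "'u \<times> (nat \<Rightarrow> 'v)" by simp
  have 2: "(0 :: 'u, snd (scale_sum sU sV c x)) = scale_sum sU sV c (0, snd x)" for c x
    by (simp add: scale_sum_def case_prod_beta)
  show ?thesis unfolding Lin_iff 1 2 LinD(1,2)[OF l] by (auto intro!: LinD(3)[OF l])
qed

lemma Lin_split: "l \<in> Lin m \<Longrightarrow> l = (\<lambda>w. l (fst w, 0)) + (\<lambda>w. l (0, snd w))"
proof
  fix w :: "'u \<times> (nat \<Rightarrow> 'v)"
  assume l: "l \<in> Lin m"
  have "w = (fst w, 0) + (0, snd w)" by (simp add: prod_eq_iff)
  then have "l w = l (fst w, 0) + l (0, snd w)" using LinD(1)[OF l] by metis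
  then show "l w = ((\<lambda>w. l (fst w, 0)) + (\<lambda>w. l (0, snd w))) w" by simp
qed

lemma Lin_V_coord:
  assumes l: "l \<in> Lin m"
  shows "l (0, v) = (\<Sum>i<m. \<Sum>b\<in>B. coord (v i) b * l (0, \<lambda>j. if j = i then b else 0))"
proof -
  let ?e = "\<lambda>i x. (0 :: 'u, \<lambda>j :: nat. if j = i then x else 0 :: 'v)"
  have add: "l (x + y) = l x + l y" and sc: "l (scale_sum sU sV c x) = c * l x" for x y c
    using l unfolding Lin_iff by blast+
  have "l 0 + l 0 = l 0 + 0" using add[of 0 0] by (simp only: add_0_right)
  then have l0: "l 0 = 0" by (rule add_left_imp_eq)
  have sum: "l (\<Sum>i\<in>I. F i) = (\<Sum>i\<in>I. l (F i))" for F :: "'i \<Rightarrow> _" and I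
    by (induction I rule: infinite_finite_induct) (simp_all add: l0 add)
  have e: "?e i (\<Sum>b\<in>J. f b) = (\<Sum>b\<in>J. ?e i (f b))" for i f and J :: "'v set"
  proof (induction J rule: infinite_finite_induct)
    case (insert x F)
    have "?e i (\<Sum>b\<in>insert x F. f b) = ?e i (f x) + ?e i (\<Sum>b\<in>F. f b)"
      using insert(1,2) by (simp add: fun_eq_iff)
    then show ?case using insert by simp
  qed (auto simp: zero_prod_def fun_eq_iff)
  have "l (0, v) = l (0, \<lambda>j. if j < m then v j else 0)"
    by (rule LinD(3)[OF l]) simp
  also have "(0, \<lambda>j. if j < m then v j else 0) = (\<Sum>i<m. ?e i (v i))"
  proof -
    have "(\<Sum>i<k. ?e i (v i)) = (0, \<lambda>j. if j < k then v j else 0)" for k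
      by (induction k) (auto simp: zero_prod_def fun_eq_iff less_Suc_eq)
    then show ?thesis by simp
  qed
  also have "l \<dots> = (\<Sum>i<m. \<Sum>b\<in>B. l (?e i (sV (coord (v i) b) b)))"
    unfolding sum by (subst coord_sum[symmetric]) (simp only: e sum)
  also have "?e i (sV c x) = scale_sum sU sV c (?e i x)" for i c x
    by (simp add: scale_sum_def fun_eq_iff)
  then have "(\<Sum>i<m. \<Sum>b\<in>B. l (?e i (sV (coord (v i) b) b))) = (\<Sum>i<m. \<Sum>b\<in>B. coord (v i) b * l (?e i b))"
    by (simp add: sc)
  finally show ?thesis .
qed

lemma Pol_precompose:
  assumes T: "\<And>l. l \<in> Lin m \<Longrightarrow> (\<lambda>w. l (T w)) \<in> Pol m" and f: "f \<in> Pol m"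
  shows "(\<lambda>w. f (T w)) \<in> Pol m"
  using f unfolding polynomial_functions_def
proof (induction f rule: algebra_generated.induct)
  case (add f h)
  then show ?case using algebra_generated.add[of "\<lambda>w. f (T w)" "Lin m" "\<lambda>w. h (T w)"] by (simp add: plus_fun_def)
next
  case (mult f h)
  then show ?case using algebra_generated.mult[of "\<lambda>w. f (T w)" "Lin m" "\<lambda>w. h (T w)"] by (simp add: times_fun_def)
qed (use T in \<open>auto intro: algebra_generated.const simp: polynomial_functions_def\<close>)

lemma GL_action_mult:
  assumes "a \<in> carrier_mat m m" "b \<in> carrier_mat m m"
  shows "GL_action sV m (a * b) w = GL_action sV m a (GL_action sV m b w)"
proof -
  have "(\<Sum>k<m. sV ((a * b) $$ (i, k)) (v k)) = (\<Sum>j<m. sV (a $$ (i, j)) (\<Sum>k<m. sV (b $$ (j, k)) (v k)))"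
    if i: "i < m" for i and v :: "nat \<Rightarrow> 'v"
  proof -
    have "(\<Sum>k<m. sV ((a * b) $$ (i, k)) (v k)) = (\<Sum>k<m. \<Sum>j<m. sV (a $$ (i, j) * b $$ (j, k)) (v k))"
      using assms i by (intro sum.cong) (auto simp: scalar_prod_def V.scale_sum_left lessThan_atLeast0)
    also have "\<dots> = (\<Sum>j<m. \<Sum>k<m. sV (a $$ (i, j) * b $$ (j, k)) (v k))" by (rule sum.swap)
    finally show ?thesis by (simp add: V.scale_sum_right)
  qed
  then show ?thesis by (cases w) (auto simp: GL_action_def fun_eq_iff intro!: sum.cong)
qed

lemma GL_action_linear:
  "GL_action sV m a (x + y) = GL_action sV m a x + GL_action sV m a y"
  "GL_action sV m a (scale_sum sU sV c x) = scale_sum sU sV c (GL_action sV m a x)"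
proof -
  show "GL_action sV m a (x + y) = GL_action sV m a x + GL_action sV m a y"
    by (cases x; cases y) (simp add: GL_action_def fun_eq_iff V.scale_right_distrib sum.distrib)
  show "GL_action sV m a (scale_sum sU sV c x) = scale_sum sU sV c (GL_action sV m a x)"
    by (cases x) (simp add: GL_action_def scale_sum_def fun_eq_iff V.scale_sum_right mult.commute)
qed

lemma GL_action_Lin: "l \<in> Lin m \<Longrightarrow> (\<lambda>w. l (GL_action sV m a w)) \<in> Lin m"
  unfolding Lin_iff GL_action_linear
  by (auto simp: GL_action_def intro!: arg_cong[of _ _ l] sum.cong)

lemma GL_action_Pol: "f \<in> Pol m \<Longrightarrow> (\<lambda>w. f (GL_action sV m a w)) \<in> Pol m"
  by (rule Pol_precompose) (auto simp: polynomial_functions_def intro: algebra_generated.incl GL_action_Lin)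

definition U_functions :: "('u \<Rightarrow> 'k) set" where
  "U_functions = {\<mu>. (\<lambda>w. \<mu> (fst w)) \<in> Pol 0}"

text \<open>A monomial in the coordinates of the copies of V with a polynomial on U as coefficient.
  U is not expanded in coordinates, as GL(m) fixes it and its degree is not counted.\<close>

definition mon :: "nat \<Rightarrow> ('u \<Rightarrow> 'k) \<Rightarrow> (nat \<times> 'v \<Rightarrow> nat) \<Rightarrow> 'u \<times> (nat \<Rightarrow> 'v) \<Rightarrow> 'k" where
  "mon m \<mu> c = (\<lambda>w. \<mu> (fst w) * (\<Prod>i<m. \<Prod>b\<in>B. coord (snd w i) b ^ c (i, b)))"

definition mons :: "nat \<Rightarrow> nat \<Rightarrow> ('u \<times> (nat \<Rightarrow> 'v) \<Rightarrow> 'k) set" where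
  "mons m d = {mon m \<mu> c | \<mu> c. \<mu> \<in> U_functions \<and> {e. c e \<noteq> 0} \<subseteq> {..<m} \<times> B \<and> (\<Sum>i<m. row_sum B c i) = d}"

lemma U_functions_mult: "\<mu> \<in> U_functions \<Longrightarrow> \<nu> \<in> U_functions \<Longrightarrow> (\<lambda>u. \<mu> u * \<nu> u) \<in> U_functions"
  unfolding U_functions_def polynomial_functions_def
  using algebra_generated.mult by (fastforce simp: times_fun_def)

lemma U_functions_const: "(\<lambda>_. c) \<in> U_functions"
  by (simp add: U_functions_def polynomial_functions_def algebra_generated.const)

lemma mon_Pol:
  assumes "\<mu> \<in> U_functions" and supp: "{e. c e \<noteq> 0} \<subseteq> {..<n} \<times> B" and "n \<le> m"
  shows "mon m \<mu> c \<in> Pol n"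
proof -
  have "(\<lambda>w. \<mu> (fst w)) \<in> Pol n"
    using assms(1) Pol_mono[of 0 n] by (auto simp: U_functions_def)
  moreover have "(\<lambda>w. coord (snd w i) b ^ c (i, b)) \<in> Pol n" if "b \<in> B" for i b
  proof (cases "i < n")
    case True
    have "(\<Prod>k<c (i, b). (\<lambda>w. coord (snd w i) b)) \<in> Pol n"
      unfolding polynomial_functions_def
      by (intro algebra_generated_prod algebra_generated.incl coord_Lin True)
    also have "(\<Prod>k<r. (\<lambda>w. coord (snd w i) b)) = (\<lambda>w :: 'u \<times> (nat \<Rightarrow> 'v). coord (snd w i) b ^ r)" for r :: nat
      by (induction r) (simp_all add: fun_eq_iff)
    finally show ?thesis .
  next
    case False
    then have "c (i, b) = 0" using supp by auto
    then show ?thesis using algebra_generated.const[of 1] by (simp add: polynomial_functions_def)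
  qed
  then have "(\<Prod>i<m. \<Prod>b\<in>B. (\<lambda>w. coord (snd w i) b ^ c (i, b))) \<in> Pol n"
    unfolding polynomial_functions_def by (intro algebra_generated_prod) auto
  ultimately have "(\<lambda>w. \<mu> (fst w)) * (\<Prod>i<m. \<Prod>b\<in>B. (\<lambda>w. coord (snd w i) b ^ c (i, b))) \<in> Pol n"
    unfolding polynomial_functions_def by (intro algebra_generated.mult)
  also have "(\<lambda>w. \<mu> (fst w)) * (\<Prod>i<m. \<Prod>b\<in>B. (\<lambda>w. coord (snd w i) b ^ c (i, b))) = mon m \<mu> c"
    by (simp add: fun_eq_iff mon_def prod_fun_apply)
  finally show ?thesis .
qed

lemma mon_mult: "mon m \<mu> c * mon m \<nu> d = mon m (\<lambda>u. \<mu> u * \<nu> u) (\<lambda>e. c e + d e)"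
  by (simp add: mon_def fun_eq_iff power_add prod.distrib)

lemma mons_mult: "f \<in> mons m d \<Longrightarrow> h \<in> mons m e \<Longrightarrow> f * h \<in> mons m (d + e)"
proof -
  assume "f \<in> mons m d" "h \<in> mons m e"
  then obtain \<mu> c \<nu> c' where *: "f = mon m \<mu> c" "\<mu> \<in> U_functions" "{e. c e \<noteq> 0} \<subseteq> {..<m} \<times> B" "(\<Sum>i<m. row_sum B c i) = d"
    "h = mon m \<nu> c'" "\<nu> \<in> U_functions" "{e. c' e \<noteq> 0} \<subseteq> {..<m} \<times> B" "(\<Sum>i<m. row_sum B c' i) = e"
    unfolding mons_def by blast
  have "(\<Sum>i<m. row_sum B (\<lambda>e. c e + c' e) i) = d + e" using *(4,8) by (simp add: row_sum_def sum.distrib)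
  moreover have "{e. c e + c' e \<noteq> 0} \<subseteq> {..<m} \<times> B" using *(3,7) by auto
  ultimately show ?thesis unfolding mons_def *(1,5) mon_mult using U_functions_mult[OF *(2,6)] by blast
qed

lemma span_mons_mult:
  assumes "f \<in> funs.span (mons m d)" "h \<in> funs.span (mons m e)"
  shows "f * h \<in> funs.span (mons m (d + e))"
  using assms(1)
proof (induction rule: funs.span_induct_alt)
  case base
  have "0 * h = 0" by (simp add: fun_eq_iff)
  then show ?case by (simp only: funs.span_zero)
next
  case (step c x y)
  have "x * h \<in> funs.span (mons m (d + e))" using assms(2)
  proof (induction rule: funs.span_induct_alt)
    case base
    have "x * 0 = 0" by (simp add: fun_eq_iff)
    then show ?case by (simp only: funs.span_zero)
  next
    case (step c' z y')
    have "x * ((\<lambda>w. c' * z w) + y') = (\<lambda>w. c' * (x * z) w) + x * y'" by (simp add: fun_eq_iff algebra_simps)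
    then show ?case
      using funs.span_add[OF funs.span_scale[OF funs.span_base[OF mons_mult[OF \<open>x \<in> mons m d\<close> step(1)]], of c'] step(2)]
      by (simp only:)
  qed
  moreover have "((\<lambda>w. c * x w) + y) * h = (\<lambda>w. c * (x * h) w) + y * h" by (simp add: fun_eq_iff algebra_simps)
  ultimately show ?case using funs.span_add[OF funs.span_scale[of "x * h" _ c] step(2)] by (simp only:)
qed

lemma span_mons_homogeneous: "funs.span (mons m d) \<subseteq> homogeneous_functions rescale d"
proof
  fix f assume "f \<in> funs.span (mons m d)"
  then show "f \<in> homogeneous_functions rescale d"
  proof (induction rule: funs.span_induct_alt)
    case base
    show ?case by (simp add: homogeneous_functions_def)
  next
    case (step a x y)
    then obtain \<mu> c where x: "x = mon m \<mu> c" "(\<Sum>i<m. row_sum B c i) = d" unfolding mons_def by blast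
    have "x (rescale t w) = t ^ d * x w" for t w
    proof -
      have "x (rescale t w) = \<mu> (fst w) * (\<Prod>i<m. \<Prod>b\<in>B. t ^ c (i, b) * coord (snd w i) b ^ c (i, b))"
        by (simp add: x mon_def rescale_def coord_scale power_mult_distrib case_prod_beta)
      also have "\<dots> = t ^ d * x w"
        by (simp add: x(1) x(2)[symmetric] mon_def prod.distrib power_sum row_sum_def)
      finally show ?thesis .
    qed
    then show ?case using step(2) by (simp add: homogeneous_functions_def algebra_simps)
  qed
qed

lemma Pol_graded: "f \<in> Pol m \<Longrightarrow> f \<in> graded_sums (\<lambda>d. funs.span (mons m d))"
  unfolding polynomial_functions_def
proof (rule algebra_generated_graded)
  show "0 \<in> funs.span (mons m d)" for d by (rule funs.span_zero)
  show "x + y \<in> funs.span (mons m d)" if "x \<in> funs.span (mons m d)" "y \<in> funs.span (mons m d)" for d x y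
    using that by (rule funs.span_add)
  have U0: "(\<lambda>w. \<mu> (fst w)) \<in> funs.span (mons m 0)" if "\<mu> \<in> U_functions" for \<mu>
  proof (rule funs.span_base)
    have "mon m \<mu> (\<lambda>_. 0) = (\<lambda>w. \<mu> (fst w))" by (simp add: mon_def)
    then show "(\<lambda>w. \<mu> (fst w)) \<in> mons m 0"
      unfolding mons_def using that by (intro CollectI exI[of _ \<mu>] exI[of _ "\<lambda>_. 0"]) (simp add: row_sum_def)
  qed
  show "(\<lambda>_. c) \<in> funs.span (mons m 0)" for c using U0[OF U_functions_const] .
  show "x * y \<in> funs.span (mons m (d + e))" if "x \<in> funs.span (mons m d)" "y \<in> funs.span (mons m e)" for d e x y
    using that by (rule span_mons_mult)
  show "linear_functionals sU sV m \<subseteq> graded_sums (\<lambda>d. funs.span (mons m d))"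
  proof
    fix l assume l: "l \<in> Lin m"
    have "(\<lambda>w. coord (snd w i) b) \<in> mons m 1" if i: "i < m" and b: "b \<in> B" for i b
    proof -
      let ?c = "\<lambda>e. if e = (i, b) then 1 else 0 :: nat"
      have "(\<Prod>b'\<in>B. x b' ^ ?c (i', b')) = (if i' = i then x b else 1)" for i' and x :: "'v \<Rightarrow> 'k"
      proof -
        have "(\<Prod>b'\<in>B. x b' ^ ?c (i', b')) = (\<Prod>b'\<in>B. if b' = b then if i' = i then x b else 1 else 1)"
          by (intro prod.cong) auto
        then show ?thesis using V.finite_Basis b by simp
      qed
      then have eq: "mon m (\<lambda>_. 1) ?c = (\<lambda>w. coord (snd w i) b)"
        using i by (simp add: mon_def fun_eq_iff)
      have "row_sum B ?c i' = (if i' = i then 1 else 0)" for i'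
      proof -
        have "row_sum B ?c i' = (\<Sum>b'\<in>B. if b' = b then if i' = i then 1 else 0 else 0)"
          unfolding row_sum_def by (intro sum.cong) auto
        then show ?thesis using V.finite_Basis b by simp
      qed
      then have tot: "(\<Sum>i'<m. row_sum B ?c i') = 1" using i by simp
      have supp: "{e. ?c e \<noteq> 0} \<subseteq> {..<m} \<times> B" using i b by auto
      show ?thesis unfolding mons_def
        by (rule CollectI, rule exI[of _ "\<lambda>_. 1"], rule exI[of _ ?c], intro conjI,
            rule eq[symmetric], rule U_functions_const, rule supp, rule tot)
    qed
    note m1 = this
    have "(\<lambda>w. l (0, snd w)) = (\<Sum>i<m. \<Sum>b\<in>B. (\<lambda>w. l (0, \<lambda>j. if j = i then b else 0) * coord (snd w i) b))"
      by (simp add: fun_eq_iff sum_fun_apply Lin_V_coord[OF l, of "snd _"] mult.commute)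
    also have "\<dots> \<in> funs.span (mons m 1)"
      by (intro funs.span_sum funs.span_scale funs.span_base m1) auto
    finally have l1: "(\<lambda>w. l (0, snd w)) \<in> funs.span (mons m 1)" .
    have "(\<lambda>u. l (u, 0)) \<in> U_functions"
      unfolding U_functions_def polynomial_functions_def using Lin_U[OF l] by (auto intro: algebra_generated.incl)
    from U0[OF this] have l0: "(\<lambda>w. l (fst w, 0)) \<in> funs.span (mons m 0)" .
    show "l \<in> graded_sums (\<lambda>d. funs.span (mons m d))"
      by (subst Lin_split[OF l], rule graded_sums_add)
        (use l0 l1 in \<open>auto intro: funs.span_zero funs.span_add graded_sums_incl[of "\<lambda>d. funs.span (mons m d)"]\<close>)
  qed
qed

text \<open>Homogeneity is a condition on values. Uniqueness of components over an infinite field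
  identifies the decomposition into monomials with the one whose only component is f.\<close>

lemma homogeneous_Pol_span_mons:
  assumes f: "f \<in> Pol m" "f \<in> homogeneous_functions rescale d"
  shows "f \<in> funs.span (mons m d)"
proof -
  obtain D F where F: "f = (\<Sum>e\<le>D. F e)" "\<And>e. F e \<in> funs.span (mons m e)"
    using Pol_graded[OF f(1)] by (auto simp: graded_sums_def)
  define F1 where "F1 e = (if e \<le> D then F e else 0)" for e
  define F2 where "F2 e = (if e = d then f else 0)" for e
  have F1: "F1 e \<in> funs.span (mons m e)" for e using F(2) by (simp add: F1_def funs.span_zero)
  have "(\<Sum>e\<le>max D d. F1 e) = f"
    unfolding F(1) F1_def by (rule sum.mono_neutral_cong_left[symmetric]) auto
  also have "f = (\<Sum>e\<le>max D d. F2 e)" by (simp add: F2_def)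
  finally have eq: "(\<Sum>e\<le>max D d. F1 e) = (\<Sum>e\<le>max D d. F2 e)" .
  have "F1 d = F2 d"
  proof (rule homogeneous_unique[OF inf _ _ eq])
    show "F1 e \<in> homogeneous_functions rescale e" for e
      using F1 span_mons_homogeneous by blast
    show "F2 e \<in> homogeneous_functions rescale e" for e
    proof (cases "e = d")
      case False
      then show ?thesis by (simp add: F2_def homogeneous_functions_def)
    qed (simp add: F2_def f(2))
  qed simp
  then show ?thesis using F1[of d] by (simp add: F2_def)
qed

end

section \<open>GL(m)-translates of polynomials in n copies\<close>

lemma extend_injection_to_permutation:
  assumes "R \<subseteq> {..<m}" "card R \<le> n" "n \<le> m"
  obtains \<pi> :: "nat \<Rightarrow> nat" where "bij_betw \<pi> {..<m} {..<m}" "\<pi> ` R \<subseteq> {..<n}"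
proof -
  have fin: "finite R" using assms(1) finite_subset by blast
  obtain f where f: "bij_betw f R {..<card R}" using bij_betw_iff_card[OF fin, of "{..<card R}"] by auto
  have "card ({..<m} - R) = card ({..<m} - {..<card R})"
    using assms fin by (simp add: card_Diff_subset)
  then obtain g where g: "bij_betw g ({..<m} - R) ({..<m} - {..<card R})"
    using finite_same_card_bij[of "{..<m} - R" "{..<m} - {..<card R}"] by auto
  define \<pi> where "\<pi> i = (if i \<in> R then f i else g i)" for i
  have "bij_betw \<pi> R {..<card R}" using f by (rule bij_betw_cong[THEN iffD1, rotated]) (simp add: \<pi>_def)
  moreover have "bij_betw \<pi> ({..<m} - R) ({..<m} - {..<card R})"
    using g by (rule bij_betw_cong[THEN iffD1, rotated]) (simp add: \<pi>_def)
  ultimately have "bij_betw \<pi> (R \<union> ({..<m} - R)) ({..<card R} \<union> ({..<m} - {..<card R}))"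
    by (rule bij_betw_combine) auto
  moreover have "R \<union> ({..<m} - R) = {..<m}" "{..<card R} \<union> ({..<m} - {..<card R}) = {..<m}"
    using assms by auto
  moreover have "\<pi> ` R \<subseteq> {..<n}" using \<open>bij_betw \<pi> R {..<card R}\<close> assms(2) by (auto simp: bij_betw_def)
  ultimately show thesis using that by simp
qed

text \<open>The linear coefficient is the derivative at 0, and the product rule yields one
  polarization term for each basis vector.\<close>

lemma coeff_one_prod_linear:
  fixes x y :: "'b \<Rightarrow> 'k::field"
  assumes "finite B"
  shows "Polynomial.coeff (\<Prod>b\<in>B. [:x b, y b:] ^ c b) 1 =
    (\<Sum>b\<in>B. of_nat (c b) * (y b * x b ^ (c b - 1) * (\<Prod>b'\<in>B - {b}. x b' ^ c b')))"
proof -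
  have "Polynomial.coeff (\<Prod>b\<in>B. [:x b, y b:] ^ c b) 1 = poly (Polynomial.pderiv (\<Prod>b\<in>B. [:x b, y b:] ^ c b)) 0"
    by (simp add: poly_0_coeff_0 coeff_pderiv)
  also have "\<dots> = (\<Sum>b\<in>B. of_nat (c b) * (y b * x b ^ (c b - 1) * (\<Prod>b'\<in>B - {b}. x b' ^ c b')))"
    by (simp add: pderiv_prod pderiv_power poly_sum poly_prod pderiv_pCons mult_ac)
  finally show ?thesis .
qed

lemma mat_mult_index:
  assumes "a \<in> carrier_mat m m" "b \<in> carrier_mat m m" "i < m" "j < m"
  shows "(a * b) $$ (i, j) = (\<Sum>k<m. a $$ (i, k) * b $$ (k, j))"
  using assms by (auto simp: scalar_prod_def lessThan_atLeast0)

context vector_copies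
begin

text \<open>Translation by a instead of its inverse gives the same span, as a runs through a
  group.\<close>

definition GL_span :: "nat \<Rightarrow> nat \<Rightarrow> ('u \<times> (nat \<Rightarrow> 'v) \<Rightarrow> 'k) set" where
  "GL_span n m = funs.span {\<lambda>w. h (GL_action sV m a w) | a h. a \<in> carrier (GL m) \<and> h \<in> Pol n}"

lemma GL_span_precompose:
  assumes f: "f \<in> GL_span n m" and a: "a \<in> carrier (GL m)"
  shows "(\<lambda>w. f (GL_action sV m a w)) \<in> GL_span n m"
  using f unfolding GL_span_def
proof (induction rule: funs.span_induct_alt)
  case base
  show ?case using funs.span_zero by (simp add: zero_fun_def)
next
  case (step c x y)
  then obtain b h where x: "x = (\<lambda>w. h (GL_action sV m b w))" "b \<in> carrier (GL m)" "h \<in> Pol n" by blast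
  interpret GLm: group "GL m :: 'k mat monoid" by (rule GL_group)
  have "b * a \<in> carrier (GL m)" using GLm.m_closed[OF x(2) a] by (simp add: GL_mult)
  moreover have "(\<lambda>w. x (GL_action sV m a w)) = (\<lambda>w. h (GL_action sV m (b * a) w))"
    using GL_carrier_mat[OF x(2)] GL_carrier_mat[OF a] by (simp add: x(1) GL_action_mult)
  ultimately have "(\<lambda>w. x (GL_action sV m a w)) \<in> {\<lambda>w. h (GL_action sV m a w) | a h. a \<in> carrier (GL m) \<and> h \<in> Pol n}"
    using x(3) by blast
  from funs.span_add[OF funs.span_scale[OF funs.span_base[OF this], of c] step(2)]
  show ?case by (simp add: plus_fun_def)
qed

text \<open>A permutation matrix carries the copies in R to copies among the first n; the exponent d
  is c transported along \<pi>.\<close>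

lemma few_rows_GL_span:
  assumes R: "R \<subseteq> {..<m}" "card R \<le> n" and "n \<le> m" and supp: "{e. c e \<noteq> 0} \<subseteq> R \<times> B"
    and \<mu>: "\<mu> \<in> U_functions"
  shows "mon m \<mu> c \<in> GL_span n m"
proof -
  obtain \<pi> where \<pi>: "bij_betw \<pi> {..<m} {..<m}" "\<pi> ` R \<subseteq> {..<n}"
    using extend_injection_to_permutation[OF R \<open>n \<le> m\<close>] .
  have \<pi>m: "\<pi> i < m" if "i < m" for i using \<pi>(1) that by (auto simp: bij_betw_def)
  have \<pi>inj: "\<pi> i = \<pi> j \<longleftrightarrow> i = j" if "i < m" "j < m" for i j
    using \<pi>(1) that by (auto simp: bij_betw_def inj_on_def)
  define a :: "'k mat" where "a = mat m m (\<lambda>(i, j). if i = \<pi> j then 1 else 0)"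
  define b :: "'k mat" where "b = mat m m (\<lambda>(i, j). if j = \<pi> i then 1 else 0)"
  have ab: "a \<in> carrier_mat m m" "b \<in> carrier_mat m m" by (simp_all add: a_def b_def)
  have "b * a = 1\<^sub>m m"
  proof (rule eq_matI)
    fix i j assume "i < dim_row (1\<^sub>m m :: 'k mat)" "j < dim_col (1\<^sub>m m :: 'k mat)"
    then have ij: "i < m" "j < m" by auto
    have "(b * a) $$ (i, j) = (\<Sum>k<m. if k = \<pi> i then if \<pi> i = \<pi> j then 1 else 0 else 0)"
      unfolding mat_mult_index[OF ab(2,1) ij] using ij by (intro sum.cong) (auto simp: a_def b_def)
    then show "(b * a) $$ (i, j) = 1\<^sub>m m $$ (i, j)" using ij \<pi>m \<pi>inj by simp
  qed (use ab in auto)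
  moreover have "a * b = 1\<^sub>m m"
  proof (rule eq_matI)
    fix i j assume "i < dim_row (1\<^sub>m m :: 'k mat)" "j < dim_col (1\<^sub>m m :: 'k mat)"
    then have ij: "i < m" "j < m" by auto
    have "(a * b) $$ (i, j) = (\<Sum>k<m. if i = \<pi> k \<and> j = \<pi> k then 1 else 0)"
      unfolding mat_mult_index[OF ab ij] using ij by (intro sum.cong) (auto simp: a_def b_def)
    also have "\<dots> = (\<Sum>k<m. if i = k \<and> j = k then 1 else 0)"
      by (rule sum.reindex_bij_betw[OF \<pi>(1)])
    also have "\<dots> = (\<Sum>k<m. if k = i then if i = j then 1 else 0 else 0)"
      by (intro sum.cong) auto
    finally show "(a * b) $$ (i, j) = 1\<^sub>m m $$ (i, j)" using ij by simp
  qed (use ab in auto)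
  ultimately have aGL: "a \<in> carrier (GL m)" using ab by (intro GL_carrierI)
  have act: "snd (GL_action sV m a w) (\<pi> i) = snd w i" if i: "i < m" for w :: "'u \<times> (nat \<Rightarrow> 'v)" and i
  proof -
    have "snd (GL_action sV m a w) (\<pi> i) = (\<Sum>j<m. sV (a $$ (\<pi> i, j)) (snd w j))"
      using \<pi>m[OF i] by (simp add: GL_action_def case_prod_beta)
    also have "\<dots> = (\<Sum>j<m. if j = i then snd w j else 0)"
      using \<pi>m[OF i] \<pi>inj i by (intro sum.cong) (auto simp: a_def)
    finally show ?thesis using i by simp
  qed
  define d where "d = (\<lambda>(i, b). if i < m then c (inv_into {..<m} \<pi> i, b) else 0)"
  have d: "d (\<pi> i, b) = c (i, b)" if "i < m" for i b
    using that \<pi>(1) \<pi>m by (simp add: d_def bij_betw_inv_into_left)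
  have "{e. d e \<noteq> 0} \<subseteq> {..<n} \<times> B"
  proof clarify
    fix i b assume nz: "d (i, b) > 0"
    then have "i < m" by (auto simp: d_def split: if_splits)
    then obtain k where k: "k < m" "i = \<pi> k" using \<pi>(1) by (auto simp: bij_betw_def image_iff)
    then have "c (k, b) \<noteq> 0" using nz d[of k b] by simp
    then have "k \<in> R" "b \<in> B" using supp by auto
    then show "i \<in> {..<n} \<and> b \<in> B" using \<pi>(2) k by auto
  qed
  then have "mon m \<mu> d \<in> Pol n" using \<mu> \<open>n \<le> m\<close> by (intro mon_Pol)
  moreover have "mon m \<mu> c = (\<lambda>w. mon m \<mu> d (GL_action sV m a w))"
  proof
    fix w :: "'u \<times> (nat \<Rightarrow> 'v)"
    have "(\<Prod>i<m. \<Prod>b\<in>B. coord (snd (GL_action sV m a w) i) b ^ d (i, b)) =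
        (\<Prod>i<m. \<Prod>b\<in>B. coord (snd (GL_action sV m a w) (\<pi> i)) b ^ d (\<pi> i, b))"
      by (rule prod.reindex_bij_betw[OF \<pi>(1), symmetric])
    also have "\<dots> = (\<Prod>i<m. \<Prod>b\<in>B. coord (snd w i) b ^ c (i, b))"
      by (intro prod.cong refl) (simp_all add: act d)
    finally show "mon m \<mu> c w = mon m \<mu> d (GL_action sV m a w)"
      by (simp add: mon_def GL_action_def case_prod_beta)
  qed
  ultimately show ?thesis unfolding GL_span_def using aGL by (intro funs.span_base) blast
qed

text \<open>The transvection \<open>a t\<close> replaces copy j by itself plus t times copy i, and
  the coefficient of t in the translated monomial is its polarization. A functional vanishing on the
  span vanishes on the translates for all t, hence on each coefficient.\<close>

lemma move_GL_span:
  assumes mem: "mon m \<mu> c \<in> GL_span n m" and ij: "i < m" "j < m" "i \<noteq> j"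
  shows "(\<Sum>b\<in>B. (\<lambda>w. of_nat (c (j, b)) * mon m \<mu> (c((j, b) := c (j, b) - 1, (i, b) := Suc (c (i, b)))) w)) \<in> GL_span n m"
    (is "?D \<in> _")
proof (rule ccontr)
  assume nin: "?D \<notin> GL_span n m"
  have sub: "funs.subspace (GL_span n m)" unfolding GL_span_def by (rule funs.subspace_span)
  obtain f where f: "Vector_Spaces.linear (\<lambda>c f w. c * f w) (*) f"
    "\<And>y. y \<in> GL_span n m \<Longrightarrow> f y = 0" "f ?D = 1"
    by (rule funs.separating_functional[OF sub nin]) (rule that)
  interpret f: Vector_Spaces.linear "\<lambda>c f w. c * f w" "(*)" f by (rule f(1))
  define a :: "'k \<Rightarrow> 'k mat" where
    "a t = mat m m (\<lambda>(k, l). if k = l then 1 else if k = j \<and> l = i then t else 0)" for t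
  have a: "a t \<in> carrier_mat m m" for t by (simp add: a_def)
  have prod: "a s * a t = a (s + t)" for s t
  proof (rule eq_matI)
    fix k l assume "k < dim_row (a (s + t))" "l < dim_col (a (s + t))"
    then have kl: "k < m" "l < m" by (auto simp: a_def)
    have "(a s * a t) $$ (k, l) = (\<Sum>x<m. a s $$ (k, x) * a t $$ (x, l))"
      by (rule mat_mult_index[OF a a kl])
    also have "\<dots> = (\<Sum>x<m. (if x = k then a t $$ (k, l) else 0) + (if x = i then if k = j \<and> l = i then s else 0 else 0))"
      using kl ij by (intro sum.cong) (auto simp: a_def)
    also have "\<dots> = a (s + t) $$ (k, l)"
      using kl ij by (auto simp: sum.distrib a_def)
    finally show "(a s * a t) $$ (k, l) = a (s + t) $$ (k, l)" .
  qed (simp_all add: a_def)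
  have "a 0 = 1\<^sub>m m" by (rule eq_matI) (auto simp: a_def)
  then have aGL: "a t \<in> carrier (GL m)" for t
    using prod[of t "- t"] prod[of "- t" t] by (intro GL_carrierI[OF a a]) simp_all
  have act: "snd (GL_action sV m (a t) w) k = (if k = j then snd w j + sV t (snd w i) else snd w k)"
    if k: "k < m" for t and w :: "'u \<times> (nat \<Rightarrow> 'v)" and k
  proof -
    have "snd (GL_action sV m (a t) w) k = (\<Sum>x<m. sV (a t $$ (k, x)) (snd w x))"
      using k by (simp add: GL_action_def case_prod_beta)
    also have "\<dots> = (\<Sum>x<m. (if x = k then snd w x else 0) + (if x = i then if k = j then sV t (snd w x) else 0 else 0))"
      using k ij by (intro sum.cong) (auto simp: a_def)
    finally show ?thesis using k ij by (simp add: sum.distrib)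
  qed
  define rest where "rest w = \<mu> (fst w) * (\<Prod>k\<in>{..<m} - {j}. \<Prod>b\<in>B. coord (snd w k) b ^ c (k, b))" for w :: "'u \<times> (nat \<Rightarrow> 'v)"
  define r where "r w = (\<Prod>b\<in>B. [:coord (snd w j) b, coord (snd w i) b:] ^ c (j, b))" for w :: "'u \<times> (nat \<Rightarrow> 'v)"
  \<comment> \<open>One more than the degree in row j, so that the coefficient of index 1 is in
    range even when row j is empty.\<close>
  define K where "K = Suc (\<Sum>b\<in>B. c (j, b))"
  define F where "F k = (\<lambda>w. rest w * Polynomial.coeff (r w) k)" for k
  have deg: "Polynomial.degree (r w) \<le> K" for w
  proof -
    have "Polynomial.degree (r w) \<le> (\<Sum>b\<in>B. Polynomial.degree ([:coord (snd w j) b, coord (snd w i) b:] ^ c (j, b)))"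
      unfolding r_def by (rule degree_prod_sum_le[OF V.finite_Basis, unfolded comp_def])
    also have "\<dots> \<le> (\<Sum>b\<in>B. c (j, b))"
    proof (rule sum_mono)
      fix b
      have "Polynomial.degree ([:coord (snd w j) b, coord (snd w i) b:] ^ c (j, b)) \<le>
          Polynomial.degree [:coord (snd w j) b, coord (snd w i) b:] * c (j, b)"
        by (rule degree_power_le)
      also have "\<dots> \<le> 1 * c (j, b)" by (intro mult_right_mono) auto
      finally show "Polynomial.degree ([:coord (snd w j) b, coord (snd w i) b:] ^ c (j, b)) \<le> c (j, b)" by simp
    qed
    finally show ?thesis by (simp add: K_def)
  qed
  have split: "mon m \<mu> d w = \<mu> (fst w) * (\<Prod>k\<in>{..<m} - {j}. \<Prod>b\<in>B. coord (snd w k) b ^ d (k, b)) * (\<Prod>b\<in>B. coord (snd w j) b ^ d (j, b))" for d w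
  proof -
    let ?g = "\<lambda>k. \<Prod>b\<in>B. coord (snd w k) b ^ d (k, b)"
    have "(\<Prod>k<m. ?g k) = ?g j * (\<Prod>k\<in>{..<m} - {j}. ?g k)" by (rule prod.remove) (use ij in auto)
    then show ?thesis unfolding mon_def by (simp only: mult.assoc mult.commute[of "?g j"])
  qed
  have expand: "mon m \<mu> c (GL_action sV m (a t) w) = (\<Sum>k\<le>K. t ^ k * F k w)" for t w
  proof -
    have "(\<Prod>k\<in>{..<m} - {j}. \<Prod>b\<in>B. coord (snd (GL_action sV m (a t) w) k) b ^ c (k, b)) =
        (\<Prod>k\<in>{..<m} - {j}. \<Prod>b\<in>B. coord (snd w k) b ^ c (k, b))"
      by (intro prod.cong) (auto simp: act)
    moreover have "(\<Prod>b\<in>B. coord (snd (GL_action sV m (a t) w) j) b ^ c (j, b)) = poly (r w) t"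
      using ij by (simp add: act r_def poly_prod coord_add coord_scale)
    ultimately have "mon m \<mu> c (GL_action sV m (a t) w) = rest w * poly (r w) t"
      unfolding split rest_def by (simp add: GL_action_def case_prod_beta)
    also have "poly (r w) t = (\<Sum>k\<le>K. Polynomial.coeff (r w) k * t ^ k)"
      unfolding poly_altdef using deg[of w]
      by (intro sum.mono_neutral_left) (auto simp: not_le intro: Polynomial.coeff_eq_0)
    finally show ?thesis by (simp only: F_def sum_distrib_left mult_ac)
  qed
  have "(\<Sum>k\<le>K. t ^ k * f (F k)) = 0" for t
  proof -
    have "(\<lambda>w. mon m \<mu> c (GL_action sV m (a t) w)) \<in> GL_span n m"
      by (rule GL_span_precompose[OF mem aGL])
    then have "0 = f (\<lambda>w. mon m \<mu> c (GL_action sV m (a t) w))" using f(2) by simp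
    also have "(\<lambda>w. mon m \<mu> c (GL_action sV m (a t) w)) = (\<Sum>k\<le>K. (\<lambda>w. t ^ k * F k w))"
      by (simp add: expand fun_eq_iff sum_fun_apply)
    also have "f \<dots> = (\<Sum>k\<le>K. t ^ k * f (F k))" by (simp only: f.sum f.scale)
    finally show ?thesis by simp
  qed
  from vanishing_polynomial_coefficients[OF inf this, of 1] have "f (F 1) = 0" by (simp add: K_def)
  moreover have "F 1 = ?D"
  proof
    fix w :: "'u \<times> (nat \<Rightarrow> 'v)"
    have "rest w * (of_nat (c (j, b)) * (coord (snd w i) b * coord (snd w j) b ^ (c (j, b) - 1) * (\<Prod>b'\<in>B - {b}. coord (snd w j) b' ^ c (j, b')))) =
       of_nat (c (j, b)) * mon m \<mu> (c((j, b) := c (j, b) - 1, (i, b) := Suc (c (i, b)))) w" if b: "b \<in> B" for b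
    proof -
      let ?c = "c((j, b) := c (j, b) - 1, (i, b) := Suc (c (i, b)))"
      have iM: "i \<in> {..<m} - {j}" using ij by auto
      have "(\<Prod>b'\<in>B. coord (snd w i) b' ^ ?c (i, b')) = coord (snd w i) b * (\<Prod>b'\<in>B. coord (snd w i) b' ^ c (i, b'))"
      proof -
        have "(\<Prod>b'\<in>B - {b}. coord (snd w i) b' ^ ?c (i, b')) = (\<Prod>b'\<in>B - {b}. coord (snd w i) b' ^ c (i, b'))"
          using ij by (intro prod.cong) auto
        then show ?thesis
          using prod.remove[OF V.finite_Basis b, of "\<lambda>b'. coord (snd w i) b' ^ ?c (i, b')"]
            prod.remove[OF V.finite_Basis b, of "\<lambda>b'. coord (snd w i) b' ^ c (i, b')"] by simp
      qed
      moreover have "(\<Prod>k\<in>{..<m} - {j} - {i}. \<Prod>b'\<in>B. coord (snd w k) b' ^ ?c (k, b')) =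
          (\<Prod>k\<in>{..<m} - {j} - {i}. \<Prod>b'\<in>B. coord (snd w k) b' ^ c (k, b'))"
        by (intro prod.cong) auto
      ultimately have "(\<Prod>k\<in>{..<m} - {j}. \<Prod>b'\<in>B. coord (snd w k) b' ^ ?c (k, b')) =
          coord (snd w i) b * (\<Prod>k\<in>{..<m} - {j}. \<Prod>b'\<in>B. coord (snd w k) b' ^ c (k, b'))"
        using prod.remove[OF _ iM, of "\<lambda>k. \<Prod>b'\<in>B. coord (snd w k) b' ^ ?c (k, b')"]
          prod.remove[OF _ iM, of "\<lambda>k. \<Prod>b'\<in>B. coord (snd w k) b' ^ c (k, b')"] by simp
      moreover have "(\<Prod>b'\<in>B. coord (snd w j) b' ^ ?c (j, b')) =
          coord (snd w j) b ^ (c (j, b) - 1) * (\<Prod>b'\<in>B - {b}. coord (snd w j) b' ^ c (j, b'))"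
      proof -
        have "(\<Prod>b'\<in>B - {b}. coord (snd w j) b' ^ ?c (j, b')) = (\<Prod>b'\<in>B - {b}. coord (snd w j) b' ^ c (j, b'))"
          using ij by (intro prod.cong) auto
        then show ?thesis
          using prod.remove[OF V.finite_Basis b, of "\<lambda>b'. coord (snd w j) b' ^ ?c (j, b')"] ij by simp
      qed
      ultimately show ?thesis unfolding split rest_def by (simp only: mult_ac)
    qed
    then show "F 1 w = ?D w"
      unfolding F_def r_def coeff_one_prod_linear[OF V.finite_Basis] sum_fun_apply sum_distrib_left
      by (intro sum.cong refl)
  qed
  ultimately show False using f(3) by simp
qed

lemma mons_GL_span:
  assumes "card B \<le> n" "n \<le> m" and q: "\<And>k. 0 < k \<Longrightarrow> k \<le> q \<Longrightarrow> of_nat k \<noteq> (0::'k)"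
    and d: "d \<le> n * q"
  shows "mons m d \<subseteq> GL_span n m"
proof
  fix f assume "f \<in> mons m d"
  then obtain \<mu> c where f: "f = mon m \<mu> c" and \<mu>: "\<mu> \<in> U_functions"
    and c: "{e. c e \<noteq> 0} \<subseteq> {..<m} \<times> B" "(\<Sum>i<m. row_sum B c i) = d" unfolding mons_def by blast
  show "f \<in> GL_span n m"
    unfolding f
  proof (rule funs.few_rows_generate[OF _ V.finite_Basis assms(1) q, where M = "{..<m}" and R = "{..<m}"])
    show "funs.subspace (GL_span n m)" unfolding GL_span_def by (rule funs.subspace_span)
    show "mon m \<mu> c \<in> GL_span n m" if "R \<subseteq> {..<m}" "card R \<le> n" "{e. c e \<noteq> 0} \<subseteq> R \<times> B" for R c
      by (rule few_rows_GL_span[OF that(1,2) assms(2) that(3) \<mu>])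
    show "(\<Sum>b\<in>B. (\<lambda>w. of_nat (c (j, b)) * mon m \<mu> (c((j, b) := c (j, b) - 1, (i, b) := Suc (c (i, b)))) w)) \<in> GL_span n m"
      if "mon m \<mu> c \<in> GL_span n m" "i \<in> {..<m}" "j \<in> {..<m}" "i \<noteq> j" for c i j
      using that by (intro move_GL_span) auto
  qed (use c d in auto)
qed

end

section \<open>Invariants and the Reynolds operator\<close>

locale group_vector_copies = vector_copies sU sV B + Group.group G
  for sU :: "'k::field \<Rightarrow> 'u::ab_group_add \<Rightarrow> 'u" and sV :: "'k \<Rightarrow> 'v::ab_group_add \<Rightarrow> 'v" and B
    and G :: "('g, 'x) monoid_scheme" (structure) +
  fixes \<rho> :: "'g \<Rightarrow> 'u \<Rightarrow> 'u" and \<sigma> :: "'g \<Rightarrow> 'v \<Rightarrow> 'v"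
  assumes fin: "finite (carrier G)"
    and rep: "representation G sU \<rho>" "representation G sV \<sigma>"
begin

abbreviation "diag \<equiv> diagonal_action \<rho> \<sigma>"
abbreviation "Inv \<equiv> invariant_polynomials G sU \<rho> sV \<sigma>"

lemma rep_linear:
  assumes "g \<in> carrier G"
  shows "\<rho> g (x + y) = \<rho> g x + \<rho> g y" "\<rho> g (sU c x) = sU c (\<rho> g x)"
    "\<sigma> g (v + w) = \<sigma> g v + \<sigma> g w" "\<sigma> g (sV c v) = sV c (\<sigma> g v)"
  using rep assms unfolding representation_def Vector_Spaces.linear_iff by blast+

lemma sigma_zero: "g \<in> carrier G \<Longrightarrow> \<sigma> g 0 = 0"
  using rep_linear(4)[of g 0 0] by simp

lemma sigma_sum: "g \<in> carrier G \<Longrightarrow> \<sigma> g (\<Sum>i\<in>I. f i) = (\<Sum>i\<in>I. \<sigma> g (f i))"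
  by (induction I rule: infinite_finite_induct) (simp_all add: sigma_zero rep_linear)

lemma diag_group:
  shows diag_one: "diag \<one> w = w"
    and diag_mult: "\<lbrakk>g \<in> carrier G; h \<in> carrier G\<rbrakk> \<Longrightarrow> diag (g \<otimes> h) w = diag g (diag h w)"
proof -
  interpret \<rho>: group_action G UNIV \<rho> using rep(1) by (simp add: representation_def)
  interpret \<sigma>: group_action G UNIV \<sigma> using rep(2) by (simp add: representation_def)
  have "\<rho> \<one> u = u" "\<sigma> \<one> v = v" for u v
    using fun_cong[OF \<rho>.id_eq_one, of u] fun_cong[OF \<sigma>.id_eq_one, of v] by simp_all
  then show "diag \<one> w = w" by (cases w) (simp add: diagonal_action_def)
  show "diag (g \<otimes> h) w = diag g (diag h w)" if "g \<in> carrier G" "h \<in> carrier G"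
    using that by (cases w) (simp add: diagonal_action_def \<rho>.composition_rule \<sigma>.composition_rule)
qed

lemma diag_linear:
  assumes "g \<in> carrier G"
  shows "diag g (x + y) = diag g x + diag g y"
    "diag g (scale_sum sU sV c x) = scale_sum sU sV c (diag g x)"
  using assms
  by (cases x; cases y; simp add: diagonal_action_def scale_sum_def fun_eq_iff rep_linear)+

lemma diag_GL: "g \<in> carrier G \<Longrightarrow> diag g (GL_action sV m a w) = GL_action sV m a (diag g w)"
  by (cases w) (auto simp: diagonal_action_def GL_action_def fun_eq_iff rep_linear sigma_sum)

lemma diag_rescale: "g \<in> carrier G \<Longrightarrow> diag g (rescale t w) = rescale t (diag g w)"
  by (cases w) (simp add: diagonal_action_def rescale_def rep_linear)

lemma diag_Lin: "g \<in> carrier G \<Longrightarrow> l \<in> Lin m \<Longrightarrow> (\<lambda>w. l (diag g w)) \<in> Lin m"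
  unfolding Lin_iff diag_linear LinD(1,2)
  by (auto simp: diag_linear diagonal_action_def intro!: arg_cong[of _ _ l])

lemma diag_Pol: "g \<in> carrier G \<Longrightarrow> f \<in> Pol m \<Longrightarrow> (\<lambda>w. f (diag g w)) \<in> Pol m"
  by (rule Pol_precompose) (auto simp: polynomial_functions_def intro: algebra_generated.incl diag_Lin)

lemma Inv_iff: "f \<in> Inv m \<longleftrightarrow> f \<in> Pol m \<and> (\<forall>g\<in>carrier G. \<forall>w. f (diag g w) = f w)"
proof -
  have "(\<forall>g\<in>carrier G. (\<lambda>w. f (diag (inv g) w)) = f) \<longleftrightarrow> (\<forall>g\<in>carrier G. \<forall>w. f (diag g w) = f w)"
  proof (intro iffI ballI allI)
    fix g w assume *: "\<forall>g\<in>carrier G. (\<lambda>w. f (diag (inv g) w)) = f" and g: "g \<in> carrier G"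
    have "(\<lambda>w. f (diag (inv (inv g)) w)) = f" using * inv_closed[OF g] by blast
    from fun_cong[OF this, of w] show "f (diag g w) = f w" using g by simp
  qed (simp add: fun_eq_iff)
  then show ?thesis by (simp add: invariant_polynomials_def function_action_def)
qed

lemma Inv_mono: "n \<le> m \<Longrightarrow> Inv n \<subseteq> Inv m"
  using Pol_mono[of n m] unfolding subset_iff Inv_iff by blast

lemma Inv_algebra: "algebra_generated (Inv m) \<subseteq> Inv m"
proof
  fix f assume "f \<in> algebra_generated (Inv m)"
  then show "f \<in> Inv m"
  proof (induction f rule: algebra_generated.induct)
    case (add f h)
    have "f + h \<in> Pol m"
      using add.IH unfolding Inv_iff polynomial_functions_def by (intro algebra_generated.add) blast+
    then have "f + h \<in> Inv m" using add.IH unfolding Inv_iff by simp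
    then show ?case unfolding plus_fun_def .
  next
    case (mult f h)
    have "f * h \<in> Pol m"
      using mult.IH unfolding Inv_iff polynomial_functions_def by (intro algebra_generated.mult) blast+
    then have "f * h \<in> Inv m" using mult.IH unfolding Inv_iff by simp
    then show ?case unfolding times_fun_def .
  qed (auto simp: Inv_iff polynomial_functions_def intro: algebra_generated.const)
qed

lemma GL_action_Inv:
  assumes "f \<in> Inv m"
  shows "(\<lambda>w. f (GL_action sV m a w)) \<in> Inv m"
proof -
  have "f (GL_action sV m a (diag g w)) = f (GL_action sV m a w)" if g: "g \<in> carrier G" for g w
    using assms g unfolding Inv_iff diag_GL[OF g, symmetric] by blast
  then show ?thesis using assms GL_action_Pol unfolding Inv_iff by blast
qed

lemma Inv_GL_submodule: "GL_submodule sU sV m (Inv m)"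
  unfolding GL_submodule_def funs.subspace_def
proof (intro conjI ballI allI)
  have Inv: "x \<in> algebra_generated (Inv m)" if "x \<in> Inv m" for x using that by (rule algebra_generated.incl)
  show "Inv m \<subseteq> Pol m" unfolding Inv_iff subset_iff by blast
  show "0 \<in> Inv m" using Inv_algebra algebra_generated_zero by blast
  show "x + y \<in> Inv m" if "x \<in> Inv m" "y \<in> Inv m" for x y
    using algebra_generated.add[OF Inv[OF that(1)] Inv[OF that(2)]] Inv_algebra by blast
  show "(\<lambda>w. c * x w) \<in> Inv m" if "x \<in> Inv m" for c x
    using algebra_generated_scale[OF Inv[OF that]] Inv_algebra by blast
  show "function_action (GL m) (GL_action sV m) a f \<in> Inv m" if "f \<in> Inv m" for a f
    unfolding function_action_def by (rule GL_action_Inv[OF that])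
qed

text \<open>Since \<open>function_action\<close> composes with the inverse, translation by a is the
  action of the inverse of a.\<close>

lemma polarization_closed:
  assumes f: "f \<in> algebra_generated (polarization sU sV m S)" and a: "a \<in> carrier (GL m)"
  shows "(\<lambda>w. f (GL_action sV m a w)) \<in> algebra_generated (polarization sU sV m S)"
  using f
proof (induction f rule: algebra_generated.induct)
  case (incl f)
  interpret GLm: group "GL m :: 'k mat monoid" by (rule GL_group)
  have "(\<lambda>w. f (GL_action sV m a w)) \<in> M" if M: "GL_submodule sU sV m M" "S \<subseteq> M" for M
  proof -
    have "f \<in> M" using incl M unfolding polarization_def hull_def by blast
    then have "function_action (GL m) (GL_action sV m) (inv\<^bsub>GL m\<^esub> a) f \<in> M"
      using M(1) GLm.inv_closed[OF a] unfolding GL_submodule_def by blast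
    then show ?thesis using a by (simp add: function_action_def)
  qed
  then show ?case by (intro algebra_generated.incl) (auto simp: polarization_def hull_def)
next
  case (add f h)
  then show ?case
    using algebra_generated.add[of "\<lambda>w. f (GL_action sV m a w)" _ "\<lambda>w. h (GL_action sV m a w)"] by (simp add: plus_fun_def)
next
  case (mult f h)
  then show ?case
    using algebra_generated.mult[of "\<lambda>w. f (GL_action sV m a w)" _ "\<lambda>w. h (GL_action sV m a w)"] by (simp add: times_fun_def)
qed (rule algebra_generated.const)

text \<open>If |G| vanishes in k, then \<open>inverse 0 = 0\<close> makes this the zero map: its
  values are still invariants, but it no longer fixes them.\<close>

definition reynolds :: "('u \<times> (nat \<Rightarrow> 'v) \<Rightarrow> 'k) \<Rightarrow> 'u \<times> (nat \<Rightarrow> 'v) \<Rightarrow> 'k" where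
  "reynolds f = (\<lambda>w. inverse (of_nat (card (carrier G))) * (\<Sum>g\<in>carrier G. f (diag g w)))"

lemma reynolds_Inv:
  assumes h: "h \<in> Pol m"
  shows "reynolds h \<in> Inv m"
proof -
  have "(\<Sum>g\<in>carrier G. (\<lambda>w. h (diag g w))) \<in> Pol m"
    using diag_Pol[OF _ h] unfolding polynomial_functions_def by (intro algebra_generated_sum)
  then have "(\<lambda>w. inverse (of_nat (card (carrier G))) * (\<Sum>g\<in>carrier G. (\<lambda>w. h (diag g w))) w) \<in> Pol m"
    unfolding polynomial_functions_def by (rule algebra_generated_scale)
  then have "reynolds h \<in> Pol m" by (simp add: reynolds_def sum_fun_apply)
  moreover have "reynolds h (diag x w) = reynolds h w" if x: "x \<in> carrier G" for x w
  proof -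
    have "(\<Sum>g\<in>carrier G. h (diag g (diag x w))) = (\<Sum>g\<in>carrier G. h (diag (g \<otimes> x) w))"
      using x by (intro sum.cong) (simp_all add: diag_mult)
    also have "\<dots> = (\<Sum>g\<in>carrier G. h (diag g w))"
      by (rule sum.reindex_bij_witness[of _ "\<lambda>g. g \<otimes> inv x" "\<lambda>g. g \<otimes> x"])
        (use x in \<open>auto simp: m_assoc\<close>)
    finally show ?thesis by (simp add: reynolds_def)
  qed
  ultimately show ?thesis by (simp add: Inv_iff)
qed

text \<open>GL(m) commutes with G, so averaging a translate of h gives the translate of the average
  of h, which is an invariant in n copies.\<close>

lemma reynolds_GL_span:
  assumes "Inv n \<subseteq> algebra_generated (polarization sU sV m S)" and f: "f \<in> GL_span n m"
  shows "reynolds f \<in> algebra_generated (polarization sU sV m S)"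
  using f unfolding GL_span_def
proof (induction rule: funs.span_induct_alt)
  case base
  have "reynolds 0 = 0" by (simp add: reynolds_def fun_eq_iff)
  then show ?case by (simp only: algebra_generated_zero)
next
  case (step c x y)
  then obtain a h where x: "x = (\<lambda>w. h (GL_action sV m a w))" "a \<in> carrier (GL m)" "h \<in> Pol n" by blast
  have "reynolds x = (\<lambda>w. reynolds h (GL_action sV m a w))"
    by (simp add: x(1) reynolds_def diag_GL fun_eq_iff)
  also have "\<dots> \<in> algebra_generated (polarization sU sV m S)"
    using reynolds_Inv[OF x(3)] assms(1) x(2) by (intro polarization_closed) blast+
  finally have "(\<lambda>w. c * reynolds x w) + reynolds y \<in> algebra_generated (polarization sU sV m S)"
    using step(2) by (intro algebra_generated.add algebra_generated_scale)
  moreover have "reynolds ((\<lambda>w. c * x w) + y) = (\<lambda>w. c * reynolds x w) + reynolds y"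
    by (simp add: reynolds_def fun_eq_iff sum.distrib sum_distrib_left algebra_simps)
  ultimately show ?case by (simp only:)
qed

lemma GL_span_Inv:
  assumes "Inv n \<subseteq> algebra_generated (polarization sU sV m S)"
    and card: "of_nat (card (carrier G)) \<noteq> (0::'k)" and f: "f \<in> GL_span n m" "f \<in> Inv m"
  shows "f \<in> algebra_generated (polarization sU sV m S)"
proof -
  have "reynolds f = f" using f(2) card by (simp add: reynolds_def Inv_iff fun_eq_iff)
  then show ?thesis using reynolds_GL_span[OF assms(1) f(1)] by simp
qed

sublocale copies: graded_function_algebra G "Lin m" rescale diag
proof
  show "infinite (UNIV :: 'k set)" by (rule inf)
  show "Lin m \<subseteq> algebra_generated (Lin m \<inter> (homogeneous_functions rescale 0 \<union> homogeneous_functions rescale 1))"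
  proof
    fix l assume l: "l \<in> Lin m"
    have "(\<lambda>w. l (fst w, 0)) \<in> Lin m" using Lin_U[OF l] Lin_mono[of 0 m] by auto
    moreover have "(\<lambda>w. l (fst w, 0)) \<in> homogeneous_functions rescale 0"
      by (auto simp: homogeneous_functions_def rescale_def)
    moreover have "(\<lambda>w. l (0, snd w)) \<in> homogeneous_functions rescale 1"
    proof -
      have "(0, snd (rescale t w)) = scale_sum sU sV t (0, snd w)" for t w
        by (simp add: rescale_def scale_sum_def case_prod_beta)
      then show ?thesis using LinD(2)[OF l] by (simp add: homogeneous_functions_def)
    qed
    ultimately show "l \<in> algebra_generated (Lin m \<inter> (homogeneous_functions rescale 0 \<union> homogeneous_functions rescale 1))"
      using Lin_V[OF l] by (subst Lin_split[OF l]) (intro algebra_generated.add algebra_generated.incl; blast)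
  qed
  show "(\<lambda>w. l (diag g w)) \<in> algebra_generated (Lin m)" if "g \<in> carrier G" "l \<in> Lin m" for g l
    using that by (intro algebra_generated.incl diag_Lin)
qed (simp_all add: diag_one diag_mult diag_rescale)

theorem polarization_generates:
  assumes S: "algebra_generated S = Inv n" and "n \<le> m" and B: "card B \<le> n"
    and beta: "CHAR('k) > 0 \<Longrightarrow> \<exists>N \<le> n * (CHAR('k) - 1). beta_group G TYPE('k) \<le> enat N"
  shows "algebra_generated (polarization sU sV m S) = Inv m"
proof
  have SI: "S \<subseteq> Inv m" using S Inv_mono[OF \<open>n \<le> m\<close>] by (auto intro: algebra_generated.incl)
  have "polarization sU sV m S \<subseteq> Inv m"
    unfolding polarization_def using SI Inv_GL_submodule by (rule hull_minimal)
  then have "algebra_generated (polarization sU sV m S) \<subseteq> algebra_generated (Inv m)"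
    by (intro algebra_generated_mono) (auto intro: algebra_generated.incl)
  then show "algebra_generated (polarization sU sV m S) \<subseteq> Inv m" using Inv_algebra by blast
  have "S \<subseteq> polarization sU sV m S" unfolding polarization_def by (rule hull_subset)
  then have n: "Inv n \<subseteq> algebra_generated (polarization sU sV m S)"
    unfolding S[symmetric] by (intro algebra_generated_mono) (auto intro: algebra_generated.incl)
  have sub: "funs.subspace (GL_span n m)" unfolding GL_span_def by (rule funs.subspace_span)
  show "Inv m \<subseteq> algebra_generated (polarization sU sV m S)"
  proof (cases "CHAR('k) = 0")
    case True
    have nz: "of_nat k \<noteq> (0::'k)" if "k > 0" for k using True that by (simp add: of_nat_eq_0_iff_char_dvd)
    have "card (carrier G) > 0" using fin one_closed by (auto simp: card_gt_0_iff)
    then have card: "of_nat (card (carrier G)) \<noteq> (0::'k)" by (rule nz)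
    \<comment> \<open>All q are admissible here, and q = d is large enough if n > 0. If n = 0, then
      V = 0 and only degree 0 occurs.\<close>
    have mons: "mons m d \<subseteq> GL_span n m" for d
    proof (cases "n = 0")
      case True
      then have "B = {}" using B V.finite_Basis by simp
      have "d = 0" if f: "f \<in> mons m d" for f
      proof -
        obtain c where "(\<Sum>i<m. row_sum B c i) = d" using f unfolding mons_def by blast
        then show ?thesis using \<open>B = {}\<close> by (simp add: row_sum_def)
      qed
      then show ?thesis using mons_GL_span[OF B \<open>n \<le> m\<close> nz, where q = 0 and d = 0] by blast
    next
      case False
      then have "d \<le> n * d" by simp
      then show ?thesis by (intro mons_GL_span[OF B \<open>n \<le> m\<close> nz])
    qed
    have "f \<in> GL_span n m" if fP: "f \<in> Pol m" for f
    proof -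
      obtain D F where F: "f = (\<Sum>e\<le>D. F e)" "\<And>e. F e \<in> funs.span (mons m e)"
        using Pol_graded[OF fP] by (auto simp: graded_sums_def)
      have "F e \<in> GL_span n m" for e using F(2)[of e] funs.span_minimal[OF mons sub, of e] by blast
      then show ?thesis unfolding F(1) by (intro funs.subspace_sum[OF sub])
    qed
    then show ?thesis using GL_span_Inv[OF n card] by (auto simp: Inv_iff)
  next
    case False
    let ?q = "CHAR('k) - 1"
    obtain N where N: "N \<le> n * ?q" "beta_group G TYPE('k) \<le> enat N" using beta False by auto
    have card: "of_nat (card (carrier G)) \<noteq> (0::'k)"
      using inf group_axioms fin N(2) by (rule card_group_nonzero)
    have q: "of_nat k \<noteq> (0::'k)" if "0 < k" "k \<le> ?q" for k
      using that by (auto simp: of_nat_eq_0_iff_char_dvd dest: dvd_imp_le)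
    show ?thesis
    proof
      fix f assume f: "f \<in> Inv m"
      have "f \<in> algebra_generated {h. (\<exists>d\<le>N. h \<in> copies.A_hom m d) \<and> (\<forall>g\<in>carrier G. \<forall>w. h (diag g w) = h w)}"
        using f by (intro copies.invariants_generated[OF fin N(2)]) (auto simp: Inv_iff polynomial_functions_def)
      moreover have "{h. (\<exists>d\<le>N. h \<in> copies.A_hom m d) \<and> (\<forall>g\<in>carrier G. \<forall>w. h (diag g w) = h w)}
          \<subseteq> algebra_generated (polarization sU sV m S)"
      proof clarify
        fix h d assume h: "d \<le> N" "h \<in> algebra_generated (Lin m)" "h \<in> homogeneous_functions rescale d"
          "\<forall>g\<in>carrier G. \<forall>w. h (diag g w) = h w"
        have hP: "h \<in> Pol m" using h(2) by (simp add: polynomial_functions_def)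
        have "mons m d \<subseteq> GL_span n m"
          using h(1) N(1) by (intro mons_GL_span[OF B \<open>n \<le> m\<close> q]) auto
        then have "h \<in> GL_span n m"
          using homogeneous_Pol_span_mons[OF hP h(3)] funs.span_minimal[OF _ sub] by blast
        moreover have "h \<in> Inv m" using hP h(4) by (simp add: Inv_iff)
        ultimately show "h \<in> algebra_generated (polarization sU sV m S)" by (rule GL_span_Inv[OF n card])
      qed
      ultimately show "f \<in> algebra_generated (polarization sU sV m S)"
        using algebra_generated_mono by blast
    qed
  qed
qed

end

theorem theorem6p1:
  fixes G :: "('g, 'x) monoid_scheme"
    and sU :: "'k::field \<Rightarrow> 'u::ab_group_add \<Rightarrow> 'u" and \<rho> :: "'g \<Rightarrow> 'u \<Rightarrow> 'u"
    and sV :: "'k \<Rightarrow> 'v::ab_group_add \<Rightarrow> 'v" and \<sigma> :: "'g \<Rightarrow> 'v \<Rightarrow> 'v"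
    and p :: ereal and n m :: nat
    and S :: "('u \<times> (nat \<Rightarrow> 'v) \<Rightarrow> 'k) set"
  assumes "infinite (UNIV :: 'k set)"
    and "p = (if CHAR('k) > 0 then ereal (real CHAR('k)) else \<infinity>)"
    and "group G" and "finite (carrier G)"
    and "representation G sU \<rho>" and "representation G sV \<sigma>"
    and "ereal (real n) \<ge> max (ereal (real (vector_space.dim sV UNIV)))
           (if CHAR('k) > 0 then ereal_of_enat (beta_group G TYPE('k)) / (p - 1) else 0)"
    and "algebra_generated S = invariant_polynomials G sU \<rho> sV \<sigma> n"
    and "n \<le> m"
  shows "algebra_generated (polarization sU sV m S) = invariant_polynomials G sU \<rho> sV \<sigma> m"
proof -
  obtain BU where BU: "finite_dimensional_vector_space sU BU" using assms(5) by (auto simp: representation_def)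
  obtain B where B: "finite_dimensional_vector_space sV B" using assms(6) by (auto simp: representation_def)
  interpret V: finite_dimensional_vector_space sV B by (rule B)
  have dim: "card B \<le> n" using assms(7) by (simp add: V.dim_UNIV)
  have "vector_copies sU sV B"
    using BU B assms(1) by (intro vector_copies.intro vector_copies_axioms.intro)
      (simp_all add: finite_dimensional_vector_space_def)
  then interpret group_vector_copies sU sV B G \<rho> \<sigma>
    using assms(3-6) by (intro group_vector_copies.intro group_vector_copies_axioms.intro)
  show ?thesis
  proof (rule polarization_generates[OF assms(8,9) dim])
    assume char: "CHAR('k) > 0"
    have "CHAR('k) \<noteq> Suc 0" by (rule CHAR_not_1)
    \<comment> \<open>Makes p - 1 positive, so that the quotient of extended reals may be cleared of
      its denominator.\<close>
    then have c: "CHAR('k) \<ge> 2" using char by linarith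
    have le: "ereal_of_enat (beta_group G TYPE('k)) / (ereal (real CHAR('k)) - 1) \<le> ereal (real n)"
      using assms(2,7) char by simp
    have c1: "ereal (real CHAR('k)) - 1 = ereal (real (CHAR('k) - 1))"
      using c by (simp add: one_ereal_def of_nat_diff)
    show "\<exists>N\<le>n * (CHAR('k) - 1). beta_group G TYPE('k) \<le> enat N"
    proof (cases "beta_group G TYPE('k)")
      case (enat N)
      have "real N / real (CHAR('k) - 1) \<le> real n" using le c unfolding c1 enat by simp
      then have "real N \<le> real n * real (CHAR('k) - 1)" using c by (simp add: divide_le_eq)
      then have "N \<le> n * (CHAR('k) - 1)" by (metis of_nat_le_iff of_nat_mult)
      then show ?thesis using enat by auto
    next
      case infinity
      \<comment> \<open>The quotient would exceed the finite n, so beta is finite; this finiteness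
        is also what makes |G| invertible in k.\<close>
      have "(\<infinity>::ereal) / ereal (real (CHAR('k) - 1)) = \<infinity>" using c by simp
      then show ?thesis using le unfolding c1 infinity by simp
    qed
  qed
qed

end
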